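(* Let $k$ be an algebraically closed field of characteristic $p\ge0$, $\delta\in k$, and $r,s\ge 0$ integers. Suppose that $(\lambda^L,\lambda^R)\in\Lambda^{r-a,s-a}$ and $(\mu^L,\mu^R)\in\Lambda^{r-b,s-b}$ for some $b-a=t\ge 0$. If the simple $B_{r,s}(\delta)$-modules $L_{r,s}(\lambda^L,\lambda^R)$ and $L_{r,s}(\mu^L,\mu^R)$ are in the same block, then $$t\delta+\sum_{d\in[\lambda^L]}c(d)+\sum_{d\in[\lambda^R]}c(d)-\sum_{d\in[\mu^L]}c(d)-\sum_{d\in[\mu^R]}c(d)=0$$ in $k$.
   Context: The walled Brauer algebra $B_{r,s}=B_{r,s}(\delta)$ has $k$-basis the diagrams defined as follows. There are northern nodes $1,\dots,r+s$ and southern nodes $\overline{1},\dots,\overline{r+s}$; a wall separates the nodes $i,\overline{i}$ with $i\le r$ (left) from those with $i>r$ (right). A diagram is a partition of all nodes into pairs such that every northern–southern pair (propagating line) has both nodes on the same side of the wall, and every pair of two northern nodes (northern arc) or two southern nodes (southern arc) has one node on each side. The product $AB$ is obtained by placing $A$ above $B$ and identifying $\overline{i}$ of $A$ with $i$ of $B$; $AB=\delta^{t}C$, where $C$ is the diagram obtained after deleting the $t$ closed components. $\Lambda^{a,b}$ is the set of pairs $(\lambda^L,\lambda^R)$ with $\lambda^L$ a partition of $a$ and $\lambda^R$ a partition of $b$; $\Lambda^{a,b}_{reg}$ is the subset with both partitions $p$-regular (no $p$ equal nonzero parts if $p>0$; no condition if $p=0$). For $(\lambda^L,\lambda^R)\in\Lambda^{r-t,s-t}$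 the cell module is $\Delta_{r,s}(\lambda^L,\lambda^R)=I^t\otimes_{k(\Sigma_{r-t}\times\Sigma_{s-t})}(S^{\lambda^L}\boxtimes S^{\lambda^R})$, where $S^{\lambda}$ is the Specht module (James' convention, $S^{(n)}$ trivial) and $I^t$ has basis the diagrams with $r+s$ northern nodes, $r-t$ left and $s-t$ right southern nodes, exactly $t$ northern arcs (each crossing the wall), and every southern node on a propagating line not crossing the wall. $B_{r,s}$ acts on $I^t$ by concatenation from above, with factor $\delta$ for each closed loop and result zero if there are fewer than $r+s-2t$ propagating lines; $\Sigma_{r-t}\times\Sigma_{s-t}$ permutes the southern nodes. The simple $B_{r,s}$-modules are the heads $L_{r,s}(\lambda^L,\lambda^R)$ of the $\Delta_{r,s}(\lambda^L,\lambda^R)$ with $(\lambda^L,\lambda^R)\in\Lambda^{r-t,s-t}_{reg}$, $0\le t\le\min(r,s)$ (omitting $(\emptyset,\emptyset)$ when $\delta=0$ and $r=s\ge1$); the symbols $L_{r,s}(\cdot)$ in the claim refer to such pairs. $[\lambda]$ is the Young diagram of $\lambda$, and the content of a box $d$ in row $i$ and column $j$ is $c(d)=j-i$. *)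

theory Defs
  imports
    "HOL-Algebra.Sym_Groups"
    "HOL-Algebra.Generated_Groups"
    "HOL-Algebra.Module"
    "HOL-Algebra.Algebraic_Closure_Type"
    "HOL-Algebra.Free_Abelian_Groups"
    "HOL-Combinatorics.Permutations"
    "HOL-Library.Disjoint_Sets"
    "HOL-Library.Poly_Mapping"
begin

section \<open>Modules over noncommutative rings\<close>

text \<open>
  The locale \<^locale>\<open>module\<close> of the library asks for a commutative ring of scalars, but the record
  type \<^typ>\<open>('a, 'b) module\<close> and the locale \<^locale>\<open>submodule\<close> do not, and they are used below
  for left modules over arbitrary rings. The fields \<^const>\<open>monoid.mult\<close> and \<^const>\<open>one\<close> of a
  module record carry no meaning. A right module is stored in the same record type, with
  \<open>a \<odot> m\<close> standing for \<open>m\<cdot>a\<close>.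
\<close>

definition quot_module :: "('a, 'b) module \<Rightarrow> 'b set \<Rightarrow> ('a, 'b set) module" where
  "quot_module M N =
    \<lparr>carrier = a_rcosets\<^bsub>M\<^esub> N, mult = undefined, one = undefined,
     ring.zero = N, add = (<+>\<^bsub>M\<^esub>),
     module.smult = (\<lambda>a U. N <+>\<^bsub>M\<^esub> ((\<lambda>x. a \<odot>\<^bsub>M\<^esub> x) ` U))\<rparr>"

definition maximal_submodule :: "'a ring \<Rightarrow> ('a, 'b) module \<Rightarrow> 'b set \<Rightarrow> bool" where
  "maximal_submodule R M N \<longleftrightarrow>
     submodule N R M \<and> N \<noteq> carrier M \<and>
     (\<forall>N'. submodule N' R M \<longrightarrow> N \<subseteq> N' \<longrightarrow> N' = N \<or> N' = carrier M)"

definition module_radical :: "'a ring \<Rightarrow> ('a, 'b) module \<Rightarrow> 'b set" where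
  "module_radical R M = carrier M \<inter> \<Inter>{N. maximal_submodule R M N}"

definition module_head :: "'a ring \<Rightarrow> ('a, 'b) module \<Rightarrow> ('a, 'b set) module" where
  "module_head R M = quot_module M (module_radical R M)"


section \<open>Tensor products\<close>

text \<open>
  \<open>tensor_product A M N act\<close> is \<open>M \<otimes>\<^sub>A N\<close> for a right \<open>A\<close>-module \<open>M\<close> and a left
  \<open>A\<close>-module \<open>N\<close>: the free abelian group on \<open>M \<times> N\<close> modulo the usual relations. Scalars \<open>b\<close> act by
  the additive extension of \<open>(m, n) \<mapsto> act b (m, n)\<close> to formal sums, passed to the quotient.
\<close>

definition tensor_relations ::
    "'a ring \<Rightarrow> ('a, 'm) module \<Rightarrow> ('a, 'n) module \<Rightarrow> ('m \<times> 'n \<Rightarrow>\<^sub>0 int) set" where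
  "tensor_relations A M N =
     {frag_of (m \<oplus>\<^bsub>M\<^esub> m', n) - frag_of (m, n) - frag_of (m', n) | m m' n.
        m \<in> carrier M \<and> m' \<in> carrier M \<and> n \<in> carrier N} \<union>
     {frag_of (m, n \<oplus>\<^bsub>N\<^esub> n') - frag_of (m, n) - frag_of (m, n') | m n n'.
        m \<in> carrier M \<and> n \<in> carrier N \<and> n' \<in> carrier N} \<union>
     {frag_of (a \<odot>\<^bsub>M\<^esub> m, n) - frag_of (m, a \<odot>\<^bsub>N\<^esub> n) | a m n.
        a \<in> carrier A \<and> m \<in> carrier M \<and> n \<in> carrier N}"

definition tensor_product ::
    "'a ring \<Rightarrow> ('a, 'm) module \<Rightarrow> ('a, 'n) module \<Rightarrow>
     ('b \<Rightarrow> 'm \<times> 'n \<Rightarrow> ('m \<times> 'n \<Rightarrow>\<^sub>0 int)) \<Rightarrow> ('b, ('m \<times> 'n \<Rightarrow>\<^sub>0 int) set) module" where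
  "tensor_product A M N act =
     (let F = free_Abelian_group (carrier M \<times> carrier N) in
      quot_module
        \<lparr>carrier = carrier F, mult = undefined, one = undefined, ring.zero = 0, add = (+),
         module.smult = (\<lambda>b. frag_extend (act b))\<rparr>
        (generate F (tensor_relations A M N)))"


section \<open>Blocks\<close>

definition central_idempotent :: "'a ring \<Rightarrow> 'a \<Rightarrow> bool" where
  "central_idempotent R e \<longleftrightarrow>
     e \<in> carrier R \<and> e \<otimes>\<^bsub>R\<^esub> e = e \<and> (\<forall>x\<in>carrier R. e \<otimes>\<^bsub>R\<^esub> x = x \<otimes>\<^bsub>R\<^esub> e)"

definition primitive_central_idempotent :: "'a ring \<Rightarrow> 'a \<Rightarrow> bool" where
  "primitive_central_idempotent R e \<longleftrightarrow>
     central_idempotent R e \<and> e \<noteq> \<zero>\<^bsub>R\<^esub> \<and>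
     (\<forall>f g. central_idempotent R f \<longrightarrow> central_idempotent R g \<longrightarrow>
        f \<otimes>\<^bsub>R\<^esub> g = \<zero>\<^bsub>R\<^esub> \<longrightarrow> e = f \<oplus>\<^bsub>R\<^esub> g \<longrightarrow> f = \<zero>\<^bsub>R\<^esub> \<or> g = \<zero>\<^bsub>R\<^esub>)"

text \<open>
  The blocks of \<open>R\<close> are the two-sided ideals \<open>Re\<close> with \<open>e\<close> a primitive central idempotent;
  a module belongs to the block \<open>Re\<close> if \<open>e\<close> acts on it as the identity.
\<close>

definition in_block :: "'a ring \<Rightarrow> 'a \<Rightarrow> ('a, 'b) module \<Rightarrow> bool" where
  "in_block R e M \<longleftrightarrow>
     primitive_central_idempotent R e \<and> (\<forall>x\<in>carrier M. e \<odot>\<^bsub>M\<^esub> x = x)"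

definition same_block :: "'a ring \<Rightarrow> ('a, 'b) module \<Rightarrow> ('a, 'c) module \<Rightarrow> bool" where
  "same_block R M N \<longleftrightarrow> (\<exists>e. in_block R e M \<and> in_block R e N)"


section \<open>Linear combinations\<close>

text \<open>The vector space with basis \<open>B\<close> is the set of \<open>x :: 'a \<Rightarrow>\<^sub>0 'k\<close> supported on \<open>B\<close>.\<close>

definition lin_comb :: "'a set \<Rightarrow> ('a \<Rightarrow>\<^sub>0 'k::field) set" where
  "lin_comb B = {x. Poly_Mapping.keys x \<subseteq> B}"

definition scale :: "'k::field \<Rightarrow> ('a \<Rightarrow>\<^sub>0 'k) \<Rightarrow> ('a \<Rightarrow>\<^sub>0 'k)" where
  "scale c = Poly_Mapping.map ((*) c)"

definition bilinear_extend ::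
    "('a \<Rightarrow> 'b \<Rightarrow> ('c \<Rightarrow>\<^sub>0 'k)) \<Rightarrow> ('a \<Rightarrow>\<^sub>0 'k) \<Rightarrow> ('b \<Rightarrow>\<^sub>0 'k) \<Rightarrow> ('c \<Rightarrow>\<^sub>0 'k::field)" where
  "bilinear_extend f x y =
     (\<Sum>a\<in>Poly_Mapping.keys x. \<Sum>b\<in>Poly_Mapping.keys y.
        scale (Poly_Mapping.lookup x a * Poly_Mapping.lookup y b) (f a b))"


section \<open>Group algebras\<close>

definition group_algebra :: "'g monoid \<Rightarrow> ('g \<Rightarrow>\<^sub>0 'k::field) ring" where
  "group_algebra G =
     \<lparr>carrier = lin_comb (carrier G),
      mult = bilinear_extend (\<lambda>g h. Poly_Mapping.single (g \<otimes>\<^bsub>G\<^esub> h) 1),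
      one = Poly_Mapping.single \<one>\<^bsub>G\<^esub> 1, ring.zero = 0, add = (+)\<rparr>"

definition restrict_to_field ::
    "'g monoid \<Rightarrow> ('g \<Rightarrow>\<^sub>0 'k, 'v) module \<Rightarrow> ('k::field, 'v) module" where
  "restrict_to_field G V =
     \<lparr>carrier = carrier V, mult = undefined, one = undefined,
      ring.zero = \<zero>\<^bsub>V\<^esub>, add = (\<oplus>\<^bsub>V\<^esub>),
      module.smult = (\<lambda>c v. Poly_Mapping.single \<one>\<^bsub>G\<^esub> c \<odot>\<^bsub>V\<^esub> v)\<rparr>"

text \<open>
  The outer tensor product \<open>V \<boxtimes> W\<close>: the space \<open>V \<otimes>\<^sub>k W\<close> on which
  \<open>c (g, h)\<close> acts by \<open>v \<otimes> w \<mapsto> c g v \<otimes> h w\<close>.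
\<close>

definition outer_tensor ::
    "'g monoid \<Rightarrow> 'h monoid \<Rightarrow> ('g \<Rightarrow>\<^sub>0 'k, 'v) module \<Rightarrow> ('h \<Rightarrow>\<^sub>0 'k, 'w) module \<Rightarrow>
     ('g \<times> 'h \<Rightarrow>\<^sub>0 'k::field, ('v \<times> 'w \<Rightarrow>\<^sub>0 int) set) module" where
  "outer_tensor G H V W =
     tensor_product ring_of_type_algebra (restrict_to_field G V) (restrict_to_field H W)
       (\<lambda>x (v, w). \<Sum>(g, h)\<in>Poly_Mapping.keys x.
          frag_of (Poly_Mapping.single g (Poly_Mapping.lookup x (g, h)) \<odot>\<^bsub>V\<^esub> v,
                   Poly_Mapping.single h 1 \<odot>\<^bsub>W\<^esub> w))"


section \<open>Partitions\<close>

definition is_partition :: "nat list \<Rightarrow> nat \<Rightarrow> bool" where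
  "is_partition \<alpha> n \<longleftrightarrow> sorted_wrt (\<ge>) \<alpha> \<and> 0 \<notin> set \<alpha> \<and> sum_list \<alpha> = n"

definition p_regular :: "nat \<Rightarrow> nat list \<Rightarrow> bool" where
  "p_regular p \<alpha> \<longleftrightarrow> (p > 0 \<longrightarrow> (\<forall>x\<in>set \<alpha>. count_list \<alpha> x < p))"

definition bipartitions :: "nat \<Rightarrow> nat \<Rightarrow> (nat list \<times> nat list) set" where
  "bipartitions a b = {(\<alpha>, \<beta>). is_partition \<alpha> a \<and> is_partition \<beta> b}"

definition regular_bipartitions :: "nat \<Rightarrow> nat \<Rightarrow> nat \<Rightarrow> (nat list \<times> nat list) set" where
  "regular_bipartitions p a b = {(\<alpha>, \<beta>) \<in> bipartitions a b. p_regular p \<alpha> \<and> p_regular p \<beta>}"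

definition young_diagram :: "nat list \<Rightarrow> (nat \<times> nat) set" where
  "young_diagram \<alpha> = {(i, j). 1 \<le> i \<and> i \<le> length \<alpha> \<and> 1 \<le> j \<and> j \<le> \<alpha> ! (i - 1)}"

definition box_content :: "nat \<times> nat \<Rightarrow> int" where
  "box_content d = int (snd d) - int (fst d)"


section \<open>Specht modules\<close>

definition tableaux :: "nat list \<Rightarrow> (nat \<times> nat \<Rightarrow> nat) set" where
  "tableaux \<alpha> = {T. bij_betw T (young_diagram \<alpha>) {1..sum_list \<alpha>}}"

text \<open>A tabloid is given by the sets of entries of its rows.\<close>

type_synonym tabloid = "nat \<Rightarrow> nat set"

definition tabloid_of :: "nat list \<Rightarrow> (nat \<times> nat \<Rightarrow> nat) \<Rightarrow> tabloid" where
  "tabloid_of \<alpha> T = (\<lambda>i. {T (i, j) | j. (i, j) \<in> young_diagram \<alpha>})"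

definition column_stabilizer :: "nat list \<Rightarrow> (nat \<times> nat \<Rightarrow> nat) \<Rightarrow> (nat \<Rightarrow> nat) set" where
  "column_stabilizer \<alpha> T =
     {\<pi>. \<pi> permutes {1..sum_list \<alpha>} \<and>
         (\<forall>(i, j)\<in>young_diagram \<alpha>. \<exists>i'. (i', j) \<in> young_diagram \<alpha> \<and> \<pi> (T (i, j)) = T (i', j))}"

definition polytabloid :: "nat list \<Rightarrow> (nat \<times> nat \<Rightarrow> nat) \<Rightarrow> (tabloid \<Rightarrow>\<^sub>0 'k::field)" where
  "polytabloid \<alpha> T =
     (\<Sum>\<pi>\<in>column_stabilizer \<alpha> T.
        Poly_Mapping.single (tabloid_of \<alpha> (\<pi> \<circ> T)) (of_int (sign \<pi>)))"

text \<open>The permutation module on tabloids; it contains James' Specht module.\<close>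

definition tabloid_module ::
    "nat list \<Rightarrow> ((nat \<Rightarrow> nat) \<Rightarrow>\<^sub>0 'k::field, tabloid \<Rightarrow>\<^sub>0 'k) module" where
  "tabloid_module \<alpha> =
     \<lparr>carrier = lin_comb (tabloid_of \<alpha> ` tableaux \<alpha>), mult = undefined, one = undefined,
      ring.zero = 0, add = (+),
      module.smult = bilinear_extend (\<lambda>\<sigma> t. Poly_Mapping.single (\<lambda>i. \<sigma> ` t i) 1)\<rparr>"

definition specht_module ::
    "nat list \<Rightarrow> ((nat \<Rightarrow> nat) \<Rightarrow>\<^sub>0 'k::field, tabloid \<Rightarrow>\<^sub>0 'k) module" where
  "specht_module \<alpha> = (tabloid_module \<alpha>)
     \<lparr>carrier := {\<Sum>T\<in>F. scale (c T) (polytabloid \<alpha> T) | F c. finite F \<and> F \<subseteq> tableaux \<alpha>}\<rparr>"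


section \<open>The walled Brauer algebra\<close>

datatype node = North nat | South nat

type_synonym diagram = "node set set"

text \<open>
  Diagrams with \<open>m\<close> left and \<open>n\<close> right northern nodes, and \<open>m'\<close> left and \<open>n'\<close> right southern nodes.
\<close>

definition nodes :: "nat \<Rightarrow> nat \<Rightarrow> node set" where
  "nodes N S = North ` {1..N} \<union> South ` {1..S}"

fun is_left :: "nat \<Rightarrow> nat \<Rightarrow> node \<Rightarrow> bool" where
  "is_left m m' (North i) \<longleftrightarrow> i \<le> m"
| "is_left m m' (South i) \<longleftrightarrow> i \<le> m'"

definition propagating_lines :: "diagram \<Rightarrow> node set set" where
  "propagating_lines D = {e \<in> D. \<exists>i j. e = {North i, South j}}"

definition northern_arcs :: "diagram \<Rightarrow> node set set" where
  "northern_arcs D = {e \<in> D. \<exists>i j. i \<noteq> j \<and> e = {North i, North j}}"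

definition southern_arcs :: "diagram \<Rightarrow> node set set" where
  "southern_arcs D = {e \<in> D. \<exists>i j. i \<noteq> j \<and> e = {South i, South j}}"

definition walled_diagrams :: "nat \<Rightarrow> nat \<Rightarrow> nat \<Rightarrow> nat \<Rightarrow> diagram set" where
  "walled_diagrams m n m' n' =
     {D. partition_on (nodes (m + n) (m' + n')) D \<and> (\<forall>e\<in>D. card e = 2) \<and>
         (\<forall>e\<in>propagating_lines D. \<forall>x\<in>e. \<forall>y\<in>e. is_left m m' x = is_left m m' y) \<and>
         (\<forall>e\<in>northern_arcs D \<union> southern_arcs D.
            \<forall>x\<in>e. \<forall>y\<in>e. x \<noteq> y \<longrightarrow> is_left m m' x \<noteq> is_left m m' y)}"

text \<open>
  To concatenate \<open>A\<close> (above) and \<open>B\<close> (below), the southern nodes of \<open>A\<close> and the northern nodes of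
  \<open>B\<close> are both sent to the points \<open>Mid i\<close>, and the connected components of the resulting graph on
  three rows of points are formed. A closed component has points in the middle row only; every
  other component gives a pair of nodes of the concatenated diagram.
\<close>

datatype point = Top nat | Mid nat | Bot nat

fun upper_point :: "node \<Rightarrow> point" where
  "upper_point (North i) = Top i"
| "upper_point (South i) = Mid i"

fun lower_point :: "node \<Rightarrow> point" where
  "lower_point (North i) = Mid i"
| "lower_point (South i) = Bot i"

fun outer_point :: "node \<Rightarrow> point" where
  "outer_point (North i) = Top i"
| "outer_point (South i) = Bot i"

definition components :: "diagram \<Rightarrow> diagram \<Rightarrow> point set set" where
  "components A B =
     (let E = (`) upper_point ` A \<union> (`) lower_point ` B
      in \<Union>E // (\<Union>e\<in>E. e \<times> e)\<^sup>+)"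

definition concat_diagram :: "diagram \<Rightarrow> diagram \<Rightarrow> diagram" where
  "concat_diagram A B = (\<lambda>K. outer_point -` K) ` components A B - {{}}"

definition closed_components :: "diagram \<Rightarrow> diagram \<Rightarrow> nat" where
  "closed_components A B = card {K \<in> components A B. K \<subseteq> range Mid}"

definition identity_diagram :: "nat \<Rightarrow> diagram" where
  "identity_diagram N = {{North i, South i} | i. i \<in> {1..N}}"

definition walled_brauer :: "'k::field \<Rightarrow> nat \<Rightarrow> nat \<Rightarrow> (diagram \<Rightarrow>\<^sub>0 'k) ring" where
  "walled_brauer \<delta> r s =
     \<lparr>carrier = lin_comb (walled_diagrams r s r s),
      mult = bilinear_extend
        (\<lambda>A B. Poly_Mapping.single (concat_diagram A B) (\<delta> ^ closed_components A B)),
      one = Poly_Mapping.single (identity_diagram (r + s)) 1, ring.zero = 0, add = (+)\<rparr>"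


section \<open>Cell modules and simple modules\<close>

text \<open>The basis of \<open>I\<^sup>t\<close>.\<close>

definition half_diagrams :: "nat \<Rightarrow> nat \<Rightarrow> nat \<Rightarrow> diagram set" where
  "half_diagrams r s t =
     {D \<in> walled_diagrams r s (r - t) (s - t).
        card (northern_arcs D) = t \<and>
        (\<forall>j\<in>{1..(r - t) + (s - t)}. \<exists>e\<in>propagating_lines D. South j \<in> e)}"

definition half_left_module ::
    "'k::field \<Rightarrow> nat \<Rightarrow> nat \<Rightarrow> nat \<Rightarrow> (diagram \<Rightarrow>\<^sub>0 'k, diagram \<Rightarrow>\<^sub>0 'k) module" where
  "half_left_module \<delta> r s t =
     \<lparr>carrier = lin_comb (half_diagrams r s t), mult = undefined, one = undefined,
      ring.zero = 0, add = (+),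
      module.smult = bilinear_extend
        (\<lambda>A D. if card (propagating_lines (concat_diagram A D)) < (r - t) + (s - t) then 0
               else Poly_Mapping.single (concat_diagram A D) (\<delta> ^ closed_components A D))\<rparr>"

text \<open>
  \<open>perm_south m (v, w)\<close> applies \<open>v\<close> to the southern nodes \<open>1, \<dots>, m\<close> and \<open>w\<close> to the ones to the
  right of the wall. The preimage under it makes \<open>half_right_module\<close> a right module for the group
  multiplication \<^const>\<open>comp\<close>: node \<open>j\<close> of \<open>D\<cdot>g\<close> is attached to what node \<open>g(j)\<close> of \<open>D\<close> is
  attached to, as for \<open>D\<close> placed above the diagram with the lines from \<open>g(j)\<close> to \<open>j\<close>.
\<close>

fun perm_south :: "nat \<Rightarrow> (nat \<Rightarrow> nat) \<times> (nat \<Rightarrow> nat) \<Rightarrow> node \<Rightarrow> node" where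
  "perm_south m (v, w) (North i) = North i"
| "perm_south m (v, w) (South j) = South (if j \<le> m then v j else m + w (j - m))"

definition half_right_module ::
    "nat \<Rightarrow> nat \<Rightarrow> nat \<Rightarrow>
     ((nat \<Rightarrow> nat) \<times> (nat \<Rightarrow> nat) \<Rightarrow>\<^sub>0 'k::field, diagram \<Rightarrow>\<^sub>0 'k) module" where
  "half_right_module r s t =
     \<lparr>carrier = lin_comb (half_diagrams r s t), mult = undefined, one = undefined,
      ring.zero = 0, add = (+),
      module.smult = bilinear_extend
        (\<lambda>g D. Poly_Mapping.single ((\<lambda>e. perm_south (r - t) g -` e) ` D) 1)\<rparr>"

type_synonym 'k specht_pair =
  "((tabloid \<Rightarrow>\<^sub>0 'k) \<times> (tabloid \<Rightarrow>\<^sub>0 'k) \<Rightarrow>\<^sub>0 int) set"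

type_synonym 'k cell_elem = "((diagram \<Rightarrow>\<^sub>0 'k) \<times> 'k specht_pair \<Rightarrow>\<^sub>0 int) set"

text \<open>
  In the next two definitions \<open>t\<close> is the number with \<open>\<alpha> \<in> bipartitions (r - t) (s - t)\<close>.
\<close>

definition cell_module ::
    "'k::field \<Rightarrow> nat \<Rightarrow> nat \<Rightarrow> nat \<Rightarrow> nat list \<times> nat list \<Rightarrow>
     (diagram \<Rightarrow>\<^sub>0 'k, 'k cell_elem) module" where
  "cell_module \<delta> r s t \<alpha> =
     (let G = sym_group (r - t); H = sym_group (s - t) in
      tensor_product (group_algebra (G \<times>\<times> H))
        (half_right_module r s t)
        (outer_tensor G H (specht_module (fst \<alpha>)) (specht_module (snd \<alpha>)))
        (\<lambda>b (x, y). frag_of (b \<odot>\<^bsub>half_left_module \<delta> r s t\<^esub> x, y)))"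

definition simple_module ::
    "'k::field \<Rightarrow> nat \<Rightarrow> nat \<Rightarrow> nat \<Rightarrow> nat list \<times> nat list \<Rightarrow>
     (diagram \<Rightarrow>\<^sub>0 'k, 'k cell_elem set) module" where
  "simple_module \<delta> r s t \<alpha> = module_head (walled_brauer \<delta> r s) (cell_module \<delta> r s t \<alpha>)"

definition simple_labels :: "'k::field \<Rightarrow> nat \<Rightarrow> nat \<Rightarrow> nat \<Rightarrow> (nat list \<times> nat list) set" where
  "simple_labels \<delta> r s t =
     {\<alpha> \<in> regular_bipartitions CHAR('k) (r - t) (s - t).
        t \<le> min r s \<and> \<not> (\<delta> = 0 \<and> r = s \<and> r \<ge> 1 \<and> \<alpha> = ([], []))}"

end

theory Submission
  imports Defs
begin

text \<open>
  The sum \<open>z\<close> of all transpositions that do not cross the wall, minus the sum of all diagrams with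
  one northern and one southern arc at the same two positions and vertical lines elsewhere, is
  central in \<open>B\<^sub>r\<^sub>,\<^sub>s\<close>. On a cell module with parameter \<open>t\<close> the arcs contribute \<open>- t \<delta>\<close>, and the
  remaining terms act by the class sums of transpositions on the two Specht modules, that is,
  by the sums of contents. Central elements act by one scalar on a block, so the values for
  \<open>\<lambda>\<close> and \<open>\<mu>\<close> agree. The heads of the cell modules must be nonzero here, since the
  zero module belongs to every block.
\<close>

section \<open>Central characters and blocks\<close>

text \<open>The obstacle is that products of diagrams are defined by connected components. Paths are
  avoided by reading a diagram as a 0/1 matrix indexed by the two-colourings of its two rows, with
  entry 1 where the colouring is constant on edges. Stacking multiplies these matrices, and a closed
  component shows up as a factor 2; associativity, products with generators, reflection and the
  group action on southern nodes become counts. Only the wall condition on a product still needs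
  paths, which an orientation controls. The sign of the arc terms makes z central: a transposition
  and an arc generator perform the same kind of surgery on edges, and moving one node to the other
  end of its edge turns one into the other. The characteristic is arbitrary, so neither
  semisimplicity nor division by 2 is available. Cancellations are arranged by pairing terms, and
  equality of scalars on a block comes from an annihilating polynomial of z. A nonzero head comes
  from a maximal submodule; that the cell module is nonzero is seen through a concrete balanced map,
  which relies on the group acting freely on half diagrams.\<close>

locale left_module = R: ring R + M: abelian_group M
  for R :: "'a ring" (structure) and M :: "('a, 'b) module" +
  assumes smult_closed: "\<lbrakk>a \<in> carrier R; x \<in> carrier M\<rbrakk> \<Longrightarrow> a \<odot>\<^bsub>M\<^esub> x \<in> carrier M"
    and smult_l_distr: "\<lbrakk>a \<in> carrier R; b \<in> carrier R; x \<in> carrier M\<rbrakk> \<Longrightarrow>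
      (a \<oplus>\<^bsub>R\<^esub> b) \<odot>\<^bsub>M\<^esub> x = a \<odot>\<^bsub>M\<^esub> x \<oplus>\<^bsub>M\<^esub> b \<odot>\<^bsub>M\<^esub> x"
    and smult_r_distr: "\<lbrakk>a \<in> carrier R; x \<in> carrier M; y \<in> carrier M\<rbrakk> \<Longrightarrow>
      a \<odot>\<^bsub>M\<^esub> (x \<oplus>\<^bsub>M\<^esub> y) = a \<odot>\<^bsub>M\<^esub> x \<oplus>\<^bsub>M\<^esub> a \<odot>\<^bsub>M\<^esub> y"
    and smult_assoc: "\<lbrakk>a \<in> carrier R; b \<in> carrier R; x \<in> carrier M\<rbrakk> \<Longrightarrow>
      (a \<otimes>\<^bsub>R\<^esub> b) \<odot>\<^bsub>M\<^esub> x = a \<odot>\<^bsub>M\<^esub> (b \<odot>\<^bsub>M\<^esub> x)"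
    and smult_one: "x \<in> carrier M \<Longrightarrow> \<one>\<^bsub>R\<^esub> \<odot>\<^bsub>M\<^esub> x = x"
begin

lemma smult_zero_left:
  assumes "x \<in> carrier M" shows "\<zero>\<^bsub>R\<^esub> \<odot>\<^bsub>M\<^esub> x = \<zero>\<^bsub>M\<^esub>"
  using smult_l_distr[of "\<zero>\<^bsub>R\<^esub>" "\<zero>\<^bsub>R\<^esub>" x] assms smult_closed[of "\<zero>\<^bsub>R\<^esub>" x]
    M.add.l_cancel_one' by auto

lemma smult_zero_right:
  assumes "a \<in> carrier R" shows "a \<odot>\<^bsub>M\<^esub> \<zero>\<^bsub>M\<^esub> = \<zero>\<^bsub>M\<^esub>"
  using smult_r_distr[of a "\<zero>\<^bsub>M\<^esub>" "\<zero>\<^bsub>M\<^esub>"] assms smult_closed[of a "\<zero>\<^bsub>M\<^esub>"]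
    M.add.l_cancel_one' by auto

text \<open>Finite generation makes the submodules that miss some generator closed under unions of chains.\<close>

lemma maximal_submodule_exists:
  assumes fin: "finite B" and sub: "B \<subseteq> carrier M"
    and gen: "\<And>N. submodule N R M \<Longrightarrow> B \<subseteq> N \<Longrightarrow> N = carrier M"
    and nz: "carrier M \<noteq> {\<zero>\<^bsub>M\<^esub>}"
  obtains N where "maximal_submodule R M N"
proof -
  define S where "S = {N. submodule N R M \<and> \<not> B \<subseteq> N}"
  have zero: "submodule {\<zero>\<^bsub>M\<^esub>} R M"
    by (auto simp: submodule_def submodule_axioms_def smult_zero_right
        group.triv_subgroup[OF M.a_group, simplified])
  have "\<exists>N\<in>S. \<forall>N'\<in>S. N \<subseteq> N' \<longrightarrow> N' = N"
  proof (rule subset_Zorn_nonempty)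
    \<comment> \<open>The zero submodule lies in \<open>S\<close>: if it contained \<open>B\<close>,
      it would be the whole nonzero module.\<close>
    show "S \<noteq> {}" using gen[OF zero] nz zero by (auto simp: S_def)
    fix C assume C: "C \<noteq> {}" "subset.chain S C"
    have CS: "C \<subseteq> S" and lin: "\<And>A D. A \<in> C \<Longrightarrow> D \<in> C \<Longrightarrow> A \<subseteq> D \<or> D \<subseteq> A"
      using C(2) by (auto simp: subset.chain_def)
    have sm: "\<And>A. A \<in> C \<Longrightarrow> submodule A R M" using CS by (auto simp: S_def)
    have "subgroup (\<Union>C) (add_monoid M)"
    proof (rule group.subgroupI[OF M.a_group])
      show "\<Union>C \<subseteq> carrier (add_monoid M)"
        using sm submodule.axioms(1) subgroup.subset by blast
      obtain A where "A \<in> C" using C by auto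
      then show "\<Union>C \<noteq> {}" using subgroup.one_closed[OF submodule.axioms(1)[OF sm]] by blast
      show "inv\<^bsub>add_monoid M\<^esub> a \<in> \<Union>C" if "a \<in> \<Union>C" for a
        using that subgroup.m_inv_closed[OF submodule.axioms(1)[OF sm]] by blast
      show "a \<otimes>\<^bsub>add_monoid M\<^esub> b \<in> \<Union>C" if ab: "a \<in> \<Union>C" "b \<in> \<Union>C" for a b
      proof -
        obtain A A' where AB: "A \<in> C" "A' \<in> C" "a \<in> A" "b \<in> A'" using ab by auto
        obtain D where D: "D \<in> C" "a \<in> D" "b \<in> D" using lin[OF AB(1,2)] AB by blast
        then show ?thesis using subgroup.m_closed[OF submodule.axioms(1)[OF sm]] by blast
      qed
    qed
    moreover have "\<lbrakk>a \<in> carrier R; x \<in> \<Union>C\<rbrakk> \<Longrightarrow> a \<odot>\<^bsub>M\<^esub> x \<in> \<Union>C" for a x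
      using submodule.smult_closed[OF sm] by blast
    ultimately have "submodule (\<Union>C) R M"
      by (auto simp: submodule_def submodule_axioms_def)
    moreover have "\<not> B \<subseteq> \<Union>C"
    proof
      assume BC: "B \<subseteq> \<Union>C"
      obtain A where "A \<in> C" "B \<subseteq> A"
        using finite_subset_Union_chain[OF fin BC C(1)] C(2) by (auto simp: subset.chain_def)
      then show False using CS by (auto simp: S_def)
    qed
    ultimately show "\<Union>C \<in> S" by (auto simp: S_def)
  qed
  then obtain N where N: "N \<in> S" "\<And>N'. N' \<in> S \<Longrightarrow> N \<subseteq> N' \<Longrightarrow> N' = N" by blast
  have "maximal_submodule R M N"
    unfolding maximal_submodule_def
  proof (intro conjI allI impI)
    show "submodule N R M" "N \<noteq> carrier M" using N(1) sub by (auto simp: S_def)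
    fix N' assume "submodule N' R M" "N \<subseteq> N'"
    then show "N' = N \<or> N' = carrier M" using N(2)[of N'] gen[of N'] by (auto simp: S_def)
  qed
  then show thesis by (rule that)
qed

text \<open>Acting trivially on the head fixes \<open>x\<close> only modulo the radical. The radical
  lies in every maximal submodule, so the congruence survives modulo \<open>N\<close>.\<close>

lemma trivial_on_headD:
  assumes triv: "\<forall>x\<in>carrier (module_head R M). e \<odot>\<^bsub>module_head R M\<^esub> x = x"
    and e: "e \<in> carrier R" and N: "maximal_submodule R M N" and x: "x \<in> carrier M"
  obtains n where "n \<in> N" "e \<odot>\<^bsub>M\<^esub> x = n \<oplus>\<^bsub>M\<^esub> x"
proof -
  define J where "J = module_radical R M"
  have JN: "J \<subseteq> N" using N by (auto simp: J_def module_radical_def)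
  have J0: "\<zero>\<^bsub>M\<^esub> \<in> J"
    by (auto simp: J_def module_radical_def maximal_submodule_def submodule_def
        dest: subgroup.one_closed)
  have el: "J +>\<^bsub>M\<^esub> x \<in> carrier (module_head R M)"
    using x by (auto simp: module_head_def quot_module_def J_def A_RCOSETS_def RCOSETS_def a_r_coset_def)
  have "J <+>\<^bsub>M\<^esub> ((\<lambda>x. e \<odot>\<^bsub>M\<^esub> x) ` (J +>\<^bsub>M\<^esub> x)) = J +>\<^bsub>M\<^esub> x"
    using bspec[OF triv el] by (auto simp: module_head_def quot_module_def J_def)
  moreover have "x \<in> J +>\<^bsub>M\<^esub> x"
    using J0 x by (force simp: a_r_coset_def r_coset_def)
  then have "\<zero>\<^bsub>M\<^esub> \<oplus>\<^bsub>M\<^esub> e \<odot>\<^bsub>M\<^esub> x \<in> J <+>\<^bsub>M\<^esub> ((\<lambda>x. e \<odot>\<^bsub>M\<^esub> x) ` (J +>\<^bsub>M\<^esub> x))"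
    using J0 by (force simp: set_add_def set_mult_def)
  ultimately have "e \<odot>\<^bsub>M\<^esub> x \<in> J +>\<^bsub>M\<^esub> x" using x e smult_closed by auto
  then show thesis using that JN by (auto simp: a_r_coset_def r_coset_def)
qed

end

section \<open>Polynomials in a central element\<close>

locale algebra_over_field = ring R for R :: "'a ring" (structure) +
  fixes \<eta> :: "'k::field \<Rightarrow> 'a"
  assumes scalar_closed: "\<eta> c \<in> carrier R"
    and scalar_add: "\<eta> (c + d) = \<eta> c \<oplus> \<eta> d"
    and scalar_mult: "\<eta> (c * d) = \<eta> c \<otimes> \<eta> d"
    and scalar_one: "\<eta> 1 = \<one>"
    and scalar_central: "x \<in> carrier R \<Longrightarrow> \<eta> c \<otimes> x = x \<otimes> \<eta> c"
begin

text \<open>Horner's scheme. The coefficients enter through the central map \<open>\<eta>\<close>,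
  so that a polynomial over the field type is evaluated in a ring given by a record.\<close>

definition eval_poly :: "'a \<Rightarrow> 'k poly \<Rightarrow> 'a" where
  "eval_poly z p = fold_coeffs (\<lambda>c y. \<eta> c \<oplus> z \<otimes> y) p \<zero>"

lemma scalar_zero: "\<eta> 0 = \<zero>"
  using scalar_add[of 0 0] scalar_closed[of 0] add.l_cancel_one' by auto

context
  fixes z assumes z: "z \<in> carrier R" and zc: "\<And>x. x \<in> carrier R \<Longrightarrow> z \<otimes> x = x \<otimes> z"
begin

lemma eval_poly_0: "eval_poly z 0 = \<zero>"
  by (simp add: eval_poly_def)

lemma eval_poly_pCons: "eval_poly z (pCons c p) = \<eta> c \<oplus> z \<otimes> eval_poly z p"
  using z by (cases "p = 0 \<and> c = 0") (auto simp: eval_poly_def scalar_zero)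

lemma eval_poly_closed: "eval_poly z p \<in> carrier R"
  by (induction p) (auto simp: eval_poly_0 eval_poly_pCons scalar_closed z)

lemma eval_poly_add: "eval_poly z (p + q) = eval_poly z p \<oplus> eval_poly z q"
proof (induction p q rule: poly_induct2)
  case 0 then show ?case by (simp add: eval_poly_0)
next
  case (pCons a p b q)
  have [simp]: "\<eta> a \<in> carrier R" "\<eta> b \<in> carrier R" "eval_poly z p \<in> carrier R" "eval_poly z q \<in> carrier R"
    by (auto simp: scalar_closed eval_poly_closed)
  show ?case using pCons z
    by (simp add: eval_poly_pCons scalar_add) (simp add: r_distr a_ac)
qed

lemma eval_poly_smult: "eval_poly z (smult c p) = \<eta> c \<otimes> eval_poly z p"
proof (induction p)
  case 0 then show ?case by (simp add: eval_poly_0 scalar_closed)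
next
  case (pCons a p)
  have [simp]: "\<And>a. \<eta> a \<in> carrier R" "eval_poly z p \<in> carrier R"
    by (auto simp: scalar_closed eval_poly_closed)
  have "z \<otimes> (\<eta> c \<otimes> eval_poly z p) = \<eta> c \<otimes> (z \<otimes> eval_poly z p)"
    using z scalar_central[of z c] by (simp add: m_assoc[symmetric])
  then show ?case using pCons z
    by (simp add: eval_poly_pCons scalar_mult) (simp add: r_distr)
qed

lemma eval_poly_mult: "eval_poly z (p * q) = eval_poly z p \<otimes> eval_poly z q"
proof (induction p)
  case 0 then show ?case by (simp add: eval_poly_0 eval_poly_closed)
next
  case (pCons a p)
  have [simp]: "\<And>a. \<eta> a \<in> carrier R" "\<And>p. eval_poly z p \<in> carrier R"
    by (auto simp: scalar_closed eval_poly_closed)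
  show ?case using pCons z
    by (simp add: eval_poly_pCons eval_poly_add eval_poly_smult scalar_zero)
      (simp add: l_distr m_assoc)
qed

lemma eval_poly_1: "eval_poly z 1 = \<one>"
  using z by (simp add: one_pCons eval_poly_pCons eval_poly_0 scalar_one)

lemma eval_poly_central:
  assumes "x \<in> carrier R" shows "eval_poly z p \<otimes> x = x \<otimes> eval_poly z p"
proof (induction p)
  case 0 then show ?case using assms by (simp add: eval_poly_0)
next
  case (pCons a p)
  have [simp]: "\<And>a. \<eta> a \<in> carrier R" "\<And>p. eval_poly z p \<in> carrier R"
    by (auto simp: scalar_closed eval_poly_closed)
  have "z \<otimes> eval_poly z p \<otimes> x = z \<otimes> x \<otimes> eval_poly z p"
    using assms z pCons by (simp add: m_assoc)
  also have "\<dots> = x \<otimes> (z \<otimes> eval_poly z p)"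
    using assms z by (simp add: zc m_assoc)
  finally show ?case using assms z
    by (simp add: eval_poly_pCons l_distr r_distr scalar_central)
qed

lemma eval_poly_act:
  assumes M: "left_module R M" and x: "x \<in> carrier M"
    and act: "\<And>x. x \<in> carrier M \<Longrightarrow> z \<odot>\<^bsub>M\<^esub> x = \<eta> \<chi> \<odot>\<^bsub>M\<^esub> x"
  shows "eval_poly z p \<odot>\<^bsub>M\<^esub> x = \<eta> (poly p \<chi>) \<odot>\<^bsub>M\<^esub> x"
proof -
  interpret M: left_module R M by (fact M)
  show ?thesis
  proof (induction p)
    case 0 then show ?case by (simp add: eval_poly_0 scalar_zero)
  next
    case (pCons a p)
    have [simp]: "\<And>a. \<eta> a \<in> carrier R" "\<And>p. eval_poly z p \<in> carrier R"
      by (auto simp: scalar_closed eval_poly_closed)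
    show ?case using x z
      by (simp add: eval_poly_pCons M.smult_l_distr M.smult_assoc act M.smult_closed pCons
          scalar_add scalar_mult)
  qed
qed

text \<open>Since \<open>e x\<close> is \<open>x\<close> modulo \<open>N\<close>, applying
  \<open>p\<close> at \<open>z\<close> to it gives both zero and \<open>poly p \<chi>\<close> times
  \<open>x\<close> modulo \<open>N\<close>. If that scalar were invertible, a vector chosen outside
  \<open>N\<close> would lie in \<open>N\<close>. The existence of \<open>N\<close> is where a
  nonzero head enters.\<close>

lemma eval_poly_block_root:
  assumes M: "left_module R M"
    and act: "\<And>x. x \<in> carrier M \<Longrightarrow> z \<odot>\<^bsub>M\<^esub> x = \<eta> \<chi> \<odot>\<^bsub>M\<^esub> x"
    and N: "maximal_submodule R M N"
    and e: "e \<in> carrier R" "\<forall>x\<in>carrier (module_head R M). e \<odot>\<^bsub>module_head R M\<^esub> x = x"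
    and zero: "eval_poly z p \<otimes> e = \<zero>"
  shows "poly p \<chi> = 0"
proof (rule ccontr)
  interpret M: left_module R M by (fact M)
  assume nz: "poly p \<chi> \<noteq> 0"
  have sN: "submodule N R M" and "N \<noteq> carrier M" using N by (auto simp: maximal_submodule_def)
  have gN: "subgroup N (add_monoid M)" using sN by (rule submodule.axioms(1))
  then obtain x where x: "x \<in> carrier M" "x \<notin> N"
    using \<open>N \<noteq> carrier M\<close> subgroup.subset[OF gN] by auto
  obtain n where n: "n \<in> N" "e \<odot>\<^bsub>M\<^esub> x = n \<oplus>\<^bsub>M\<^esub> x"
    using M.trivial_on_headD[OF e(2,1) N x(1)] .
  have nM: "n \<in> carrier M" using n subgroup.subset[OF gN] by auto
  define y where "y = eval_poly z p \<odot>\<^bsub>M\<^esub> x"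
  define m where "m = eval_poly z p \<odot>\<^bsub>M\<^esub> n"
  have m: "m \<in> N" "m \<in> carrier M"
    using submodule.smult_closed[OF sN eval_poly_closed n(1)] M.smult_closed[OF eval_poly_closed nM]
    by (auto simp: m_def)
  have yM: "y \<in> carrier M" using M.smult_closed[OF eval_poly_closed x(1)] by (simp add: y_def)
  have "m \<oplus>\<^bsub>M\<^esub> y = eval_poly z p \<odot>\<^bsub>M\<^esub> (e \<odot>\<^bsub>M\<^esub> x)"
    using nM x by (simp add: n y_def m_def M.smult_r_distr eval_poly_closed)
  also have "\<dots> = \<zero>\<^bsub>M\<^esub>"
    using x e by (simp add: M.smult_assoc[symmetric] eval_poly_closed zero M.smult_zero_left)
  finally have "y = \<ominus>\<^bsub>M\<^esub> m" using yM m M.M.minus_equality[of y m] M.M.a_comm[of m y] by simp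
  then have "y \<in> N" using subgroup.m_inv_closed[OF gN m(1)] by (simp add: a_inv_def)
  then have "\<eta> (poly p \<chi>) \<odot>\<^bsub>M\<^esub> x \<in> N" using eval_poly_act[OF M x(1) act] by (simp add: y_def)
  then have "\<eta> (inverse (poly p \<chi>)) \<odot>\<^bsub>M\<^esub> (\<eta> (poly p \<chi>) \<odot>\<^bsub>M\<^esub> x) \<in> N"
    using submodule.smult_closed[OF sN scalar_closed] by blast
  then have "\<eta> (inverse (poly p \<chi>) * poly p \<chi>) \<odot>\<^bsub>M\<^esub> x \<in> N"
    using x by (simp add: scalar_mult scalar_closed M.smult_assoc)
  then show False using nz x by (simp add: scalar_one M.smult_one)
qed

text \<open>
  Write an annihilating polynomial of \<open>z\<close> as \<open>(X - \<chi>)\<^sup>k Q\<close> with \<open>Q(\<chi>) \<noteq> 0\<close> and put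
  \<open>w = 1 - Q/Q(\<chi>)\<close>. Then \<open>w\<^sup>k\<close> and \<open>1 - w\<^sup>k\<close> are orthogonal idempotents at \<open>z\<close>; they
  take the values \<open>0, 1\<close> at \<open>\<chi>\<close> and \<open>1, 0\<close> at any other eigenvalue \<open>\<chi>'\<close> of \<open>z\<close>.
\<close>

lemma same_block_imp_eq_char:
  assumes M: "left_module R M" "left_module R M'"
    and act: "\<And>x. x \<in> carrier M \<Longrightarrow> z \<odot>\<^bsub>M\<^esub> x = \<eta> \<chi> \<odot>\<^bsub>M\<^esub> x"
      "\<And>x. x \<in> carrier M' \<Longrightarrow> z \<odot>\<^bsub>M'\<^esub> x = \<eta> \<chi>' \<odot>\<^bsub>M'\<^esub> x"
    and N: "maximal_submodule R M N" "maximal_submodule R M' N'"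
    and blk: "same_block R (module_head R M) (module_head R M')"
    and P: "P \<noteq> 0" "eval_poly z P = \<zero>"
  shows "\<chi> = \<chi>'"
proof (rule ccontr)
  assume ne: "\<chi> \<noteq> \<chi>'"
  obtain e where prim: "primitive_central_idempotent R e"
    and e1: "\<forall>x\<in>carrier (module_head R M). e \<odot>\<^bsub>module_head R M\<^esub> x = x"
    and e2: "\<forall>x\<in>carrier (module_head R M'). e \<odot>\<^bsub>module_head R M'\<^esub> x = x"
    using blk by (auto simp: same_block_def in_block_def)
  have e: "e \<in> carrier R" "e \<otimes> e = e" and ec: "\<And>x. x \<in> carrier R \<Longrightarrow> e \<otimes> x = x \<otimes> e"
    using prim unfolding primitive_central_idempotent_def central_idempotent_def by blast+
  note root = eval_poly_block_root[OF M(1) act(1) N(1) e(1) e1]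
  note root' = eval_poly_block_root[OF M(2) act(2) N(2) e(1) e2]
  have Pe: "eval_poly z P \<otimes> e = \<zero>" using e P by simp
  define k where "k = order \<chi> P"
  obtain Q where Q: "P = [:-\<chi>, 1:] ^ k * Q" "\<not> [:-\<chi>, 1:] dvd Q"
    using order_decomp[OF P(1), of \<chi>] by (auto simp: k_def)
  have Q1: "poly Q \<chi> \<noteq> 0" using Q(2) by (simp add: poly_eq_0_iff_dvd)
  \<comment> \<open>At \<open>z\<close>, \<open>P\<close> annihilates \<open>e\<close> too, so both
    eigenvalues are roots of \<open>P\<close>. Hence \<open>k\<close> is positive and, as the
    eigenvalues differ, the root \<open>\<chi>'\<close> belongs to \<open>Q\<close>.\<close>
  have k: "k \<noteq> 0" using root[OF _ Pe] P(1) by (auto simp: k_def order_root)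
  have Q2: "poly Q \<chi>' = 0" using root'[OF _ Pe] ne by (simp add: Q)
  define w where "w = 1 - smult (inverse (poly Q \<chi>)) Q"
  have w1: "poly w \<chi> = 0" and w2: "poly w \<chi>' = 1" using Q1 Q2 by (auto simp: w_def)
  have "[:-\<chi>, 1:] dvd w" using w1 by (simp add: poly_eq_0_iff_dvd)
  then have d1: "[:-\<chi>, 1:] ^ k dvd w ^ k" by (rule dvd_power_same)
  have "1 - w dvd 1 - w ^ k" by (simp add: one_diff_power_eq)
  then have "smult (inverse (poly Q \<chi>)) Q dvd 1 - w ^ k" by (simp add: w_def)
  then have "Q dvd 1 - w ^ k" using smult_dvd_cancel by blast
  \<comment> \<open>The factor \<open>w ^ k\<close> supplies the power of \<open>X - \<chi>\<close>
    and the factor \<open>1 - w ^ k\<close> supplies \<open>Q\<close>, so the product vanishes at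
    \<open>z\<close>.\<close>
  then have "P dvd w ^ k * (1 - w ^ k)" using d1 mult_dvd_mono unfolding Q by blast
  then obtain S where S: "w ^ k * (1 - w ^ k) = P * S" by (auto simp: dvd_def)
  define f where "f = eval_poly z (w ^ k) \<otimes> e"
  define g where "g = eval_poly z (1 - w ^ k) \<otimes> e"
  note [simp] = eval_poly_closed e
  have mult_e: "(eval_poly z p \<otimes> e) \<otimes> (eval_poly z q \<otimes> e) = eval_poly z (p * q) \<otimes> e" for p q
  proof -
    have "(eval_poly z p \<otimes> e) \<otimes> (eval_poly z q \<otimes> e) = eval_poly z p \<otimes> (e \<otimes> eval_poly z q) \<otimes> e"
      by (simp add: m_assoc)
    also have "\<dots> = eval_poly z p \<otimes> eval_poly z q \<otimes> (e \<otimes> e)"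
      by (simp only: ec[OF eval_poly_closed]) (simp add: m_assoc)
    finally show ?thesis by (simp add: eval_poly_mult)
  qed
  have zero: "eval_poly z (w ^ k * (1 - w ^ k)) \<otimes> e = \<zero>"
    unfolding S eval_poly_mult using P by simp
  have fg: "f \<otimes> g = \<zero>" using zero by (simp add: f_def g_def mult_e)
  have gf: "g \<otimes> f = \<zero>" using zero by (simp add: f_def g_def mult_e mult.commute)
  have sum: "f \<oplus> g = e"
  proof -
    have "f \<oplus> g = eval_poly z (w ^ k + (1 - w ^ k)) \<otimes> e"
      unfolding f_def g_def eval_poly_add by (simp add: l_distr)
    then show ?thesis by (simp add: eval_poly_1)
  qed
  have cl: "f \<in> carrier R" "g \<in> carrier R" by (auto simp: f_def g_def)
  have comm: "eval_poly z p \<otimes> e \<otimes> x = x \<otimes> (eval_poly z p \<otimes> e)" if "x \<in> carrier R" for p x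
  proof -
    have "eval_poly z p \<otimes> e \<otimes> x = eval_poly z p \<otimes> x \<otimes> e"
      using that ec[OF that] by (simp add: m_assoc)
    then show ?thesis using that eval_poly_central[OF that] by (simp add: m_assoc)
  qed
  \<comment> \<open>Idempotency: expand \<open>f\<close> times \<open>e = f + g\<close> and use that
    \<open>f\<close> times \<open>g\<close> is zero.\<close>
  have "f \<otimes> e = f" "g \<otimes> e = g" by (auto simp: f_def g_def m_assoc)
  then have "f \<otimes> f = f" "g \<otimes> g = g"
    using cl fg gf r_distr[of f g f] r_distr[of f g g] sum by auto
  moreover have "f \<otimes> x = x \<otimes> f" "g \<otimes> x = x \<otimes> g" if "x \<in> carrier R" for x
    unfolding f_def g_def by (rule comm[OF that])+
  ultimately have "central_idempotent R f" "central_idempotent R g"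
    using cl unfolding central_idempotent_def by blast+
  moreover have "\<forall>f g. central_idempotent R f \<longrightarrow> central_idempotent R g \<longrightarrow>
      f \<otimes> g = \<zero> \<longrightarrow> e = f \<oplus> g \<longrightarrow> f = \<zero> \<or> g = \<zero>"
    using prim unfolding primitive_central_idempotent_def by blast
  ultimately have "f = \<zero> \<or> g = \<zero>"
    using fg sum[symmetric] by (elim allE impE) assumption+
  \<comment> \<open>If \<open>f\<close> vanished, \<open>w ^ k\<close> would have the root
    \<open>\<chi>'\<close>, where its value is 1. If \<open>g\<close> vanished,
    \<open>1 - w ^ k\<close> would have the root \<open>\<chi>\<close>, where its value is
    1.\<close>
  then show False
  proof
    assume "f = \<zero>"
    then have "poly (w ^ k) \<chi>' = 0" unfolding f_def by (rule root'[rotated])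
    then show False using w2 by simp
  next
    assume "g = \<zero>"
    then have "poly (1 - w ^ k) \<chi> = 0" unfolding g_def by (rule root[rotated])
    then show False using w1 k by (simp add: power_0_left)
  qed
qed

end

end

section \<open>Linear combinations\<close>

lemma scale_lookup [simp]: "Poly_Mapping.lookup (scale c x) a = c * Poly_Mapping.lookup x a"
  by (simp add: scale_def Poly_Mapping.map.rep_eq when_def)

lemma scale_single [simp]: "scale c (Poly_Mapping.single a d) = Poly_Mapping.single a (c * d)"
  by (rule poly_mapping_eqI) (simp add: lookup_single when_def)

lemma scale_add: "scale c (x + y) = scale c x + scale c y"
  by (rule poly_mapping_eqI) (simp add: lookup_add algebra_simps)

lemma scale_add_left: "scale (c + d) x = scale c x + scale d x"
  by (rule poly_mapping_eqI) (simp add: lookup_add algebra_simps)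

lemma scale_scale [simp]: "scale c (scale d x) = scale (c * d) x"
  by (rule poly_mapping_eqI) (simp add: algebra_simps)

lemma scale_zero [simp]: "scale c 0 = 0"
  by (rule poly_mapping_eqI) simp

lemma scale_zero_left [simp]: "scale 0 x = 0"
  by (rule poly_mapping_eqI) simp

lemma scale_one [simp]: "scale 1 x = x"
  by (rule poly_mapping_eqI) simp

lemma scale_minus: "scale c (- x) = - scale c x"
  by (rule poly_mapping_eqI) simp

lemma scale_minus_left: "scale (- c) x = - scale c x"
  by (rule poly_mapping_eqI) simp

lemma scale_sum: "scale c (sum f A) = (\<Sum>a\<in>A. scale c (f a))"
  by (induction A rule: infinite_finite_induct) (auto simp: scale_add)

lemma scale_sum_left: "scale (sum f A) x = (\<Sum>a\<in>A. scale (f a) x)"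
  by (induction A rule: infinite_finite_induct) (auto simp: scale_add_left)

lemma keys_scale: "Poly_Mapping.keys (scale c x) \<subseteq> Poly_Mapping.keys x"
  by (auto simp: in_keys_iff)

lemma poly_mapping_sum_single:
  assumes "finite A" "Poly_Mapping.keys x \<subseteq> A"
  shows "(\<Sum>a\<in>A. Poly_Mapping.single a (Poly_Mapping.lookup x a)) = x"
proof (rule poly_mapping_eqI)
  fix b
  show "Poly_Mapping.lookup (\<Sum>a\<in>A. Poly_Mapping.single a (Poly_Mapping.lookup x a)) b = Poly_Mapping.lookup x b"
    using assms by (auto simp: lookup_sum lookup_single when_def sum.delta in_keys_iff)
qed

lemma lin_comb_add [simp, intro]: "x \<in> lin_comb B \<Longrightarrow> y \<in> lin_comb B \<Longrightarrow> x + y \<in> lin_comb B"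
  using Poly_Mapping.keys_add[of x y] by (auto simp: lin_comb_def)

lemma lin_comb_0 [simp, intro]: "0 \<in> lin_comb B"
  by (auto simp: lin_comb_def)

lemma lin_comb_uminus [simp, intro]: "x \<in> lin_comb B \<Longrightarrow> - x \<in> lin_comb B"
  by (auto simp: lin_comb_def in_keys_iff)

lemma lin_comb_scale [simp, intro]: "x \<in> lin_comb B \<Longrightarrow> scale c x \<in> lin_comb B"
  using keys_scale[of c x] by (auto simp: lin_comb_def)

lemma lin_comb_sum [simp, intro]: "(\<And>a. a \<in> A \<Longrightarrow> f a \<in> lin_comb B) \<Longrightarrow> sum f A \<in> lin_comb B"
  by (induction A rule: infinite_finite_induct) auto

lemma lin_comb_single [simp, intro]: "a \<in> B \<Longrightarrow> Poly_Mapping.single a c \<in> lin_comb B"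
  by (auto simp: lin_comb_def)

lemma lin_comb_induct [consumes 1, case_names zero single add]:
  assumes "x \<in> lin_comb B"
    and zero: "P 0" and single: "\<And>a c. a \<in> B \<Longrightarrow> P (Poly_Mapping.single a c)"
    and add: "\<And>x y. x \<in> lin_comb B \<Longrightarrow> y \<in> lin_comb B \<Longrightarrow> P x \<Longrightarrow> P y \<Longrightarrow> P (x + y)"
  shows "P x"
proof -
  have "finite A \<Longrightarrow> A \<subseteq> B \<Longrightarrow>
      P (\<Sum>a\<in>A. Poly_Mapping.single a (Poly_Mapping.lookup x a))" for A
    by (induction A rule: finite_induct) (auto simp: zero single intro!: add)
  from this[of "Poly_Mapping.keys x"] show ?thesis
    using assms(1) by (simp add: poly_mapping_sum_single lin_comb_def)
qed

text \<open>The support of a sum can be smaller than the union of the supports, so additivity is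
  proved by summing over a common finite superset, on which the extra terms vanish.\<close>

lemma bilinear_extend_superset:
  assumes "finite A" "Poly_Mapping.keys x \<subseteq> A" "finite B" "Poly_Mapping.keys y \<subseteq> B"
  shows "bilinear_extend f x y =
    (\<Sum>a\<in>A. \<Sum>b\<in>B. scale (Poly_Mapping.lookup x a * Poly_Mapping.lookup y b) (f a b))"
proof -
  have "bilinear_extend f x y = (\<Sum>a\<in>Poly_Mapping.keys x. \<Sum>b\<in>B.
      scale (Poly_Mapping.lookup x a * Poly_Mapping.lookup y b) (f a b))"
    unfolding bilinear_extend_def using assms
    by (intro sum.cong refl sum.mono_neutral_left) (auto simp: in_keys_iff)
  also have "\<dots> = (\<Sum>a\<in>A. \<Sum>b\<in>B.
      scale (Poly_Mapping.lookup x a * Poly_Mapping.lookup y b) (f a b))"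
    using assms by (intro sum.mono_neutral_left) (auto simp: in_keys_iff)
  finally show ?thesis .
qed

lemma bilinear_extend_add_left:
  "bilinear_extend f (x + x') y = bilinear_extend f x y + bilinear_extend f x' y"
proof -
  let ?A = "Poly_Mapping.keys x \<union> Poly_Mapping.keys x'"
  have "Poly_Mapping.keys (x + x') \<subseteq> ?A" by (rule Poly_Mapping.keys_add)
  then show ?thesis
    by (simp add: bilinear_extend_superset[of ?A _ "Poly_Mapping.keys y"] lookup_add
        distrib_right scale_add_left sum.distrib)
qed

lemma bilinear_extend_add_right:
  "bilinear_extend f x (y + y') = bilinear_extend f x y + bilinear_extend f x y'"
proof -
  let ?A = "Poly_Mapping.keys y \<union> Poly_Mapping.keys y'"
  have "Poly_Mapping.keys (y + y') \<subseteq> ?A" by (rule Poly_Mapping.keys_add)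
  then show ?thesis
    by (simp add: bilinear_extend_superset[of "Poly_Mapping.keys x" _ ?A] lookup_add
        distrib_left scale_add_left sum.distrib)
qed

lemma bilinear_extend_0 [simp]: "bilinear_extend f 0 y = 0" "bilinear_extend f x 0 = 0"
  by (auto simp: bilinear_extend_def)

lemma bilinear_extend_single [simp]:
  "bilinear_extend f (Poly_Mapping.single a c) (Poly_Mapping.single b d) = scale (c * d) (f a b)"
  by (simp add: bilinear_extend_superset[of "{a}" _ "{b}"])

lemma bilinear_extend_scale_left: "bilinear_extend f (scale c x) y = scale c (bilinear_extend f x y)"
  by (simp add: bilinear_extend_superset[of "Poly_Mapping.keys x" _ "Poly_Mapping.keys y"]
      keys_scale scale_sum mult.assoc)

lemma bilinear_extend_scale_right: "bilinear_extend f x (scale c y) = scale c (bilinear_extend f x y)"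
  by (simp add: bilinear_extend_superset[of "Poly_Mapping.keys x" _ "Poly_Mapping.keys y"]
      keys_scale scale_sum mult_ac)

lemma bilinear_extend_sum_left:
  "bilinear_extend f (sum g A) y = (\<Sum>a\<in>A. bilinear_extend f (g a) y)"
  by (induction A rule: infinite_finite_induct) (auto simp: bilinear_extend_add_left)

lemma bilinear_extend_sum_right:
  "bilinear_extend f x (sum g A) = (\<Sum>a\<in>A. bilinear_extend f x (g a))"
  by (induction A rule: infinite_finite_induct) (auto simp: bilinear_extend_add_right)

lemma bilinear_extend_closed:
  assumes "x \<in> lin_comb A" "y \<in> lin_comb B" "\<And>a b. a \<in> A \<Longrightarrow> b \<in> B \<Longrightarrow> f a b \<in> lin_comb C"
  shows "bilinear_extend f x y \<in> lin_comb C"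
  using assms unfolding bilinear_extend_def lin_comb_def[of A] lin_comb_def[of B]
  by (intro lin_comb_sum lin_comb_scale) auto

text \<open>Four different products are allowed so that one induction covers the ring law, the law
  of a left module and the action of the group algebra on pairs of tabloids.\<close>

lemma bilinear_extend_assoc:
  assumes x: "x \<in> lin_comb A" and y: "y \<in> lin_comb B" and z: "z \<in> lin_comb C"
    and basis: "\<And>a b c. a \<in> A \<Longrightarrow> b \<in> B \<Longrightarrow> c \<in> C \<Longrightarrow>
      bilinear_extend g (f a b) (Poly_Mapping.single c 1)
      = bilinear_extend h (Poly_Mapping.single a 1) (k b c)"
  shows "bilinear_extend g (bilinear_extend f x y) z = bilinear_extend h x (bilinear_extend k y z)"
  using x
proof (induction x rule: lin_comb_induct)
  case (single a c1)
  show ?case using y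
  proof (induction y rule: lin_comb_induct)
    case (single b c2)
    show ?case using z
    proof (induction z rule: lin_comb_induct)
      case (single c c3)
      have "bilinear_extend g (f a b) (scale c3 (Poly_Mapping.single c 1))
        = scale c3 (bilinear_extend h (Poly_Mapping.single a 1) (k b c))"
        unfolding bilinear_extend_scale_right using \<open>a \<in> A\<close> \<open>b \<in> B\<close> \<open>c \<in> C\<close> by (simp add: basis)
      moreover have "bilinear_extend h (scale c1 (Poly_Mapping.single a 1)) (k b c)
        = scale c1 (bilinear_extend h (Poly_Mapping.single a 1) (k b c))"
        by (rule bilinear_extend_scale_left)
      ultimately show ?case
        by (simp add: bilinear_extend_scale_left bilinear_extend_scale_right mult_ac)
    qed (auto simp: bilinear_extend_add_right)
  qed (auto simp: bilinear_extend_add_left bilinear_extend_add_right)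
qed (auto simp: bilinear_extend_add_left)

lemma bilinear_extend_commute_basis:
  assumes "x \<in> lin_comb A"
    and "\<And>a. a \<in> A \<Longrightarrow> bilinear_extend f z (Poly_Mapping.single a 1) = bilinear_extend f (Poly_Mapping.single a 1) z"
  shows "bilinear_extend f z x = bilinear_extend f x z"
  using assms(1)
proof (induction x rule: lin_comb_induct)
  case (single a c)
  have s: "Poly_Mapping.single a c = scale c (Poly_Mapping.single a 1)" by simp
  show ?case unfolding s bilinear_extend_scale_left bilinear_extend_scale_right
    using assms(2)[OF single] by simp
qed (auto simp: bilinear_extend_add_left bilinear_extend_add_right)

section \<open>Colourings and products of diagrams\<close>

text \<open>\<open>Z\<close> is one of two colour classes. A partition is determined by the
  two-colourings that are constant on its blocks, so diagrams can be compared and multiplied without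
  following paths.\<close>

definition colouring :: "'a set \<Rightarrow> 'a set set \<Rightarrow> bool" where
  "colouring Z D \<longleftrightarrow> (\<forall>e\<in>D. e \<subseteq> Z \<or> e \<inter> Z = {})"

text \<open>The two rows of a diagram are coloured separately, because the southern row of an upper
  factor and the northern row of a lower one have to share a colouring.\<close>

definition rows :: "nat set \<Rightarrow> nat set \<Rightarrow> node set" where
  "rows F G = North ` F \<union> South ` G"

lemma North_in_rows [simp]: "North i \<in> rows F G \<longleftrightarrow> i \<in> F"
  and South_in_rows [simp]: "South i \<in> rows F G \<longleftrightarrow> i \<in> G"
  by (auto simp: rows_def)

lemma North_in_nodes [simp]: "North i \<in> nodes N S \<longleftrightarrow> 1 \<le> i \<and> i \<le> N"
  and South_in_nodes [simp]: "South i \<in> nodes N S \<longleftrightarrow> 1 \<le> i \<and> i \<le> S"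
  by (auto simp: nodes_def)

lemma finite_nodes [simp]: "finite (nodes N S)"
  by (simp add: nodes_def)

lemma constant_on_image:
  assumes "\<And>x. f x \<in> U \<longleftrightarrow> x \<in> W"
  shows "(f ` e \<subseteq> U \<or> f ` e \<inter> U = {}) \<longleftrightarrow> (e \<subseteq> W \<or> e \<inter> W = {})"
  using assms by blast

lemma ball_image_Diff_empty: "Q {} \<Longrightarrow> (\<forall>e\<in>f ` P - {{}}. Q e) \<longleftrightarrow> (\<forall>K\<in>P. Q (f K))"
  by auto

lemma rows_vimage: "rows (North -` Z) (South -` Z) = Z"
proof -
  have "x \<in> rows (North -` Z) (South -` Z) \<longleftrightarrow> x \<in> Z" for x by (cases x) auto
  then show ?thesis by blast
qed

text \<open>Each block is itself a colour class constant on the blocks of its own partition, hence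
  on those of the other one. So each partition refines the other.\<close>

lemma partition_on_eqI:
  assumes P: "partition_on V P" "partition_on V Q"
    and compat: "\<And>Z. Z \<subseteq> V \<Longrightarrow> colouring Z P \<longleftrightarrow> colouring Z Q"
  shows "P = Q"
proof -
  have sub: "\<exists>f\<in>Q. f \<subseteq> e \<and> x \<in> f"
    if P: "partition_on V P" "partition_on V Q"
      and compat: "\<And>Z. Z \<subseteq> V \<Longrightarrow> colouring Z P \<longleftrightarrow> colouring Z Q"
      and e: "e \<in> P" "x \<in> e" for P Q e x
  proof -
    have "colouring e P"
      using partition_onD2[OF P(1)] e by (auto simp: colouring_def disjoint_def)
    then have c: "colouring e Q" using compat[of e] partition_onD1[OF P(1)] e by auto
    obtain f where f: "f \<in> Q" "x \<in> f" using partition_onD1[OF P(1)] partition_onD1[OF P(2)] e by auto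
    then have "f \<subseteq> e" using c e by (auto simp: colouring_def)
    then show ?thesis using f by blast
  qed
  have "P \<subseteq> Q" if P: "partition_on V P" "partition_on V Q"
      and compat: "\<And>Z. Z \<subseteq> V \<Longrightarrow> colouring Z P \<longleftrightarrow> colouring Z Q" for P Q
  proof
    fix e assume e: "e \<in> P"
    then obtain x where x: "x \<in> e" using partition_onD3[OF P(1)] by (metis equals0I)
    obtain f where f: "f \<in> Q" "f \<subseteq> e" "x \<in> f" using sub[OF P compat e x] by blast
    obtain e' where e': "e' \<in> P" "e' \<subseteq> f" "x \<in> e'"
      using sub[OF P(2,1) compat[symmetric] f(1,3)] by blast
    have "e' = e" using partition_onD2[OF P(1)] e e' x by (auto simp: disjoint_def)
    then show "e \<in> Q" using e' f by auto
  qed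
  from this[OF P compat] this[OF P(2,1) compat[symmetric]] show ?thesis by blast
qed

text \<open>A block inside \<open>M\<close> may take either colour, and a block that leaves
  \<open>M\<close> must continue the colour prescribed outside. This gives one factor 2 for each
  block inside \<open>M\<close>, or no extension at all if some block sees both colours
  outside.\<close>

lemma card_colouring_extensions:
  assumes P: "partition_on V P" and fin: "finite V" and M: "M \<subseteq> V" and Y: "Y \<inter> M = {}"
  shows "card {G. G \<subseteq> M \<and> colouring (Y \<union> G) P} =
    (if \<forall>K\<in>P. K - M \<subseteq> Y \<or> (K - M) \<inter> Y = {} then 2 ^ card {K \<in> P. K \<subseteq> M} else 0)"
proof (cases "\<forall>K\<in>P. K - M \<subseteq> Y \<or> (K - M) \<inter> Y = {}")
  case True
  have eq: "K = L" if "K \<in> P" "L \<in> P" "x \<in> K" "x \<in> L" for K L x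
    using partition_onD2[OF P] that by (auto simp: disjoint_def)
  have ne: "K \<noteq> {}" if "K \<in> P" for K using partition_onD3[OF P] that by auto
  have V: "K \<subseteq> V" if "K \<in> P" for K using partition_onD1[OF P] that by auto
  \<comment> \<open>The part of \<open>M\<close> that is forced into the colour class: its blocks
    reach a coloured point outside \<open>M\<close>.\<close>
  define base where "base = M \<inter> \<Union>{K \<in> P. K \<inter> Y \<noteq> {}}"
  have base: "K \<inter> base = {}" if "K \<in> P" "K \<subseteq> M" for K
    using that eq Y by (fastforce simp: base_def)
  have "bij_betw (\<lambda>U. \<Union>U \<union> base) (Pow {K \<in> P. K \<subseteq> M}) {G. G \<subseteq> M \<and> colouring (Y \<union> G) P}"
  proof (rule bij_betw_byWitness[where f' = "\<lambda>G. {K \<in> P. K \<subseteq> M \<and> K \<subseteq> G}"])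
    show "\<forall>U\<in>Pow {K \<in> P. K \<subseteq> M}. {K \<in> P. K \<subseteq> M \<and> K \<subseteq> \<Union>U \<union> base} = U"
    proof
      fix U assume U: "U \<in> Pow {K \<in> P. K \<subseteq> M}"
      have "K \<in> U" if K: "K \<in> P" "K \<subseteq> M" "K \<subseteq> \<Union>U \<union> base" for K
      proof -
        obtain x where "x \<in> K" using ne[OF K(1)] by auto
        then obtain L where "L \<in> U" "x \<in> L" using base[OF K(1,2)] K by blast
        then show ?thesis using eq[of K L x] U K \<open>x \<in> K\<close> by auto
      qed
      then show "{K \<in> P. K \<subseteq> M \<and> K \<subseteq> \<Union>U \<union> base} = U" using U by auto
    qed
    show "\<forall>G\<in>{G. G \<subseteq> M \<and> colouring (Y \<union> G) P}. \<Union>{K \<in> P. K \<subseteq> M \<and> K \<subseteq> G} \<union> base = G"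
    proof
      fix G assume "G \<in> {G. G \<subseteq> M \<and> colouring (Y \<union> G) P}"
      then have G: "G \<subseteq> M" "\<And>K. K \<in> P \<Longrightarrow> K \<subseteq> Y \<union> G \<or> K \<inter> (Y \<union> G) = {}"
        by (auto simp: colouring_def)
      have "x \<in> \<Union>{K \<in> P. K \<subseteq> M \<and> K \<subseteq> G} \<union> base" if x: "x \<in> G" for x
      proof -
        obtain K where K: "K \<in> P" "x \<in> K" using x G(1) M partition_onD1[OF P] by blast
        have KG: "K \<subseteq> Y \<union> G" using G(2)[OF K(1)] K x by auto
        show ?thesis
        proof (cases "K \<inter> Y = {}")
          case True then show ?thesis using KG K G(1) by blast
        next
          case False then show ?thesis using K x G(1) by (auto simp: base_def)
        qed
      qed
      moreover have "x \<in> G" if x: "x \<in> base" for x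
      proof -
        obtain K where K: "K \<in> P" "x \<in> K" "K \<inter> Y \<noteq> {}" "x \<in> M" using x by (auto simp: base_def)
        then show ?thesis using G(2)[OF K(1)] Y by blast
      qed
      ultimately show "\<Union>{K \<in> P. K \<subseteq> M \<and> K \<subseteq> G} \<union> base = G" by blast
    qed
    show "(\<lambda>U. \<Union>U \<union> base) ` Pow {K \<in> P. K \<subseteq> M} \<subseteq> {G. G \<subseteq> M \<and> colouring (Y \<union> G) P}"
    proof
      fix G assume "G \<in> (\<lambda>U. \<Union>U \<union> base) ` Pow {K \<in> P. K \<subseteq> M}"
      then obtain U where U: "U \<subseteq> {K \<in> P. K \<subseteq> M}" "G = \<Union>U \<union> base" by auto
      have "K \<subseteq> Y \<union> G \<or> K \<inter> (Y \<union> G) = {}" if K: "K \<in> P" for K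
      proof (cases "K \<inter> Y = {}")
        case True
        show ?thesis
        proof (cases "K \<in> U")
          case True then show ?thesis using U by auto
        next
          case False
          have "K \<inter> \<Union>U = {}" using eq[OF K] U False by blast
          moreover have "K \<inter> base = {}" using eq[OF K] True by (auto simp: base_def)
          ultimately show ?thesis using True U by auto
        qed
      next
        case False
        then have "K - M \<subseteq> Y" using \<open>\<forall>K\<in>P. _\<close> K Y by blast
        then show ?thesis using False K U by (auto simp: base_def)
      qed
      moreover have "G \<subseteq> M" using U by (auto simp: base_def)
      ultimately show "G \<in> {G. G \<subseteq> M \<and> colouring (Y \<union> G) P}" by (auto simp: colouring_def)
    qed
    show "(\<lambda>G. {K \<in> P. K \<subseteq> M \<and> K \<subseteq> G}) ` {G. G \<subseteq> M \<and> colouring (Y \<union> G) P} \<subseteq> Pow {K \<in> P. K \<subseteq> M}"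
      by auto
  qed
  then have "card {G. G \<subseteq> M \<and> colouring (Y \<union> G) P} = card (Pow {K \<in> P. K \<subseteq> M})"
    by (simp add: bij_betw_same_card)
  also have "\<dots> = 2 ^ card {K \<in> P. K \<subseteq> M}"
    using finite_elements[OF fin P] by (simp add: card_Pow)
  finally show ?thesis using True by simp
next
  case False
  then obtain K where K: "K \<in> P" "\<not> K - M \<subseteq> Y" "(K - M) \<inter> Y \<noteq> {}" by blast
  have "{G. G \<subseteq> M \<and> colouring (Y \<union> G) P} = {}"
  proof -
    have "\<not> colouring (Y \<union> G) P" if "G \<subseteq> M" for G
      using that K by (auto simp: colouring_def)
    then show ?thesis by auto
  qed
  then show ?thesis using False by (simp only: if_False card.empty)
qed

section \<open>Colourings of a stacked pair of diagrams\<close>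

definition join_edges :: "diagram \<Rightarrow> diagram \<Rightarrow> point set set" where
  "join_edges A B = (`) upper_point ` A \<union> (`) lower_point ` B"

definition points :: "nat \<Rightarrow> nat \<Rightarrow> nat \<Rightarrow> point set" where
  "points N M S = Top ` {1..N} \<union> Mid ` {1..M} \<union> Bot ` {1..S}"

lemma components_eq:
  "components A B = \<Union>(join_edges A B) // (\<Union>e\<in>join_edges A B. e \<times> e)\<^sup>+"
  by (simp add: components_def join_edges_def Let_def)

lemma range_outer_point: "range outer_point = - range Mid"
proof -
  have "x \<in> range outer_point \<longleftrightarrow> x \<notin> range Mid" for x
  proof (cases x)
    case (Top i) then show ?thesis using range_eqI[of x outer_point "North i"] by auto
  next
    case (Bot i) then show ?thesis using range_eqI[of x outer_point "South i"] by auto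
  next
    case (Mid i)
    have "Mid i \<noteq> outer_point y" for y by (cases y) auto
    then show ?thesis using Mid by auto
  qed
  then show ?thesis by blast
qed

context
  fixes N M S A B
  assumes A: "partition_on (nodes N M) A" and B: "partition_on (nodes M S) B"
begin

lemma Union_join_edges: "\<Union>(join_edges A B) = points N M S"
proof -
  have "\<Union>(join_edges A B) = upper_point ` \<Union>A \<union> lower_point ` \<Union>B"
    by (auto simp: join_edges_def)
  also have "\<dots> = points N M S"
    using partition_onD1[OF A, symmetric] partition_onD1[OF B, symmetric]
    by (simp add: nodes_def points_def image_Un image_image) auto
  finally show ?thesis .
qed

text \<open>The transitive closure is already reflexive, since \<open>e \<times> e\<close> contains
  the diagonal of \<open>e\<close> and every point lies on an edge.\<close>

lemma equiv_joined: "equiv (points N M S) ((\<Union>e\<in>join_edges A B. e \<times> e)\<^sup>+)"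
proof (rule equivI)
  let ?R = "\<Union>e\<in>join_edges A B. e \<times> e"
  show "?R\<^sup>+ \<subseteq> points N M S \<times> points N M S"
    using trancl_subset_Sigma[of ?R "points N M S"] Union_join_edges by blast
  show "refl_on (points N M S) (?R\<^sup>+)"
    unfolding refl_on_def using Union_join_edges by (auto intro!: r_into_trancl)
  show "sym (?R\<^sup>+)" by (intro sym_trancl) (auto simp: sym_def)
  show "trans (?R\<^sup>+)" by simp
qed

lemma partition_on_components: "partition_on (points N M S) (components A B)"
  unfolding components_eq Union_join_edges using equiv_joined by (rule partition_on_quotient)

text \<open>A colour that is constant along edges stays constant along chains of edges, so
  components can be tested edge by edge.\<close>

lemma colouring_components: "colouring Z (components A B) \<longleftrightarrow> colouring Z (join_edges A B)"
proof
  assume c: "colouring Z (components A B)"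
  show "colouring Z (join_edges A B)"
    unfolding colouring_def
  proof
    fix e assume e: "e \<in> join_edges A B"
    show "e \<subseteq> Z \<or> e \<inter> Z = {}"
    proof (cases "e = {}")
      case False
      then obtain x where x: "x \<in> e" by auto
      define K where "K = (\<Union>e\<in>join_edges A B. e \<times> e)\<^sup>+ `` {x}"
      have "K \<in> components A B" unfolding components_eq K_def using e x by (auto intro!: quotientI)
      then have "K \<subseteq> Z \<or> K \<inter> Z = {}" using c unfolding colouring_def by (rule bspec[rotated])
      moreover have "e \<subseteq> K" unfolding K_def using e x by (auto intro!: r_into_trancl)
      ultimately show ?thesis by blast
    qed auto
  qed
next
  assume c: "colouring Z (join_edges A B)"
  have step: "x \<in> Z \<longleftrightarrow> y \<in> Z" if "(x, y) \<in> (\<Union>e\<in>join_edges A B. e \<times> e)\<^sup>+" for x y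
    using that by induction (use c in \<open>auto simp: colouring_def\<close>)
  show "colouring Z (components A B)"
    unfolding colouring_def components_eq
  proof
    fix K assume "K \<in> \<Union>(join_edges A B) // (\<Union>e\<in>join_edges A B. e \<times> e)\<^sup>+"
    then obtain x where K: "K = (\<Union>e\<in>join_edges A B. e \<times> e)\<^sup>+ `` {x}" by (rule quotientE)
    have "y \<in> Z \<longleftrightarrow> x \<in> Z" if "y \<in> K" for y using that step[of x y] unfolding K by blast
    then show "K \<subseteq> Z \<or> K \<inter> Z = {}" by blast
  qed
qed

lemma colouring_join_edges:
  "colouring (Top ` F \<union> Mid ` G \<union> Bot ` H) (join_edges A B) \<longleftrightarrow>
   colouring (rows F G) A \<and> colouring (rows G H) B"
proof -
  let ?Z = "Top ` F \<union> Mid ` G \<union> Bot ` H"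
  have u: "upper_point x \<in> ?Z \<longleftrightarrow> x \<in> rows F G" for x by (cases x) auto
  have l: "lower_point x \<in> ?Z \<longleftrightarrow> x \<in> rows G H" for x by (cases x) auto
  show ?thesis
    unfolding colouring_def join_edges_def ball_Un ball_simps constant_on_image[OF u] constant_on_image[OF l] by simp
qed

lemma partition_on_concat: "partition_on (nodes N S) (concat_diagram A B)"
proof -
  have "outer_point x \<in> points N M S \<longleftrightarrow> x \<in> nodes N S" for x
    by (cases x) (auto simp: points_def)
  then have "outer_point -` points N M S = nodes N S" by blast
  then show ?thesis
    using partition_on_vimage[OF partition_on_components, of outer_point]
    by (simp add: concat_diagram_def)
qed

text \<open>
  The number of 2-colourings of the middle row that are constant on components determines the
  product, including the number of closed components.
\<close>

lemma card_colourings: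
  "card {G. G \<subseteq> {1..M} \<and> colouring (rows F G) A \<and> colouring (rows G H) B} =
   (if colouring (rows F H) (concat_diagram A B) then 2 ^ closed_components A B else 0)"
proof -
  let ?Y = "Top ` F \<union> Bot ` H" and ?P = "components A B" and ?M = "Mid ` {1..M}"
  have P: "partition_on (points N M S) ?P" by (rule partition_on_components)
  have sub: "K \<subseteq> points N M S" if "K \<in> ?P" for K using partition_onD1[OF P] that by auto
  have "card {G. G \<subseteq> {1..M} \<and> colouring (rows F G) A \<and> colouring (rows G H) B}
    = card ((`) Mid ` {G. G \<subseteq> {1..M} \<and> colouring (rows F G) A \<and> colouring (rows G H) B})"
    by (rule card_image[symmetric]) (auto intro!: inj_onI)
  also have "(`) Mid ` {G. G \<subseteq> {1..M} \<and> colouring (rows F G) A \<and> colouring (rows G H) B}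
    = {G. G \<subseteq> ?M \<and> colouring (?Y \<union> G) ?P}"
  proof -
    have "colouring (rows F G) A \<and> colouring (rows G H) B \<longleftrightarrow> colouring (?Y \<union> Mid ` G) ?P" for G
      unfolding colouring_components colouring_join_edges[symmetric] by (simp add: Un_ac)
    then show ?thesis by (auto simp: subset_image_iff)
  qed
  also have "card \<dots> = (if \<forall>K\<in>?P. K - ?M \<subseteq> ?Y \<or> (K - ?M) \<inter> ?Y = {} then 2 ^ card {K \<in> ?P. K \<subseteq> ?M} else 0)"
    by (rule card_colouring_extensions[OF P]) (auto simp: points_def)
  also have "{K \<in> ?P. K \<subseteq> ?M} = {K \<in> ?P. K \<subseteq> range Mid}"
    using sub unfolding points_def by blast
  also have "(\<forall>K\<in>?P. K - ?M \<subseteq> ?Y \<or> (K - ?M) \<inter> ?Y = {}) \<longleftrightarrow> colouring (rows F H) (concat_diagram A B)"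
  proof -
    have o: "outer_point x \<in> ?Y \<longleftrightarrow> x \<in> rows F H" for x by (cases x) auto
    have "(K - ?M \<subseteq> ?Y \<or> (K - ?M) \<inter> ?Y = {}) \<longleftrightarrow>
        (outer_point -` K \<subseteq> rows F H \<or> outer_point -` K \<inter> rows F H = {})" if "K \<in> ?P" for K
    proof -
      have "K - ?M = K \<inter> range outer_point"
        using sub[OF that] unfolding range_outer_point points_def by blast
      then have K: "K - ?M = outer_point ` (outer_point -` K)"
        by (simp only: image_vimage_eq)
      show ?thesis unfolding K by (rule constant_on_image) (rule o)
    qed
    \<comment> \<open>The empty block discarded by \<open>concat_diagram\<close> satisfies every
      colouring condition, so dropping it changes nothing.\<close>
    moreover have "colouring (rows F H) (concat_diagram A B) \<longleftrightarrow>
        (\<forall>K\<in>?P. outer_point -` K \<subseteq> rows F H \<or> outer_point -` K \<inter> rows F H = {})"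
      unfolding colouring_def concat_diagram_def ball_Un by (rule ball_image_Diff_empty) simp
    ultimately show ?thesis by (simp only: cong: ball_cong)
  qed
  finally show ?thesis by (simp add: closed_components_def)
qed

text \<open>The colourings with nonzero count recover the partition, and the empty colouring, which
  is always admissible, recovers the number of closed components from its power of 2.\<close>

lemma concat_diagramI:
  assumes C: "partition_on (nodes N S) C"
    and count: "\<And>F H. F \<subseteq> {1..N} \<Longrightarrow> H \<subseteq> {1..S} \<Longrightarrow>
      card {G. G \<subseteq> {1..M} \<and> colouring (rows F G) A \<and> colouring (rows G H) B} =
      (if colouring (rows F H) C then 2 ^ c else 0)"
  shows "concat_diagram A B = C" "closed_components A B = c"
proof -
  have "colouring Z (concat_diagram A B) \<longleftrightarrow> colouring Z C" if Z: "Z \<subseteq> nodes N S" for Z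
  proof -
    have "North -` Z \<subseteq> {1..N}" "South -` Z \<subseteq> {1..S}" using Z by auto
    from count[OF this] show ?thesis unfolding card_colourings rows_vimage by (simp split: if_splits)
  qed
  then show "concat_diagram A B = C" by (rule partition_on_eqI[OF partition_on_concat C])
  have "colouring (rows {} {}) D" for D by (auto simp: colouring_def rows_def)
  then show "closed_components A B = c" using count[of "{}" "{}"] card_colourings[of "{}" "{}"] by simp
qed

end

text \<open>Both bracketings count the colourings of the two middle rows together, with the order of
  summation exchanged. Which counts are nonzero gives the diagram, and the exponent of 2 at the
  empty colouring gives the total number of loops.\<close>

lemma concat_assoc:
  assumes A: "partition_on (nodes N M) A" and B: "partition_on (nodes M L) B"
    and C: "partition_on (nodes L S) C"
  shows "concat_diagram (concat_diagram A B) C = concat_diagram A (concat_diagram B C)" (is ?eq)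
    and "closed_components A B + closed_components (concat_diagram A B) C
       = closed_components B C + closed_components A (concat_diagram B C)" (is "?t = ?t'")
proof -
  note AB = partition_on_concat[OF A B] and BC = partition_on_concat[OF B C]
  have card_sum: "card {G. G \<subseteq> {1..n} \<and> Q G} = (\<Sum>G\<in>Pow {1..n}. of_bool (Q G))" for n :: nat and Q
    by (simp add: sum_of_bool_eq Int_def Pow_def)
  have *: "(if colouring (rows F H) (concat_diagram (concat_diagram A B) C) then 2 ^ ?t else 0)
      = (if colouring (rows F H) (concat_diagram A (concat_diagram B C)) then 2 ^ ?t' else (0::nat))" for F H
  proof -
    let ?a = "\<lambda>G. of_bool (colouring (rows F G) A) :: nat"
      and ?b = "\<lambda>G G'. of_bool (colouring (rows G G') B) :: nat"
      and ?c = "\<lambda>G. of_bool (colouring (rows G H) C) :: nat"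
    have "(if colouring (rows F H) (concat_diagram (concat_diagram A B) C) then 2 ^ ?t else (0::nat))
      = 2 ^ closed_components A B * (\<Sum>G'\<in>Pow {1..L}. of_bool (colouring (rows F G') (concat_diagram A B) \<and> colouring (rows G' H) C))"
      unfolding card_sum[symmetric] card_colourings[OF AB C] by (simp add: power_add)
    also have "\<dots> = (\<Sum>G'\<in>Pow {1..L}. (if colouring (rows F G') (concat_diagram A B) then 2 ^ closed_components A B else 0) * ?c G')"
      unfolding sum_distrib_left by (intro sum.cong) auto
    also have "\<dots> = (\<Sum>G'\<in>Pow {1..L}. \<Sum>G\<in>Pow {1..M}. ?a G * ?b G G' * ?c G')"
      unfolding card_colourings[OF A B, symmetric] card_sum sum_distrib_right by (simp only: of_bool_conj)
    also have "\<dots> = (\<Sum>G\<in>Pow {1..M}. \<Sum>G'\<in>Pow {1..L}. ?a G * (?b G G' * ?c G'))"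
      by (subst sum.swap) (simp add: mult.assoc)
    also have "\<dots> = (\<Sum>G\<in>Pow {1..M}. ?a G * (if colouring (rows G H) (concat_diagram B C) then 2 ^ closed_components B C else 0))"
      unfolding card_colourings[OF B C, symmetric] card_sum sum_distrib_left by (simp only: of_bool_conj)
    also have "\<dots> = 2 ^ closed_components B C * (\<Sum>G\<in>Pow {1..M}. of_bool (colouring (rows F G) A \<and> colouring (rows G H) (concat_diagram B C)))"
      unfolding sum_distrib_left by (intro sum.cong) auto
    also have "\<dots> = (if colouring (rows F H) (concat_diagram A (concat_diagram B C)) then 2 ^ ?t' else 0)"
      unfolding card_sum[symmetric] card_colourings[OF A BC] by (simp add: power_add)
    finally show ?thesis .
  qed
  have "colouring Z (concat_diagram (concat_diagram A B) C) \<longleftrightarrow> colouring Z (concat_diagram A (concat_diagram B C))" for Z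
    using *[of "North -` Z" "South -` Z"] by (simp add: rows_vimage split: if_splits)
  then show ?eq
    by (intro partition_on_eqI[OF partition_on_concat[OF AB C] partition_on_concat[OF A BC]])
  have "colouring (rows {} {}) D" for D by (auto simp: colouring_def rows_def)
  then show "?t = ?t'" using *[of "{}" "{}"] by simp
qed

section \<open>Products of walled diagrams\<close>

definition partner :: "'a set set \<Rightarrow> 'a \<Rightarrow> 'a" where
  "partner D x = (THE y. y \<noteq> x \<and> {x, y} \<in> D)"

locale matching =
  fixes V :: "'a set" and D :: "'a set set"
  assumes partition: "partition_on V D" and card_edge: "e \<in> D \<Longrightarrow> card e = 2"
begin

lemma edge_eq: "e \<in> D \<Longrightarrow> f \<in> D \<Longrightarrow> x \<in> e \<Longrightarrow> x \<in> f \<Longrightarrow> e = f"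
  using partition_onD2[OF partition] by (auto simp: disjoint_def)

lemma edge_subset: "e \<in> D \<Longrightarrow> e \<subseteq> V"
  using partition_onD1[OF partition] by auto

lemma ex1_partner: "x \<in> V \<Longrightarrow> \<exists>!y. y \<noteq> x \<and> {x, y} \<in> D"
proof -
  assume "x \<in> V"
  then obtain e where e: "e \<in> D" "x \<in> e" using partition_onD1[OF partition] by auto
  then obtain y where "e = {x, y}" "y \<noteq> x"
    using card_edge[OF e(1)] by (auto simp: card_2_iff)
  then show ?thesis using edge_eq e by (intro ex1I[of _ y]) (auto simp: doubleton_eq_iff)
qed

lemma
  assumes "x \<in> V"
  shows partner_neq: "partner D x \<noteq> x" and partner_edge: "{x, partner D x} \<in> D"
  using theI'[OF ex1_partner[OF assms]] by (auto simp: partner_def)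

lemma partner_eqI: "{x, y} \<in> D \<Longrightarrow> partner D x = y"
proof -
  assume e: "{x, y} \<in> D"
  then have "x \<noteq> y" using card_edge[OF e] by auto
  then show ?thesis
    using e ex1_partner[of x] edge_subset[OF e] unfolding partner_def
    by (intro the1_equality) auto
qed

lemma partner_in: "x \<in> V \<Longrightarrow> partner D x \<in> V"
  using edge_subset[OF partner_edge] by blast

lemma partner_partner: "x \<in> V \<Longrightarrow> partner D (partner D x) = x"
  by (rule partner_eqI) (metis partner_edge insert_commute)

lemma edge_conv_partner: "e \<in> D \<Longrightarrow> x \<in> e \<Longrightarrow> e = {x, partner D x}"
  by (meson edge_eq edge_subset in_mono insertI1 partner_edge)

end

text \<open>
  Orient left propagating lines downwards, right ones upwards, northern arcs to the right and
  southern arcs to the left. The wall condition says that every edge runs from a source to a node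
  that is not a source, and a point in the middle of a product is a source of exactly one factor.
\<close>

fun source :: "nat \<Rightarrow> nat \<Rightarrow> node \<Rightarrow> bool" where
  "source m m' (North i) \<longleftrightarrow> i \<le> m"
| "source m m' (South i) \<longleftrightarrow> \<not> i \<le> m'"

lemma walled_diagrams_iff:
  "D \<in> walled_diagrams m n m' n' \<longleftrightarrow> partition_on (nodes (m + n) (m' + n')) D \<and>
    (\<forall>e\<in>D. \<exists>x y. e = {x, y} \<and> source m m' x \<and> \<not> source m m' y)"
proof -
  have "(card e = 2 \<and>
      (e \<in> propagating_lines D \<longrightarrow> (\<forall>x\<in>e. \<forall>y\<in>e. is_left m m' x = is_left m m' y)) \<and>
      (e \<in> northern_arcs D \<union> southern_arcs D \<longrightarrow>
        (\<forall>x\<in>e. \<forall>y\<in>e. x \<noteq> y \<longrightarrow> is_left m m' x \<noteq> is_left m m' y)))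
    \<longleftrightarrow> (\<exists>x y. e = {x, y} \<and> source m m' x \<and> \<not> source m m' y)" if e: "e \<in> D" for e
  proof (cases "card e = 2")
    case True
    then obtain x y where xy: "e = {x, y}" "x \<noteq> y" by (auto simp: card_2_iff)
    have ex: "(\<exists>u v. e = {u, v} \<and> source m m' u \<and> \<not> source m m' v) \<longleftrightarrow> (source m m' x \<noteq> source m m' y)"
      by (auto simp: xy doubleton_eq_iff)
    show ?thesis
      unfolding ex using xy e
      by (cases x; cases y)
        (auto simp: propagating_lines_def northern_arcs_def southern_arcs_def doubleton_eq_iff)
  next
    case False
    then have "\<not> (\<exists>x y. e = {x, y} \<and> source m m' x \<and> \<not> source m m' y)"
      by (auto simp: card_2_iff)
    then show ?thesis using False by simp
  qed
  note pointwise = this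
  have sub: "propagating_lines D \<subseteq> D" "northern_arcs D \<union> southern_arcs D \<subseteq> D"
    by (auto simp: propagating_lines_def northern_arcs_def southern_arcs_def)
  have "(\<forall>e\<in>D. P e) \<and> (\<forall>e\<in>S. Q e) \<and> (\<forall>e\<in>T. R e) \<longleftrightarrow>
      (\<forall>e\<in>D. P e \<and> (e \<in> S \<longrightarrow> Q e) \<and> (e \<in> T \<longrightarrow> R e))"
    if "S \<subseteq> D" "T \<subseteq> D" for S T and P Q R :: "node set \<Rightarrow> bool"
    using that by blast
  note merge = this[OF sub]
  show ?thesis unfolding walled_diagrams_def mem_Collect_eq merge
    by (intro conj_cong refl ball_cong pointwise)
qed

lemma walled_partition: "D \<in> walled_diagrams m n m' n' \<Longrightarrow> partition_on (nodes (m + n) (m' + n')) D"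
  by (simp add: walled_diagrams_iff)

lemma matching_walled: "D \<in> walled_diagrams m n m' n' \<Longrightarrow> matching (nodes (m + n) (m' + n')) D"
  by (auto simp: matching_def walled_diagrams_def)

lemma source_partner:
  assumes D: "D \<in> walled_diagrams m n m' n'" and x: "x \<in> nodes (m + n) (m' + n')"
  shows "source m m' (partner D x) \<longleftrightarrow> \<not> source m m' x"
proof -
  interpret matching "nodes (m + n) (m' + n')" D by (rule matching_walled[OF D])
  obtain u v where "{x, partner D x} = {u, v}" "source m m' u" "\<not> source m m' v"
    using D partner_edge[OF x] unfolding walled_diagrams_iff by blast
  then show ?thesis by (auto simp: doubleton_eq_iff)
qed

text \<open>With at most one successor and one predecessor at every point, a step against the
  current direction can only retrace the previous step. So connected points lie on one directed
  path.\<close>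

lemma rtrancl_Un_converse:
  assumes sv: "single_valued R" "single_valued (R\<inverse>)" and "(x, y) \<in> (R \<union> R\<inverse>)\<^sup>*"
  shows "(x, y) \<in> R\<^sup>* \<or> (y, x) \<in> R\<^sup>*"
  using assms(3)
proof (induction rule: rtrancl_induct)
  case base then show ?case by simp
next
  case (step y z)
  from step.hyps(2) consider "(y, z) \<in> R" | "(z, y) \<in> R" by auto
  then show ?case
  proof cases
    case 1
    show ?thesis using step.IH
    proof
      assume "(x, y) \<in> R\<^sup>*" then show ?thesis using 1 by auto
    next
      assume "(y, x) \<in> R\<^sup>*"
      then show ?thesis
      proof (cases rule: converse_rtranclE)
        case base then show ?thesis using 1 by auto
      next
        case (step w) then show ?thesis using 1 sv(1) by (auto dest: single_valuedD)
      qed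
    qed
  next
    case 2
    show ?thesis using step.IH
    proof
      assume "(y, x) \<in> R\<^sup>*" then show ?thesis using 2 by (auto intro: converse_rtrancl_into_rtrancl)
    next
      assume "(x, y) \<in> R\<^sup>*"
      then show ?thesis
      proof (cases rule: rtranclE)
        case base then show ?thesis using 2 by auto
      next
        case (step w)
        then have "w = z" using 2 sv(2) by (auto dest: single_valuedD)
        then show ?thesis using step by auto
      qed
    qed
  qed
qed

text \<open>Otherwise a choice of successors would be an injective self-map of the finite set
  \<open>K\<close>, hence onto, and would give \<open>x\<close> a predecessor.\<close>

lemma chain_has_end:
  assumes "finite K" and closed: "\<And>p q. p \<in> K \<Longrightarrow> (p, q) \<in> R \<Longrightarrow> q \<in> K"
    and sv: "single_valued (R\<inverse>)" and x: "x \<in> K" "x \<notin> Range R"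
  obtains y where "y \<in> K" "y \<notin> Domain R"
proof (rule ccontr)
  assume "\<not> thesis"
  then have "\<forall>y\<in>K. \<exists>z. (y, z) \<in> R" using that by blast
  then obtain f where f: "\<And>y. y \<in> K \<Longrightarrow> (y, f y) \<in> R" by metis
  have "f ` K \<subseteq> K" using f closed by blast
  moreover have "inj_on f K"
  proof (rule inj_onI)
    fix y z assume "y \<in> K" "z \<in> K" "f y = f z"
    then have "(f y, y) \<in> R\<inverse>" "(f y, z) \<in> R\<inverse>" using f[of y] f[of z] by simp_all
    then show "y = z" by (rule single_valuedD[OF sv])
  qed
  ultimately have "f ` K = K" using \<open>finite K\<close> by (simp add: endo_inj_surj)
  then obtain y where "y \<in> K" "x = f y" using x(1) by (metis imageE)
  then show False using x(2) f[of y] by auto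
qed

definition arrows :: "nat \<Rightarrow> nat \<Rightarrow> nat \<Rightarrow> diagram \<Rightarrow> diagram \<Rightarrow> (point \<times> point) set" where
  "arrows m m' m'' A B =
    {(upper_point x, upper_point y) | x y. {x, y} \<in> A \<and> source m m' x \<and> \<not> source m m' y} \<union>
    {(lower_point x, lower_point y) | x y. {x, y} \<in> B \<and> source m' m'' x \<and> \<not> source m' m'' y}"

lemma upper_point_eq [simp]:
  "upper_point x = Top i \<longleftrightarrow> x = North i" "upper_point x = Mid i \<longleftrightarrow> x = South i" "upper_point x \<noteq> Bot i"
  by (cases x; auto)+

lemma lower_point_eq [simp]:
  "lower_point x = Mid i \<longleftrightarrow> x = North i" "lower_point x = Bot i \<longleftrightarrow> x = South i" "lower_point x \<noteq> Top i"
  by (cases x; auto)+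

lemma outer_point_eq [simp]:
  "Top i = outer_point x \<longleftrightarrow> x = North i" "Bot i = outer_point x \<longleftrightarrow> x = South i" "Mid i \<noteq> outer_point x"
  by (cases x; auto)+

context
  fixes m n m' n' m'' n'' A B
  assumes A: "A \<in> walled_diagrams m n m' n'" and B: "B \<in> walled_diagrams m' n' m'' n''"
begin

interpretation A: matching "nodes (m + n) (m' + n')" A by (rule matching_walled[OF A])
interpretation B: matching "nodes (m' + n') (m'' + n'')" B by (rule matching_walled[OF B])

private abbreviation "R \<equiv> arrows m m' m'' A B"

lemma arrow_cases:
  "(Top i, q) \<in> R \<longleftrightarrow> (i \<le> m \<and> (\<exists>y. {North i, y} \<in> A \<and> \<not> source m m' y \<and> q = upper_point y))"
  "(Mid i, q) \<in> R \<longleftrightarrow> (\<not> i \<le> m' \<and> (\<exists>y. {South i, y} \<in> A \<and> \<not> source m m' y \<and> q = upper_point y)) \<or>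
     (i \<le> m' \<and> (\<exists>y. {North i, y} \<in> B \<and> \<not> source m' m'' y \<and> q = lower_point y))"
  "(Bot i, q) \<in> R \<longleftrightarrow> (\<not> i \<le> m'' \<and> (\<exists>y. {South i, y} \<in> B \<and> \<not> source m' m'' y \<and> q = lower_point y))"
  "(q, Top i) \<in> R \<longleftrightarrow> (\<not> i \<le> m \<and> (\<exists>y. {y, North i} \<in> A \<and> source m m' y \<and> q = upper_point y))"
  "(q, Mid i) \<in> R \<longleftrightarrow> (i \<le> m' \<and> (\<exists>y. {y, South i} \<in> A \<and> source m m' y \<and> q = upper_point y)) \<or>
     (\<not> i \<le> m' \<and> (\<exists>y. {y, North i} \<in> B \<and> source m' m'' y \<and> q = lower_point y))"
  "(q, Bot i) \<in> R \<longleftrightarrow> (i \<le> m'' \<and> (\<exists>y. {y, South i} \<in> B \<and> source m' m'' y \<and> q = lower_point y))"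
  unfolding arrows_def
  by (auto simp: eq_commute[of "Top _"] eq_commute[of "Mid _"] eq_commute[of "Bot _"])

text \<open>At a middle point the side of the wall decides which factor carries the outgoing arrow
  and which the incoming one. The oriented graph therefore consists of directed paths and
  cycles.\<close>

lemma single_valued_arrows: "single_valued R" "single_valued (R\<inverse>)"
proof -
  have A': "y = z" if "{x, y} \<in> A" "{x, z} \<in> A" for x y z using that A.partner_eqI by blast
  have B': "y = z" if "{x, y} \<in> B" "{x, z} \<in> B" for x y z using that B.partner_eqI by blast
  have A'': "y = z" if "{y, x} \<in> A" "{z, x} \<in> A" for x y z using A'[of x y z] that by (simp add: insert_commute)
  have B'': "y = z" if "{y, x} \<in> B" "{z, x} \<in> B" for x y z using B'[of x y z] that by (simp add: insert_commute)
  show "single_valued R"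
  proof (rule single_valuedI)
    fix p q q' assume "(p, q) \<in> R" "(p, q') \<in> R"
    then show "q = q'" by (cases p) (auto simp: arrow_cases dest: A' B')
  qed
  show "single_valued (R\<inverse>)"
  proof (rule single_valuedI)
    fix p q q' assume "(p, q) \<in> R\<inverse>" "(p, q') \<in> R\<inverse>"
    then have "(q, p) \<in> R" "(q', p) \<in> R" by auto
    then show "q = q'"
      by (cases p) (auto simp: arrow_cases dest: A'' B'')
  qed
qed

text \<open>Every middle point has an outgoing arrow from one of the factors, so a path can stop
  only at an outer node, and there only if it is not a source. Dually, paths start exactly at the
  outer sources.\<close>

lemma Domain_arrows:
  assumes "p \<in> points (m + n) (m' + n') (m'' + n'')"
  shows "p \<in> Domain R \<longleftrightarrow> \<not> (\<exists>y. p = outer_point y \<and> \<not> source m m'' y)"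
proof -
  have A': "\<exists>y. {x, y} \<in> A \<and> \<not> source m m' y" if "x \<in> nodes (m + n) (m' + n')" "source m m' x" for x
    using A.partner_edge[OF that(1)] source_partner[OF A that(1)] that(2) by blast
  have B': "\<exists>y. {x, y} \<in> B \<and> \<not> source m' m'' y" if "x \<in> nodes (m' + n') (m'' + n'')" "source m' m'' x" for x
    using B.partner_edge[OF that(1)] source_partner[OF B that(1)] that(2) by blast
  show ?thesis
  proof (cases p)
    case (Top i)
    then show ?thesis using assms A'[of "North i"]
      by (auto simp: Domain_iff arrow_cases points_def)
  next
    case (Mid i)
    then show ?thesis using assms A'[of "South i"] B'[of "North i"]
      by (cases "i \<le> m'") (auto simp: Domain_iff arrow_cases points_def)
  next
    case (Bot i)
    then show ?thesis using assms B'[of "South i"]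
      by (auto simp: Domain_iff arrow_cases points_def)
  qed
qed

lemma Range_arrows:
  assumes "p \<in> points (m + n) (m' + n') (m'' + n'')"
  shows "p \<in> Range R \<longleftrightarrow> \<not> (\<exists>y. p = outer_point y \<and> source m m'' y)"
proof -
  have A': "\<exists>y. {y, x} \<in> A \<and> source m m' y" if "x \<in> nodes (m + n) (m' + n')" "\<not> source m m' x" for x
    using A.partner_edge[OF that(1)] source_partner[OF A that(1)] that(2) by (metis insert_commute)
  have B': "\<exists>y. {y, x} \<in> B \<and> source m' m'' y" if "x \<in> nodes (m' + n') (m'' + n'')" "\<not> source m' m'' x" for x
    using B.partner_edge[OF that(1)] source_partner[OF B that(1)] that(2) by (metis insert_commute)
  show ?thesis
  proof (cases p)
    case (Top i)
    then show ?thesis using assms A'[of "North i"]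
      by (auto simp: Range_iff arrow_cases points_def)
  next
    case (Mid i)
    then show ?thesis using assms A'[of "South i"] B'[of "North i"]
      by (cases "i \<le> m'") (auto simp: Range_iff arrow_cases points_def)
  next
    case (Bot i)
    then show ?thesis using assms B'[of "South i"]
      by (auto simp: Range_iff arrow_cases points_def)
  qed
qed

lemma joined_imp_arrows:
  assumes "(p, q) \<in> (\<Union>e\<in>join_edges A B. e \<times> e)\<^sup>+"
  shows "(p, q) \<in> R\<^sup>* \<or> (q, p) \<in> R\<^sup>*"
proof -
  have step: "(p, q) \<in> (R \<union> R\<inverse>)\<^sup>*" if e: "e \<in> join_edges A B" "p \<in> e" "q \<in> e" for e p q
  proof -
    have "\<exists>u v. e = {u, v} \<and> (u, v) \<in> R"
    proof -
      from e(1) consider f where "f \<in> A" "e = upper_point ` f" | f where "f \<in> B" "e = lower_point ` f"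
        by (auto simp: join_edges_def)
      then show ?thesis
      proof cases
        case 1
        then obtain x y where "f = {x, y}" "source m m' x" "\<not> source m m' y"
          using A unfolding walled_diagrams_iff by blast
        then show ?thesis using 1 by (intro exI[of _ "upper_point x"] exI[of _ "upper_point y"])
            (auto simp: arrows_def)
      next
        case 2
        then obtain x y where "f = {x, y}" "source m' m'' x" "\<not> source m' m'' y"
          using B unfolding walled_diagrams_iff by blast
        then show ?thesis using 2 by (intro exI[of _ "lower_point x"] exI[of _ "lower_point y"])
            (auto simp: arrows_def)
      qed
    qed
    then show ?thesis using e by auto
  qed
  from assms have "(p, q) \<in> (R \<union> R\<inverse>)\<^sup>*"
    by induction (use step in \<open>blast intro: rtrancl_trans\<close>)+
  then show ?thesis by (rule rtrancl_Un_converse[OF single_valued_arrows])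
qed

text \<open>A component with outer points is a directed path; its start is the only source on it and
  its end the only outer node that is not a source. This is the wall condition in oriented
  form.\<close>

lemma concat_walled: "concat_diagram A B \<in> walled_diagrams m n m'' n''"
  unfolding walled_diagrams_iff
proof (intro conjI ballI)
  note pA = walled_partition[OF A] and pB = walled_partition[OF B]
  let ?V = "points (m + n) (m' + n') (m'' + n'')"
  show "partition_on (nodes (m + n) (m'' + n'')) (concat_diagram A B)"
    by (rule partition_on_concat[OF pA pB])
  fix b assume b: "b \<in> concat_diagram A B"
  then obtain K where K: "K \<in> components A B" "b = outer_point -` K" "b \<noteq> {}"
    by (auto simp: concat_diagram_def)
  note P = partition_on_components[OF pA pB]
  have KV: "K \<subseteq> ?V" using partition_onD1[OF P] K by auto
  then have fin: "finite K" using finite_subset[of K ?V] by (auto simp: points_def)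
  have K': "K \<in> ?V // (\<Union>e\<in>join_edges A B. e \<times> e)\<^sup>+"
    using K(1) unfolding components_eq Union_join_edges[OF pA pB] .
  have conn: "(p, q) \<in> R\<^sup>* \<or> (q, p) \<in> R\<^sup>*" if "p \<in> K" "q \<in> K" for p q
    by (rule joined_imp_arrows) (rule in_quotient_imp_in_rel[OF equiv_joined[OF pA pB] K'], use that in auto)
  have closed: "q \<in> K \<longleftrightarrow> p \<in> K" if "(p, q) \<in> R" for p q
  proof -
    have "\<exists>e\<in>join_edges A B. p \<in> e \<and> q \<in> e"
    proof -
      from that consider x y where "{x, y} \<in> A" "p = upper_point x" "q = upper_point y"
        | x y where "{x, y} \<in> B" "p = lower_point x" "q = lower_point y"
        by (auto simp: arrows_def)
      then show ?thesis
        by cases (auto simp: join_edges_def intro: bexI[of _ "upper_point ` {_, _}"] bexI[of _ "lower_point ` {_, _}"])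
    qed
    then have pq: "(p, q) \<in> (\<Union>e\<in>join_edges A B. e \<times> e)\<^sup>+" "(q, p) \<in> (\<Union>e\<in>join_edges A B. e \<times> e)\<^sup>+"
      by (auto intro: r_into_trancl)
    show ?thesis
      using in_quotient_imp_closed[OF equiv_joined[OF pA pB] K' _ pq(1)]
        in_quotient_imp_closed[OF equiv_joined[OF pA pB] K' _ pq(2)] by blast
  qed
  \<comment> \<open>From a node that is not a source, the arrows are followed backwards to the start
    of the path.\<close>
  have "\<exists>x\<in>b. source m m'' x"
  proof -
    obtain y where y: "y \<in> b" using K by auto
    show ?thesis
    proof (cases "source m m'' y")
      case False
      have "outer_point y \<notin> Range (R\<inverse>)" using Domain_arrows[of "outer_point y"] False y K KV by auto
      then obtain p where "p \<in> K" "p \<notin> Domain (R\<inverse>)"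
        using chain_has_end[of K "R\<inverse>" "outer_point y"] fin closed single_valued_arrows y K by auto
      then show ?thesis using Range_arrows[of p] KV K by auto
    qed (use y in auto)
  qed
  then obtain x where x: "x \<in> b" "source m m'' x" by auto
  have "outer_point x \<notin> Range R" using Range_arrows[of "outer_point x"] x K KV by auto
  then obtain p where "p \<in> K" "p \<notin> Domain R"
    using chain_has_end[of K R "outer_point x"] fin closed single_valued_arrows x K by auto
  then obtain y where y: "y \<in> b" "\<not> source m m'' y" using Domain_arrows[of p] KV K by auto
  have inj: "u = v" if "outer_point u = outer_point v" for u v using that by (cases u; cases v) auto
  \<comment> \<open>Two sources of one block are joined by a directed path, yet neither has an
    incoming arrow, so they coincide. The same holds for two nodes without outgoing arrows.\<close>
  have "z = x \<or> z = y" if z: "z \<in> b" for z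
  proof (cases "source m m'' z")
    case True
    have "outer_point z \<notin> Range R" "outer_point x \<notin> Range R"
      using Range_arrows[of "outer_point z"] Range_arrows[of "outer_point x"] z True x K KV by auto
    then have "outer_point z = outer_point x"
      using conn[of "outer_point z" "outer_point x"] z x K by (auto elim: rtranclE)
    then show ?thesis using inj by auto
  next
    case False
    have "outer_point z \<notin> Domain R" "outer_point y \<notin> Domain R"
      using Domain_arrows[of "outer_point z"] Domain_arrows[of "outer_point y"] z False y K KV by auto
    then have "outer_point z = outer_point y"
      using conn[of "outer_point z" "outer_point y"] z y K by (auto elim: converse_rtranclE)
    then show ?thesis using inj by auto
  qed
  then have "b = {x, y}" using x y by auto
  then show "\<exists>x y. b = {x, y} \<and> source m m'' x \<and> \<not> source m m'' y" using x y by blast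
qed

end

section \<open>Multiplication by generators\<close>

text \<open>The surgery behind products with generators: two edges are cut and their four ends
  joined anew. A transposition and an arc generator differ only in which ends are joined.\<close>

definition reconnect :: "'a set set \<Rightarrow> 'a \<Rightarrow> 'a \<Rightarrow> 'a set set" where
  "reconnect D u w =
     (D - {{u, partner D u}, {w, partner D w}}) \<union> {{u, w}, {partner D u, partner D w}}"

lemma agree_iff: "P \<and> Q \<or> \<not> P \<and> \<not> Q \<longleftrightarrow> (P \<longleftrightarrow> Q)"
  by blast

lemma reconnect_sym: "reconnect D u w = reconnect D w u"
  by (simp add: reconnect_def insert_commute)

context matching
begin

lemma reconnect_partner:
  "u \<in> V \<Longrightarrow> w \<in> V \<Longrightarrow> reconnect D (partner D u) (partner D w) = reconnect D u w"
  by (simp add: reconnect_def partner_partner insert_commute)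

context
  fixes u w assumes u: "u \<in> V" and w: "w \<in> V" and uw: "w \<noteq> u" "w \<noteq> partner D u"
begin

lemma four_distinct:
  "u \<noteq> w" "u \<noteq> partner D u" "u \<noteq> partner D w" "w \<noteq> partner D u" "w \<noteq> partner D w"
  "partner D u \<noteq> partner D w"
  using u w uw partner_neq partner_partner by metis+

lemma matching_reconnect: "matching V (reconnect D u w)"
proof
  note [simp] = four_distinct four_distinct[symmetric]
  have eu: "{u, partner D u} \<in> D" and ew: "{w, partner D w} \<in> D"
    using partner_edge u w by auto
  show "partition_on V (reconnect D u w)"
  proof (rule partition_onI)
    have "\<Union>D = \<Union>(D - {{u, partner D u}, {w, partner D w}}) \<union> {u, partner D u, w, partner D w}"
      using eu ew by blast
    also have "\<dots> = \<Union>(reconnect D u w)" unfolding reconnect_def by blast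
    finally show "\<Union>(reconnect D u w) = V" using partition_onD1[OF partition] by simp
    show "{} \<notin> reconnect D u w"
      using partition_onD3[OF partition] by (simp add: reconnect_def)
    let ?O = "D - {{u, partner D u}, {w, partner D w}}"
    have notin: "x \<notin> e"
      if e: "e \<in> D" "e \<noteq> {u, partner D u}" "e \<noteq> {w, partner D w}"
        and x: "x \<in> {u, partner D u, w, partner D w}" for e x
    proof
      assume "x \<in> e"
      then have "e = {x, partner D x}" using edge_conv_partner[OF e(1)] by blast
      then show False
        using x e(2,3) partner_partner[OF u] partner_partner[OF w] by (auto simp: insert_commute)
    qed
    have oo: "disjnt e f" if "e \<in> ?O" "f \<in> ?O" "e \<noteq> f" for e f
      using that edge_eq[of e f] by (auto simp: disjnt_def)
    have new: "disjnt {u, w} {partner D u, partner D w}" by (simp add: disjnt_def)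
    show "disjnt e f" if "e \<in> reconnect D u w" "f \<in> reconnect D u w" "e \<noteq> f" for e f
    proof -
      have "e \<in> ?O \<or> e = {u, w} \<or> e = {partner D u, partner D w}"
        "f \<in> ?O \<or> f = {u, w} \<or> f = {partner D u, partner D w}"
        using that(1,2) unfolding reconnect_def by blast+
      then show ?thesis
        using that(3)
        by (elim disjE) (simp_all add: notin oo new new[THEN disjnt_sym])
    qed
  qed
  show "card e = 2" if "e \<in> reconnect D u w" for e
    using that card_edge by (auto simp: reconnect_def)
qed

lemma colouring_split:
  "colouring Z D \<longleftrightarrow> colouring Z (D - {{u, partner D u}, {w, partner D w}}) \<and>
     (u \<in> Z \<longleftrightarrow> partner D u \<in> Z) \<and> (w \<in> Z \<longleftrightarrow> partner D w \<in> Z)"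
proof -
  have "D = insert {u, partner D u} (insert {w, partner D w} (D - {{u, partner D u}, {w, partner D w}}))"
    using partner_edge[OF u] partner_edge[OF w] by blast
  then have "colouring Z D \<longleftrightarrow> colouring Z (insert {u, partner D u} (insert {w, partner D w}
      (D - {{u, partner D u}, {w, partner D w}})))" by (rule arg_cong)
  also have "\<dots> \<longleftrightarrow> colouring Z (D - {{u, partner D u}, {w, partner D w}}) \<and>
     (u \<in> Z \<longleftrightarrow> partner D u \<in> Z) \<and> (w \<in> Z \<longleftrightarrow> partner D w \<in> Z)"
    unfolding colouring_def by (simp only: ball_simps) (simp add: agree_iff conj_ac)
  finally show ?thesis .
qed

lemma colouring_reconnect:
  "colouring Z (reconnect D u w) \<longleftrightarrow> colouring Z (D - {{u, partner D u}, {w, partner D w}}) \<and>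
     (u \<in> Z \<longleftrightarrow> w \<in> Z) \<and> (partner D u \<in> Z \<longleftrightarrow> partner D w \<in> Z)"
  unfolding colouring_def reconnect_def Un_insert_right ball_simps by (simp add: agree_iff conj_ac)

lemma colouring_rest_cong:
  assumes "\<And>x. x \<notin> {u, partner D u, w, partner D w} \<Longrightarrow> x \<in> Z \<longleftrightarrow> x \<in> Z'"
  shows "colouring Z (D - {{u, partner D u}, {w, partner D w}}) \<longleftrightarrow>
    colouring Z' (D - {{u, partner D u}, {w, partner D w}})"
  unfolding colouring_def
proof (rule ball_cong[OF refl])
  fix e assume e: "e \<in> D - {{u, partner D u}, {w, partner D w}}"
  have "x \<in> Z \<longleftrightarrow> x \<in> Z'" if "x \<in> e" for x
    using that e edge_conv_partner[of e x] u w partner_partner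
    by (intro assms) (auto simp: insert_commute)
  then show "e \<subseteq> Z \<or> e \<inter> Z = {} \<longleftrightarrow> e \<subseteq> Z' \<or> e \<inter> Z' = {}" by blast
qed

end

text \<open>Exchanging the colours of \<open>u\<close> and \<open>v\<close> has the effect of
  exchanging their partners, so \<open>u\<close> is joined to the old partner of \<open>v\<close>.
  This serves both for products with transpositions and for the action on southern nodes.\<close>

lemma colouring_transpose:
  assumes "u \<in> V" "v \<in> V" "v \<noteq> u" "v \<noteq> partner D u"
  shows "colouring {x. transpose u v x \<in> Z} D \<longleftrightarrow> colouring Z (reconnect D u (partner D v))"
proof -
  have w: "partner D v \<in> V" "partner D v \<noteq> u" "partner D v \<noteq> partner D u" and pv: "partner D (partner D v) = v"
    using assms partner_in partner_partner by metis+
  note d = four_distinct[OF assms(1) w]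
  have "colouring {x. transpose u v x \<in> Z} (D - {{u, partner D u}, {partner D v, partner D (partner D v)}}) \<longleftrightarrow>
    colouring Z (D - {{u, partner D u}, {partner D v, partner D (partner D v)}})"
    by (rule colouring_rest_cong[OF assms(1) w]) (auto simp: pv transpose_def)
  then show ?thesis
    using d assms(3)
    unfolding colouring_split[OF assms(1) w] colouring_reconnect[OF assms(1) w] pv
    by (auto simp: transpose_def)
qed

text \<open>The lower arc of an arc generator forces one common colour on \<open>u\<close> and
  \<open>v\<close>. Either choice of it requires both partners to have that colour too.\<close>

lemma colouring_clear:
  assumes "u \<in> V" "v \<in> V" "v \<noteq> u" "v \<noteq> partner D u"
  shows "colouring (Z - {u, v}) D \<longleftrightarrow> colouring Z (D - {{u, partner D u}, {v, partner D v}}) \<and>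
      partner D u \<notin> Z \<and> partner D v \<notin> Z"
    and "colouring (Z \<union> {u, v}) D \<longleftrightarrow> colouring Z (D - {{u, partner D u}, {v, partner D v}}) \<and>
      partner D u \<in> Z \<and> partner D v \<in> Z"
proof -
  note d = four_distinct[OF assms]
  have "colouring (Z - {u, v}) (D - {{u, partner D u}, {v, partner D v}}) \<longleftrightarrow>
      colouring Z (D - {{u, partner D u}, {v, partner D v}})"
    by (rule colouring_rest_cong[OF assms]) auto
  then show "colouring (Z - {u, v}) D \<longleftrightarrow> colouring Z (D - {{u, partner D u}, {v, partner D v}}) \<and>
      partner D u \<notin> Z \<and> partner D v \<notin> Z"
    using d unfolding colouring_split[OF assms] by auto
  have "colouring (Z \<union> {u, v}) (D - {{u, partner D u}, {v, partner D v}}) \<longleftrightarrow>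
      colouring Z (D - {{u, partner D u}, {v, partner D v}})"
    by (rule colouring_rest_cong[OF assms]) auto
  then show "colouring (Z \<union> {u, v}) D \<longleftrightarrow> colouring Z (D - {{u, partner D u}, {v, partner D v}}) \<and>
      partner D u \<in> Z \<and> partner D v \<in> Z"
    using d unfolding colouring_split[OF assms] by auto
qed

text \<open>When \<open>u\<close> is joined to its partner, both choices of their common colour
  leave the same condition on the remaining edges. This is the source of the factor 2 for a closed
  loop.\<close>

lemma colouring_edge:
  assumes "u \<in> V"
  shows "colouring (Z - {u, partner D u}) D \<longleftrightarrow> colouring Z (D - {{u, partner D u}})"
    and "colouring (Z \<union> {u, partner D u}) D \<longleftrightarrow> colouring Z (D - {{u, partner D u}})"
    and "colouring Z D \<longleftrightarrow> colouring Z (D - {{u, partner D u}}) \<and> (u \<in> Z \<longleftrightarrow> partner D u \<in> Z)"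
proof -
  have e: "{u, partner D u} \<in> D" using partner_edge assms by auto
  have dj: "e \<inter> {u, partner D u} = {}" if "e \<in> D" "e \<noteq> {u, partner D u}" for e
    using edge_eq[OF that(1) e] that(2) by blast
  have D: "D = insert {u, partner D u} (D - {{u, partner D u}})" using e by auto
  have ins: "colouring Z D \<longleftrightarrow> (u \<in> Z \<longleftrightarrow> partner D u \<in> Z) \<and> colouring Z (D - {{u, partner D u}})" for Z
    by (subst (1) D) (auto simp: colouring_def)
  then show "colouring Z D \<longleftrightarrow> colouring Z (D - {{u, partner D u}}) \<and> (u \<in> Z \<longleftrightarrow> partner D u \<in> Z)"
    by blast
  have rest: "e \<subseteq> Z - {u, partner D u} \<or> e \<inter> (Z - {u, partner D u}) = {} \<longleftrightarrow> e \<subseteq> Z \<or> e \<inter> Z = {}"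
    "e \<subseteq> Z \<union> {u, partner D u} \<or> e \<inter> (Z \<union> {u, partner D u}) = {} \<longleftrightarrow> e \<subseteq> Z \<or> e \<inter> Z = {}"
    if "e \<in> D - {{u, partner D u}}" for e
    using dj[of e] that by blast+
  have "colouring (Z - {u, partner D u}) (D - {{u, partner D u}}) \<longleftrightarrow> colouring Z (D - {{u, partner D u}})"
    unfolding colouring_def by (rule ball_cong[OF refl rest(1)])
  moreover have "colouring (Z \<union> {u, partner D u}) (D - {{u, partner D u}}) \<longleftrightarrow> colouring Z (D - {{u, partner D u}})"
    unfolding colouring_def by (rule ball_cong[OF refl rest(2)])
  ultimately show "colouring (Z - {u, partner D u}) D \<longleftrightarrow> colouring Z (D - {{u, partner D u}})"
    "colouring (Z \<union> {u, partner D u}) D \<longleftrightarrow> colouring Z (D - {{u, partner D u}})"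
    unfolding ins by auto
qed

end

section \<open>Products with transpositions and arc generators\<close>

definition swap_diagram :: "nat \<Rightarrow> nat \<Rightarrow> nat \<Rightarrow> diagram" where
  "swap_diagram N i j = (\<lambda>k. {North k, South (transpose i j k)}) ` {1..N}"

definition cup_diagram :: "nat \<Rightarrow> nat \<Rightarrow> nat \<Rightarrow> diagram" where
  "cup_diagram N i j =
     insert {North i, North j} (insert {South i, South j} ((\<lambda>k. {North k, South k}) ` ({1..N} - {i, j})))"

lemma partition_on_swap:
  assumes "i \<in> {1..N}" "j \<in> {1..N}"
  shows "partition_on (nodes N N) (swap_diagram N i j)"
proof (rule partition_onI)
  have t: "transpose i j ` {1..N} = {1..N}" using assms by simp
  have "\<Union>(swap_diagram N i j) = North ` {1..N} \<union> South ` transpose i j ` {1..N}"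
    by (auto simp: swap_diagram_def)
  then show "\<Union>(swap_diagram N i j) = nodes N N" unfolding t nodes_def .
  show "disjnt p q" if "p \<in> swap_diagram N i j" "q \<in> swap_diagram N i j" "p \<noteq> q" for p q
    using that by (auto simp: swap_diagram_def disjnt_def inj_eq[OF inj_transpose])
  show "{} \<notin> swap_diagram N i j" by (auto simp: swap_diagram_def)
qed

lemma partition_on_cup:
  assumes "i \<in> {1..N}" "j \<in> {1..N}"
  shows "partition_on (nodes N N) (cup_diagram N i j)"
proof (rule partition_onI)
  have "\<Union>(cup_diagram N i j) = North ` ({1..N} - {i, j} \<union> {i, j}) \<union> South ` ({1..N} - {i, j} \<union> {i, j})"
    unfolding cup_diagram_def by auto
  also have "{1..N} - {i, j} \<union> {i, j} = {1..N}" using assms by auto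
  finally show "\<Union>(cup_diagram N i j) = nodes N N" unfolding nodes_def .
  show "disjnt p q" if "p \<in> cup_diagram N i j" "q \<in> cup_diagram N i j" "p \<noteq> q" for p q
    using that by (auto simp: cup_diagram_def disjnt_def)
  show "{} \<notin> cup_diagram N i j" by (auto simp: cup_diagram_def)
qed

text \<open>As a matrix on row colourings this diagram is a permutation matrix, so the middle row of
  a product with it is forced.\<close>

lemma colouring_swap:
  assumes "i \<in> {1..N}" "j \<in> {1..N}" "F \<subseteq> {1..N}" "G \<subseteq> {1..N}"
  shows "colouring (rows F G) (swap_diagram N i j) \<longleftrightarrow> G = transpose i j ` F"
proof -
  have "colouring (rows F G) (swap_diagram N i j) \<longleftrightarrow> (\<forall>k\<in>{1..N}. k \<in> F \<longleftrightarrow> transpose i j k \<in> G)"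
    by (simp add: colouring_def swap_diagram_def agree_iff)
  also have "\<dots> \<longleftrightarrow> (\<forall>k. k \<in> F \<longleftrightarrow> transpose i j k \<in> G)"
  proof -
    have "transpose i j k \<notin> G" if "k \<notin> {1..N}" for k
      using assms that by (auto simp: transpose_def)
    then show ?thesis using assms(3) by blast
  qed
  also have "\<dots> \<longleftrightarrow> G = transpose i j ` F"
  proof
    assume "\<forall>k. k \<in> F \<longleftrightarrow> transpose i j k \<in> G"
    then show "G = transpose i j ` F" by (auto simp: image_iff) (metis transpose_involutory)
  next
    assume "G = transpose i j ` F"
    then show "\<forall>k. k \<in> F \<longleftrightarrow> transpose i j k \<in> G" by (simp add: inj_image_mem_iff)
  qed
  finally show ?thesis .
qed

text \<open>The upper arc constrains the northern colouring, and the lower arc leaves exactly two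
  possible southern ones.\<close>

lemma colouring_cup:
  assumes "i \<in> {1..N}" "j \<in> {1..N}" "F \<subseteq> {1..N}" "G \<subseteq> {1..N}"
  shows "colouring (rows F G) (cup_diagram N i j) \<longleftrightarrow>
    (i \<in> F \<longleftrightarrow> j \<in> F) \<and> (G = F - {i, j} \<or> G = F \<union> {i, j})"
proof -
  have "colouring (rows F G) (cup_diagram N i j) \<longleftrightarrow>
      (i \<in> F \<longleftrightarrow> j \<in> F) \<and> (i \<in> G \<longleftrightarrow> j \<in> G) \<and> (\<forall>k\<in>{1..N} - {i, j}. k \<in> F \<longleftrightarrow> k \<in> G)"
    by (simp add: colouring_def cup_diagram_def agree_iff conj_ac)
  also have "(\<forall>k\<in>{1..N} - {i, j}. k \<in> F \<longleftrightarrow> k \<in> G) \<longleftrightarrow> F - {i, j} = G - {i, j}"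
    using assms(3,4) by blast
  also have "(i \<in> G \<longleftrightarrow> j \<in> G) \<and> F - {i, j} = G - {i, j} \<longleftrightarrow> G = F - {i, j} \<or> G = F \<union> {i, j}"
    by blast
  finally show ?thesis .
qed

context
  fixes N S D i j
  assumes D: "matching (nodes N S) D" and ij: "i \<in> {1..N}" "j \<in> {1..N}" "i \<noteq> j"
begin

interpretation matching "nodes N S" D by (fact D)

lemma north_mem: "North i \<in> nodes N S" "North j \<in> nodes N S" "North j \<noteq> North i"
  using ij by auto

text \<open>The middle colouring is forced to be the transposed one, so no loop arises. The
  assumption \<open>np\<close> holds for nodes on one side of the wall, as arcs cross it.\<close>

lemma concat_swap:
  assumes np: "{North i, North j} \<notin> D"
  shows "concat_diagram (swap_diagram N i j) D = reconnect D (North i) (partner D (North j))"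
    and "closed_components (swap_diagram N i j) D = 0"
proof -
  have np': "North j \<noteq> partner D (North i)" using np partner_edge north_mem by metis
  then have w: "partner D (North j) \<in> nodes N S" "partner D (North j) \<noteq> North i"
      "partner D (North j) \<noteq> partner D (North i)"
    using north_mem partner_in partner_partner by metis+
  have "card {G. G \<subseteq> {1..N} \<and> colouring (rows F G) (swap_diagram N i j) \<and> colouring (rows G H) D}
      = (if colouring (rows F H) (reconnect D (North i) (partner D (North j))) then 2 ^ 0 else 0)"
    if F: "F \<subseteq> {1..N}" and "H \<subseteq> {1..S}" for F H
  proof -
    have tF: "transpose i j ` F \<subseteq> {1..N}" using F ij by (auto simp: transpose_def)
    have "x \<in> rows (transpose i j ` F) H \<longleftrightarrow> transpose (North i) (North j) x \<in> rows F H" for x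
    proof (cases x)
      case (North k)
      have "k \<in> transpose i j ` F \<longleftrightarrow> transpose i j k \<in> F"
        by (metis (no_types, lifting) image_iff transpose_involutory)
      then show ?thesis using North by (auto simp: transpose_def)
    qed (simp add: transpose_def)
    then have "rows (transpose i j ` F) H = {x. transpose (North i) (North j) x \<in> rows F H}" by blast
    then have "colouring (rows (transpose i j ` F) H) D \<longleftrightarrow>
        colouring (rows F H) (reconnect D (North i) (partner D (North j)))"
      using colouring_transpose[OF north_mem np'] by simp
    moreover have "{G. G \<subseteq> {1..N} \<and> colouring (rows F G) (swap_diagram N i j) \<and> colouring (rows G H) D}
      = (if colouring (rows (transpose i j ` F) H) D then {transpose i j ` F} else {})"
      using colouring_swap[OF ij(1,2) F] tF by auto
    ultimately show ?thesis by simp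
  qed
  from concat_diagramI[OF partition_on_swap[OF ij(1,2)] partition _ this]
  show "concat_diagram (swap_diagram N i j) D = reconnect D (North i) (partner D (North j))"
    "closed_components (swap_diagram N i j) D = 0"
    using matching.partition[OF matching_reconnect[OF north_mem(1) w]] by auto
qed

text \<open>Of the two middle colourings left by the lower arc, only the one matching the colour of
  the old partners survives. The count is therefore at most 1, and there is no loop.\<close>

lemma concat_cup:
  assumes np: "{North i, North j} \<notin> D"
  shows "concat_diagram (cup_diagram N i j) D = reconnect D (North i) (North j)"
    and "closed_components (cup_diagram N i j) D = 0"
proof -
  have np': "North j \<noteq> partner D (North i)" using np partner_edge north_mem by metis
  have "card {G. G \<subseteq> {1..N} \<and> colouring (rows F G) (cup_diagram N i j) \<and> colouring (rows G H) D}
      = (if colouring (rows F H) (reconnect D (North i) (North j)) then 2 ^ 0 else 0)"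
    if F: "F \<subseteq> {1..N}" and "H \<subseteq> {1..S}" for F H
  proof -
    let ?rest = "colouring (rows F H) (D - {{North i, partner D (North i)}, {North j, partner D (North j)}})"
    have r: "rows (F - {i, j}) H = rows F H - {North i, North j}"
      "rows (F \<union> {i, j}) H = rows F H \<union> {North i, North j}" by (auto simp: rows_def)
    have sub: "F - {i, j} \<subseteq> {1..N}" "F \<union> {i, j} \<subseteq> {1..N}" using F ij by auto
    have ne: "F - {i, j} \<noteq> F \<union> {i, j}" by auto
    have "{G. G \<subseteq> {1..N} \<and> colouring (rows F G) (cup_diagram N i j) \<and> colouring (rows G H) D}
      = {G. (i \<in> F \<longleftrightarrow> j \<in> F) \<and> (G = F - {i, j} \<and> colouring (rows (F - {i, j}) H) D \<or>
          G = F \<union> {i, j} \<and> colouring (rows (F \<union> {i, j}) H) D)}"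
    proof (rule Collect_cong)
      fix G
      show "G \<subseteq> {1..N} \<and> colouring (rows F G) (cup_diagram N i j) \<and> colouring (rows G H) D \<longleftrightarrow>
          (i \<in> F \<longleftrightarrow> j \<in> F) \<and> (G = F - {i, j} \<and> colouring (rows (F - {i, j}) H) D \<or>
          G = F \<union> {i, j} \<and> colouring (rows (F \<union> {i, j}) H) D)"
      proof (cases "G \<subseteq> {1..N}")
        case True
        then show ?thesis unfolding colouring_cup[OF ij(1,2) F True] by blast
      next
        case False
        then show ?thesis using sub by blast
      qed
    qed
    also have "\<dots> = (if (i \<in> F \<longleftrightarrow> j \<in> F) \<and> ?rest \<and>
          (partner D (North i) \<in> rows F H \<longleftrightarrow> partner D (North j) \<in> rows F H)
        then {if partner D (North i) \<in> rows F H then F \<union> {i, j} else F - {i, j}} else {})"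
      unfolding r colouring_clear[OF north_mem np'] using ne by auto
    finally show ?thesis
      using colouring_reconnect[OF north_mem np'] by simp
  qed
  from concat_diagramI[OF partition_on_cup[OF ij(1,2)] partition _ this]
  show "concat_diagram (cup_diagram N i j) D = reconnect D (North i) (North j)"
    "closed_components (cup_diagram N i j) D = 0"
    using matching.partition[OF matching_reconnect[OF north_mem np']] by auto
qed

text \<open>Both colours of the middle arc survive; the count doubles, which is the factor 2 of one
  closed component.\<close>

lemma concat_cup_edge:
  assumes e: "{North i, North j} \<in> D"
  shows "concat_diagram (cup_diagram N i j) D = D"
    and "closed_components (cup_diagram N i j) D = 1"
proof -
  have p: "partner D (North i) = North j" using partner_eqI[OF e] .
  have "card {G. G \<subseteq> {1..N} \<and> colouring (rows F G) (cup_diagram N i j) \<and> colouring (rows G H) D}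
      = (if colouring (rows F H) D then 2 ^ 1 else 0)"
    if F: "F \<subseteq> {1..N}" and "H \<subseteq> {1..S}" for F H
  proof -
    have r: "rows (F - {i, j}) H = rows F H - {North i, North j}"
      "rows (F \<union> {i, j}) H = rows F H \<union> {North i, North j}" by (auto simp: rows_def)
    have sub: "F - {i, j} \<subseteq> {1..N}" "F \<union> {i, j} \<subseteq> {1..N}" using F ij by auto
    have ne: "F - {i, j} \<noteq> F \<union> {i, j}" by auto
    note ce = colouring_edge[OF north_mem(1), unfolded p]
    have "{G. G \<subseteq> {1..N} \<and> colouring (rows F G) (cup_diagram N i j) \<and> colouring (rows G H) D}
      = {G. (i \<in> F \<longleftrightarrow> j \<in> F) \<and> (G = F - {i, j} \<and> colouring (rows (F - {i, j}) H) D \<or>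
          G = F \<union> {i, j} \<and> colouring (rows (F \<union> {i, j}) H) D)}"
    proof (rule Collect_cong)
      fix G
      show "G \<subseteq> {1..N} \<and> colouring (rows F G) (cup_diagram N i j) \<and> colouring (rows G H) D \<longleftrightarrow>
          (i \<in> F \<longleftrightarrow> j \<in> F) \<and> (G = F - {i, j} \<and> colouring (rows (F - {i, j}) H) D \<or>
          G = F \<union> {i, j} \<and> colouring (rows (F \<union> {i, j}) H) D)"
      proof (cases "G \<subseteq> {1..N}")
        case True
        then show ?thesis unfolding colouring_cup[OF ij(1,2) F True] by blast
      next
        case False
        then show ?thesis using sub by blast
      qed
    qed
    also have "\<dots> = (if colouring (rows F H) D then {F - {i, j}, F \<union> {i, j}} else {})"
      unfolding r ce(1,2) ce(3)[of "rows F H"] by auto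
    finally show ?thesis using ne by (simp del: Un_insert_right)
  qed
  from concat_diagramI[OF partition_on_cup[OF ij(1,2)] partition partition this]
  show "concat_diagram (cup_diagram N i j) D = D" "closed_components (cup_diagram N i j) D = 1"
    by auto
qed

end

lemma identity_diagram_image: "identity_diagram N = (\<lambda>k. {North k, South k}) ` {1..N}"
  by (auto simp: identity_diagram_def)

lemma partition_on_identity: "partition_on (nodes N N) (identity_diagram N)"
proof (rule partition_onI)
  show "\<Union>(identity_diagram N) = nodes N N" by (auto simp: identity_diagram_image nodes_def)
  show "disjnt p q" if "p \<in> identity_diagram N" "q \<in> identity_diagram N" "p \<noteq> q" for p q
    using that by (auto simp: identity_diagram_image disjnt_def)
  show "{} \<notin> identity_diagram N" by (auto simp: identity_diagram_def)
qed

lemma colouring_identity: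
  assumes "F \<subseteq> {1..N}" "G \<subseteq> {1..N}"
  shows "colouring (rows F G) (identity_diagram N) \<longleftrightarrow> F = G"
proof -
  have "colouring (rows F G) (identity_diagram N) \<longleftrightarrow> (\<forall>k\<in>{1..N}. k \<in> F \<longleftrightarrow> k \<in> G)"
    by (simp add: colouring_def identity_diagram_image agree_iff)
  then show ?thesis using assms by blast
qed

lemma concat_identity_left:
  assumes D: "partition_on (nodes N S) D"
  shows "concat_diagram (identity_diagram N) D = D" "closed_components (identity_diagram N) D = 0"
proof -
  have "card {G. G \<subseteq> {1..N} \<and> colouring (rows F G) (identity_diagram N) \<and> colouring (rows G H) D}
      = (if colouring (rows F H) D then 2 ^ 0 else 0)" if F: "F \<subseteq> {1..N}" for F H
  proof -
    have "{G. G \<subseteq> {1..N} \<and> colouring (rows F G) (identity_diagram N) \<and> colouring (rows G H) D}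
      = (if colouring (rows F H) D then {F} else {})"
      using colouring_identity[OF F] F by auto
    then show ?thesis by simp
  qed
  from concat_diagramI[OF partition_on_identity D D this]
  show "concat_diagram (identity_diagram N) D = D" "closed_components (identity_diagram N) D = 0" by auto
qed

lemma concat_identity_right:
  assumes D: "partition_on (nodes N S) D"
  shows "concat_diagram D (identity_diagram S) = D" "closed_components D (identity_diagram S) = 0"
proof -
  have "card {G. G \<subseteq> {1..S} \<and> colouring (rows F G) D \<and> colouring (rows G H) (identity_diagram S)}
      = (if colouring (rows F H) D then 2 ^ 0 else 0)" if H: "H \<subseteq> {1..S}" for F H
  proof -
    have "{G. G \<subseteq> {1..S} \<and> colouring (rows F G) D \<and> colouring (rows G H) (identity_diagram S)}
      = (if colouring (rows F H) D then {H} else {})"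
      using colouring_identity[OF _ H] H by auto
    then show ?thesis by simp
  qed
  from concat_diagramI[OF D partition_on_identity D this]
  show "concat_diagram D (identity_diagram S) = D" "closed_components D (identity_diagram S) = 0" by auto
qed

section \<open>Reflection of diagrams\<close>

fun flip_node :: "node \<Rightarrow> node" where
  "flip_node (North i) = South i"
| "flip_node (South i) = North i"

definition flip :: "diagram \<Rightarrow> diagram" where
  "flip D = (`) flip_node ` D"

lemma flip_node_flip_node [simp]: "flip_node (flip_node x) = x"
  by (cases x) auto

lemma flip_node_eq_iff [simp]: "flip_node x = flip_node y \<longleftrightarrow> x = y"
  by (cases x; cases y) auto

lemma inj_flip_node: "inj flip_node"
  by (auto intro: injI)

lemma inj_image_flip: "inj ((`) flip_node)"
  by (rule injI) (simp add: inj_image_eq_iff[OF inj_flip_node])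

lemma flip_flip [simp]: "flip (flip D) = D"
  by (auto simp: flip_def image_image)

lemma flip_node_nodes: "flip_node ` nodes N S = nodes S N"
  by (auto simp: nodes_def image_Un image_image)

lemma partition_on_flip:
  assumes "partition_on (nodes N S) D" shows "partition_on (nodes S N) (flip D)"
proof -
  have "partition_on (flip_node ` nodes N S) ((`) flip_node ` D - {{}})"
    by (rule partition_on_inj_image[OF assms]) (auto intro: inj_onI)
  moreover have "{} \<notin> (`) flip_node ` D" using partition_onD3[OF assms] by auto
  ultimately show ?thesis by (simp add: flip_def flip_node_nodes)
qed

lemma matching_flip:
  assumes "matching (nodes N S) D" shows "matching (nodes S N) (flip D)"
proof
  show "partition_on (nodes S N) (flip D)" using partition_on_flip matching.partition[OF assms] .
  show "card e = 2" if "e \<in> flip D" for e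
    using that matching.card_edge[OF assms] by (auto simp: flip_def card_image inj_on_def)
qed

lemma colouring_flip: "colouring (rows F G) (flip D) \<longleftrightarrow> colouring (rows G F) D"
proof -
  have "flip_node x \<in> rows F G \<longleftrightarrow> x \<in> rows G F" for x by (cases x) auto
  from constant_on_image[of flip_node, OF this] show ?thesis by (simp add: colouring_def flip_def)
qed

text \<open>The number of middle colourings does not change when the two factors are reflected and
  exchanged. So reflection reverses products, and multiplication from below follows from
  multiplication from above.\<close>

lemma concat_flip:
  assumes A: "partition_on (nodes N M) A" and B: "partition_on (nodes M S) B"
  shows "concat_diagram (flip B) (flip A) = flip (concat_diagram A B)"
    and "closed_components (flip B) (flip A) = closed_components A B"
proof -
  have "card {G. G \<subseteq> {1..M} \<and> colouring (rows F G) (flip B) \<and> colouring (rows G H) (flip A)}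
    = (if colouring (rows F H) (flip (concat_diagram A B)) then 2 ^ closed_components A B else 0)" for F H
    using card_colourings[OF A B, of H F] by (simp add: colouring_flip conj_commute del: One_nat_def)
  from concat_diagramI[OF partition_on_flip[OF B] partition_on_flip[OF A] partition_on_flip[OF partition_on_concat[OF A B]] this]
  show "concat_diagram (flip B) (flip A) = flip (concat_diagram A B)"
    "closed_components (flip B) (flip A) = closed_components A B" by auto
qed

lemma flip_swap:
  assumes "i \<in> {1..N}" "j \<in> {1..N}" shows "flip (swap_diagram N i j) = swap_diagram N i j"
proof -
  have "transpose i j ` {1..N} = {1..N}" using assms by simp
  then have "swap_diagram N i j = (\<lambda>k. {North k, South (transpose i j k)}) ` transpose i j ` {1..N}"
    by (simp add: swap_diagram_def)
  also have "\<dots> = flip (swap_diagram N i j)"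
    by (simp add: flip_def swap_diagram_def image_image insert_commute)
  finally show ?thesis ..
qed

lemma flip_cup: "flip (cup_diagram N i j) = cup_diagram N i j"
  by (simp add: flip_def cup_diagram_def image_image insert_commute)

lemma partner_flip:
  assumes D: "matching (nodes N S) D" and x: "x \<in> nodes N S"
  shows "partner (flip D) (flip_node x) = flip_node (partner D x)"
proof (rule matching.partner_eqI[OF matching_flip[OF D]])
  have "flip_node ` {x, partner D x} \<in> flip D"
    unfolding flip_def by (rule imageI) (rule matching.partner_edge[OF D x])
  then show "{flip_node x, flip_node (partner D x)} \<in> flip D" by simp
qed

lemma flip_reconnect:
  assumes D: "matching (nodes N S) D" and "u \<in> nodes N S" "w \<in> nodes N S"
  shows "flip (reconnect D u w) = reconnect (flip D) (flip_node u) (flip_node w)"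
proof -
  have diff: "flip (A - B) = flip A - flip B" for A B
    unfolding flip_def by (rule image_set_diff) (simp add: inj_image_flip)
  have flip_insert: "flip (insert e A) = insert (flip_node ` e) (flip A)" for e A
    by (simp add: flip_def)
  have "flip {} = {}" "\<And>A B. flip (A \<union> B) = flip A \<union> flip B" by (auto simp: flip_def)
  then show ?thesis
    unfolding reconnect_def partner_flip[OF D assms(2)] partner_flip[OF D assms(3)]
    by (simp add: diff flip_insert)
qed

context
  fixes N S D i j
  assumes D: "matching (nodes S N) D" and ij: "i \<in> {1..N}" "j \<in> {1..N}" "i \<noteq> j"
begin

lemma south_edge_flip: "{North i, North j} \<in> flip D \<longleftrightarrow> {South i, South j} \<in> D"
proof -
  have "{North i, North j} = flip_node ` {South i, South j}" by simp
  then show ?thesis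
    unfolding flip_def by (metis inj_image_flip inj_image_mem_iff)
qed

lemma south_mem: "South i \<in> nodes S N" "South j \<in> nodes S N"
  using ij by auto

lemma concat_swap_right:
  assumes np: "{South i, South j} \<notin> D"
  shows "concat_diagram D (swap_diagram N i j) = reconnect D (South i) (partner D (South j))"
    and "closed_components D (swap_diagram N i j) = 0"
proof -
  note D' = matching_flip[OF D]
  note c = concat_flip[OF matching.partition[OF D] partition_on_swap[OF ij(1,2)]]
  note s = concat_swap[OF D' ij np[folded south_edge_flip]]
  have "partner (flip D) (North j) = flip_node (partner D (South j))"
    using partner_flip[OF D south_mem(2)] by simp
  then have "flip (concat_diagram D (swap_diagram N i j)) = flip (reconnect D (South i) (partner D (South j)))"
    using c(1) s(1) flip_reconnect[OF D south_mem(1) matching.partner_in[OF D south_mem(2)]]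
    by (simp add: flip_swap[OF ij(1,2)])
  then show "concat_diagram D (swap_diagram N i j) = reconnect D (South i) (partner D (South j))"
    by (metis flip_flip)
  show "closed_components D (swap_diagram N i j) = 0"
    using c(2) s(2) by (simp add: flip_swap[OF ij(1,2)])
qed

lemma concat_cup_right:
  assumes np: "{South i, South j} \<notin> D"
  shows "concat_diagram D (cup_diagram N i j) = reconnect D (South i) (South j)"
    and "closed_components D (cup_diagram N i j) = 0"
proof -
  note D' = matching_flip[OF D]
  note c = concat_flip[OF matching.partition[OF D] partition_on_cup[OF ij(1,2)]]
  note s = concat_cup[OF D' ij np[folded south_edge_flip]]
  have "flip (concat_diagram D (cup_diagram N i j)) = flip (reconnect D (South i) (South j))"
    using c(1) s(1) flip_reconnect[OF D south_mem] by (simp add: flip_cup)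
  then show "concat_diagram D (cup_diagram N i j) = reconnect D (South i) (South j)"
    by (metis flip_flip)
  show "closed_components D (cup_diagram N i j) = 0"
    using c(2) s(2) by (simp add: flip_cup)
qed

lemma concat_cup_edge_right:
  assumes e: "{South i, South j} \<in> D"
  shows "concat_diagram D (cup_diagram N i j) = D"
    and "closed_components D (cup_diagram N i j) = 1"
proof -
  note D' = matching_flip[OF D]
  note c = concat_flip[OF matching.partition[OF D] partition_on_cup[OF ij(1,2)]]
  note s = concat_cup_edge[OF D' ij e[folded south_edge_flip]]
  show "concat_diagram D (cup_diagram N i j) = D"
    using c(1) s(1) by (simp add: flip_cup) (metis flip_flip)
  show "closed_components D (cup_diagram N i j) = 1"
    using c(2) s(2) by (simp add: flip_cup)
qed

end

section \<open>The cancellation of arcs\<close>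

text \<open>A symmetric summand on unordered pairs does not depend on the ranking that picks one
  order of each pair. The two rankings will be nodes and edges, entries and their images under a
  permutation, and entries and boxes of a tableau.\<close>

lemma sum_reorient:
  fixes f h :: "'a \<Rightarrow> nat"
  assumes A: "finite A" and sym: "\<And>x y. x \<in> A \<Longrightarrow> y \<in> A \<Longrightarrow> g x y = g y x"
  shows "(\<Sum>(x, y)\<in>{(x, y). x \<in> A \<and> y \<in> A \<and> f x < f y \<and> h x \<noteq> h y}. g x y) =
    (\<Sum>(x, y)\<in>{(x, y). x \<in> A \<and> y \<in> A \<and> h x < h y \<and> f x \<noteq> f y}. g x y :: 'b::comm_monoid_add)"
proof -
  let ?P = "\<lambda>Q. {(x, y). x \<in> A \<and> y \<in> A \<and> Q x y}"
  have fin: "finite (?P Q)" for Q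
    by (rule finite_subset[of _ "A \<times> A"]) (use A in auto)
  have "(\<Sum>(x, y)\<in>?P (\<lambda>x y. f x < f y \<and> h y < h x). g x y) =
      (\<Sum>(x, y)\<in>?P (\<lambda>x y. h x < h y \<and> f y < f x). g x y)"
    by (rule sum.reindex_bij_witness[of _ prod.swap prod.swap]) (auto simp: sym)
  moreover have un: "(\<Sum>(x, y)\<in>?P Q \<union> ?P Q'. g x y) = (\<Sum>(x, y)\<in>?P Q. g x y) + (\<Sum>(x, y)\<in>?P Q'. g x y)"
    if "\<And>x y. Q x y \<Longrightarrow> \<not> Q' x y" for Q Q'
    by (rule sum.union_disjoint[OF fin fin]) (use that in auto)
  ultimately have "(\<Sum>(x, y)\<in>?P (\<lambda>x y. f x < f y \<and> h x < h y) \<union> ?P (\<lambda>x y. f x < f y \<and> h y < h x). g x y)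
    = (\<Sum>(x, y)\<in>?P (\<lambda>x y. f x < f y \<and> h x < h y) \<union> ?P (\<lambda>x y. h x < h y \<and> f y < f x). g x y)"
    by (subst (1 2) un) auto
  also have "?P (\<lambda>x y. f x < f y \<and> h x < h y) \<union> ?P (\<lambda>x y. f x < f y \<and> h y < h x) =
      ?P (\<lambda>x y. f x < f y \<and> h x \<noteq> h y)" by auto
  also have "?P (\<lambda>x y. f x < f y \<and> h x < h y) \<union> ?P (\<lambda>x y. h x < h y \<and> f y < f x) =
      ?P (\<lambda>x y. h x < h y \<and> f x \<noteq> f y)" by auto
  finally show ?thesis .
qed

definition pairs :: "nat \<Rightarrow> (nat \<times> nat) set" where
  "pairs n = {(i, j). 1 \<le> i \<and> i < j \<and> j \<le> n}"

lemma northern_arcs_iff: "{North i, North j} \<in> northern_arcs D \<longleftrightarrow> {North i, North j} \<in> D \<and> i \<noteq> j"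
  unfolding northern_arcs_def by (auto simp: doubleton_eq_iff)

lemma southern_arcs_iff: "{South i, South j} \<in> southern_arcs D \<longleftrightarrow> {South i, South j} \<in> D \<and> i \<noteq> j"
  unfolding southern_arcs_def by (auto simp: doubleton_eq_iff)

lemma propagating_lines_iff: "{North i, South j} \<in> propagating_lines D \<longleftrightarrow> {North i, South j} \<in> D"
  unfolding propagating_lines_def by (auto simp: doubleton_eq_iff)

lemma finite_pairs [simp]: "finite (pairs n)"
  by (rule finite_subset[of _ "{..n} \<times> {..n}"]) (auto simp: pairs_def)

text \<open>Interleaving even and odd values makes the numbering injective on all nodes and
  increasing along each row.\<close>

fun node_index :: "node \<Rightarrow> nat" where
  "node_index (North i) = 2 * i"
| "node_index (South i) = Suc (2 * i)"

lemma node_index_eq_iff [simp]: "node_index x = node_index y \<longleftrightarrow> x = y"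
  by (cases x; cases y) (auto; presburger)+

text \<open>
  The diagrams \<open>s D\<close> (sign \<open>+\<close>) and \<open>e D\<close> (sign \<open>-\<close>), for \<open>s\<close> the transposition and \<open>e\<close> the
  generator with two arcs at the northern nodes \<open>u, w\<close>, are written in a form that makes sense for
  arbitrary nodes. Replacing \<open>u\<close> by its partner changes the sign, so all terms with \<open>u\<close>
  or \<open>w\<close> on an arc cancel, and the remaining terms are the same from above and from below.
\<close>

definition exchange :: "(diagram \<Rightarrow> 'a::ab_group_add) \<Rightarrow> nat \<Rightarrow> nat \<Rightarrow> diagram \<Rightarrow> node \<Rightarrow> node \<Rightarrow> 'a" where
  "exchange \<phi> m m' D u w =
     (if source m m' u = source m m' w then \<phi> (reconnect D u (partner D w)) else - \<phi> (reconnect D u w))"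

context
  fixes m n m' n' D
  assumes D: "D \<in> walled_diagrams m n m' n'"
begin

interpretation matching "nodes (m + n) (m' + n')" D by (rule matching_walled[OF D])

private abbreviation "V \<equiv> nodes (m + n) (m' + n')"
private abbreviation "\<pi> \<equiv> partner D"

text \<open>Pairs of nodes will be ordered by their edges rather than by themselves, because this
  order does not change when a node is replaced by its partner.\<close>

definition edge_index :: "node \<Rightarrow> nat" where
  "edge_index u = min (node_index u) (node_index (\<pi> u))"

lemma edge_index_partner: "u \<in> V \<Longrightarrow> edge_index (\<pi> u) = edge_index u"
  by (simp add: edge_index_def partner_partner min.commute)

lemma edge_index_eq_iff:
  assumes "u \<in> V" "w \<in> V" shows "edge_index u = edge_index w \<longleftrightarrow> w = u \<or> w = \<pi> u"
proof
  assume "edge_index u = edge_index w"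
  then have "u = w \<or> u = \<pi> w \<or> \<pi> u = w \<or> \<pi> u = \<pi> w"
    by (auto simp: edge_index_def min_def split: if_splits)
  then show "w = u \<or> w = \<pi> u" using assms partner_partner by metis
qed (use assms edge_index_partner in auto)

lemma exchange_sym:
  assumes "u \<in> V" "w \<in> V"
  shows "exchange \<phi> m m' D u w = exchange \<phi> m m' D w u"
proof -
  have "reconnect D u (\<pi> w) = reconnect D w (\<pi> u)"
    using reconnect_partner[of u "\<pi> w"] assms
    by (simp add: partner_in partner_partner reconnect_sym)
  then show ?thesis by (auto simp: exchange_def reconnect_sym)
qed

text \<open>Passing to the partner changes a source into a non-source or conversely, hence switches
  between the two branches of \<open>exchange\<close>, while the diagram produced stays the
  same.\<close>

lemma exchange_partner:
  assumes "u \<in> V" "w \<in> V"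
  shows "exchange \<phi> m m' D (\<pi> u) w = - exchange \<phi> m m' D u w"
proof -
  have "reconnect D (\<pi> u) w = reconnect D u (\<pi> w)"
    using reconnect_partner[of u "\<pi> w"] assms by (simp add: partner_in partner_partner)
  then show ?thesis
    using source_partner[OF D assms(1)] assms by (auto simp: exchange_def reconnect_partner)
qed

text \<open>Sources are matched with their partners, so the sum splits into two opposite halves.
  From the sum being its own negative alone, nothing would follow in characteristic 2.\<close>

lemma sum_partner_cancel:
  assumes A: "finite A" "A \<subseteq> V" and closed: "\<pi> ` A \<subseteq> A"
    and g: "\<And>u. u \<in> A \<Longrightarrow> g (\<pi> u) = - g u"
  shows "sum g A = (0::'b::ab_group_add)"
proof -
  let ?S = "{u \<in> A. source m m' u}" and ?T = "{u \<in> A. \<not> source m m' u}"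
  have "sum g ?T = (\<Sum>u\<in>?S. g (\<pi> u))"
    by (rule sum.reindex_bij_witness[of _ \<pi> \<pi>])
      (use A closed source_partner[OF D] partner_partner in auto)
  also have "\<dots> = - sum g ?S" by (simp add: g sum_negf)
  finally have "sum g ?S + sum g ?T = 0" by simp
  moreover have "sum g A = sum g (?S \<union> ?T)" by (rule arg_cong[of _ _ "sum g"]) auto
  moreover have "\<dots> = sum g ?S + sum g ?T" using A by (intro sum.union_disjoint) auto
  ultimately show ?thesis by simp
qed

context
  fixes \<phi> :: "diagram \<Rightarrow> 'b::ab_group_add"
begin

text \<open>Extension by zero to all ordered pairs turns the sum over pairs into an iterated sum, in
  which each variable can be cancelled separately.\<close>

private definition t where
  "t u w = (if edge_index u < edge_index w then exchange \<phi> m m' D u w else 0)"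

lemma t_partner:
  assumes "u \<in> V" "w \<in> V"
  shows "t (\<pi> u) w = - t u w" "t u (\<pi> w) = - t u w"
proof -
  show "t (\<pi> u) w = - t u w"
    using assms by (simp add: t_def edge_index_partner exchange_partner)
  have "exchange \<phi> m m' D u (\<pi> w) = - exchange \<phi> m m' D u w"
    using assms exchange_partner[of w u \<phi>] exchange_sym[of u "\<pi> w" \<phi>] exchange_sym[of u w \<phi>]
    by (simp add: partner_in)
  then show "t u (\<pi> w) = - t u w" using assms by (simp add: t_def edge_index_partner)
qed

text \<open>Once pairs are ordered by edges, the summand is odd under \<open>\<pi>\<close> in each
  variable. Nodes whose partner lies in the same row then cancel, and only ends of propagating lines
  remain. The map \<open>c\<close> will be \<open>North\<close> or \<open>South\<close>.\<close>

lemma sum_exchange_propagating: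
  assumes c: "\<And>i j. i < j \<longleftrightarrow> node_index (c i) < node_index (c j)" and cV: "c ` {1..N} \<subseteq> V"
  shows "(\<Sum>(i, j)\<in>{(i, j) \<in> pairs N. {c i, c j} \<notin> D}. exchange \<phi> m m' D (c i) (c j)) =
    (\<Sum>u\<in>{u \<in> c ` {1..N}. \<pi> u \<notin> c ` {1..N}}. \<Sum>w\<in>{w \<in> c ` {1..N}. \<pi> w \<notin> c ` {1..N}}. t u w)"
proof -
  let ?A = "c ` {1..N}" and ?B = "{u \<in> c ` {1..N}. \<pi> u \<in> c ` {1..N}}"
    and ?C = "{u \<in> c ` {1..N}. \<pi> u \<notin> c ` {1..N}}"
  have inj: "inj c" by (rule injI) (metis c less_irrefl linorder_neqE_nat)
  have "(\<Sum>(i, j)\<in>{(i, j) \<in> pairs N. {c i, c j} \<notin> D}. exchange \<phi> m m' D (c i) (c j)) =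
    (\<Sum>(u, w)\<in>map_prod c c ` {(i, j) \<in> pairs N. {c i, c j} \<notin> D}. exchange \<phi> m m' D u w)"
    by (subst sum.reindex) (auto simp: inj_eq[OF inj] inj_on_def split_def)
  also have "map_prod c c ` {(i, j) \<in> pairs N. {c i, c j} \<notin> D} =
      {(u, w). u \<in> ?A \<and> w \<in> ?A \<and> node_index u < node_index w \<and> edge_index u \<noteq> edge_index w}"
  proof -
    have "edge_index (c i) \<noteq> edge_index (c j) \<longleftrightarrow> {c i, c j} \<notin> D"
      if "i < j" "i \<in> {1..N}" "j \<in> {1..N}" for i j
    proof -
      have V: "c i \<in> V" "c j \<in> V" using cV that by auto
      have ne: "c j \<noteq> c i" using that by (simp add: inj_eq[OF inj])
      have "c j = \<pi> (c i) \<longleftrightarrow> {c i, c j} \<in> D" using partner_edge[OF V(1)] partner_eqI by metis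
      then show ?thesis using edge_index_eq_iff[OF V] ne by auto
    qed
    then show ?thesis
      by (auto simp: pairs_def image_iff c[symmetric])
  qed
  also have "(\<Sum>(u, w)\<in>\<dots>. exchange \<phi> m m' D u w) =
      (\<Sum>(u, w)\<in>{(u, w). u \<in> ?A \<and> w \<in> ?A \<and> edge_index u < edge_index w \<and> node_index u \<noteq> node_index w}. exchange \<phi> m m' D u w)"
    by (rule sum_reorient) (use cV in \<open>auto intro!: exchange_sym\<close>)
  also have "\<dots> = (\<Sum>(u, w)\<in>?A \<times> ?A. t u w)"
    by (rule sum.mono_neutral_cong_left) (auto simp: t_def split: if_splits)
  also have "\<dots> = (\<Sum>u\<in>?A. \<Sum>w\<in>?A. t u w)" by (rule sum.cartesian_product[symmetric])
  also have "\<dots> = (\<Sum>u\<in>?C. \<Sum>w\<in>?C. t u w)"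
  proof -
    have BV: "finite ?B" "?B \<subseteq> V" "\<pi> ` ?B \<subseteq> ?B" using cV partner_partner by (auto simp: subset_iff)
    \<comment> \<open>A summand odd under \<open>\<pi>\<close> loses all nodes whose partner lies in
      the same row. This is applied to the outer variable and then to the inner one.\<close>
    have split: "sum f ?A = sum f ?C" if "\<And>u. u \<in> ?B \<Longrightarrow> f (\<pi> u) = - f u" for f :: "node \<Rightarrow> 'b"
    proof -
      have "sum f ?A = sum f (?B \<union> ?C)" by (rule arg_cong[of _ _ "sum f"]) auto
      also have "\<dots> = sum f ?B + sum f ?C" by (intro sum.union_disjoint) auto
      also have "sum f ?B = 0" by (rule sum_partner_cancel) (use BV that in auto)
      finally show ?thesis by simp
    qed
    have "(\<Sum>u\<in>?A. \<Sum>w\<in>?A. t u w) = (\<Sum>u\<in>?C. \<Sum>w\<in>?A. t u w)"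
    proof (rule split)
      fix u assume "u \<in> ?B"
      then have "u \<in> V" using BV by auto
      then have "(\<Sum>w\<in>?A. t (\<pi> u) w) = (\<Sum>w\<in>?A. - t u w)"
        using cV by (intro sum.cong refl t_partner) auto
      then show "(\<Sum>w\<in>?A. t (\<pi> u) w) = - (\<Sum>w\<in>?A. t u w)" by (simp add: sum_negf)
    qed
    also have "\<dots> = (\<Sum>u\<in>?C. \<Sum>w\<in>?C. t u w)"
    proof (rule sum.cong[OF refl], rule split)
      fix u w assume "u \<in> ?C" "w \<in> ?B"
      then show "t u (\<pi> w) = - t u w" using cV BV by (intro t_partner) auto
    qed
    finally show ?thesis .
  qed
  finally show ?thesis .
qed

text \<open>Propagating lines identify the remaining northern nodes with the remaining southern
  ones. Replacing both nodes of a pair by their partners changes the sign twice, hence not at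
  all.\<close>

lemma sum_exchange_north_south:
  "(\<Sum>(i, j)\<in>{(i, j) \<in> pairs (m + n). {North i, North j} \<notin> D}. exchange \<phi> m m' D (North i) (North j)) =
   (\<Sum>(i, j)\<in>{(i, j) \<in> pairs (m' + n'). {South i, South j} \<notin> D}. exchange \<phi> m m' D (South i) (South j))"
proof -
  let ?N = "North ` {1..m + n}" and ?S = "South ` {1..m' + n'}"
  have V: "V = ?N \<union> ?S" by (simp add: nodes_def)
  have dj: "?N \<inter> ?S = {}" by auto
  define C where "C = {u \<in> ?N. \<pi> u \<notin> ?N}"
  define E where "E = {u \<in> ?S. \<pi> u \<notin> ?S}"
  have sub: "u \<in> V" if "u \<in> C \<or> u \<in> E" for u using that unfolding V C_def E_def by blast
  have pp: "\<pi> (\<pi> u) = u" if "u \<in> C \<or> u \<in> E" for u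
    using sub[OF that] by (rule partner_partner)
  have CE: "\<pi> u \<in> E" if u: "u \<in> C" for u
  proof -
    have "\<pi> u \<in> ?S" using u partner_in[of u] sub[of u] unfolding V C_def by blast
    then show ?thesis using u pp[of u] dj unfolding C_def E_def by auto
  qed
  have EC: "\<pi> u \<in> C" if u: "u \<in> E" for u
  proof -
    have "\<pi> u \<in> ?N" using u partner_in[of u] sub[of u] unfolding V E_def by blast
    then show ?thesis using u pp[of u] dj unfolding C_def E_def by auto
  qed
  have reindex: "sum f C = (\<Sum>u\<in>E. f (\<pi> u))" for f :: "node \<Rightarrow> 'b"
    by (rule sum.reindex_bij_witness[of _ \<pi> \<pi>]) (auto simp: CE EC pp)
  have "(\<Sum>u\<in>C. \<Sum>w\<in>C. t u w) = (\<Sum>u\<in>E. \<Sum>w\<in>E. t (\<pi> u) (\<pi> w))"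
    by (simp only: reindex)
  also have "\<dots> = (\<Sum>u\<in>E. \<Sum>w\<in>E. t u w)"
  proof (intro sum.cong refl)
    fix u w assume "u \<in> E" "w \<in> E"
    then have "u \<in> V" "w \<in> V" using sub by auto
    then show "t (\<pi> u) (\<pi> w) = t u w" by (simp add: t_partner partner_in)
  qed
  finally have *: "(\<Sum>u\<in>C. \<Sum>w\<in>C. t u w) = (\<Sum>u\<in>E. \<Sum>w\<in>E. t u w)" .
  have "(\<Sum>(i, j)\<in>{(i, j) \<in> pairs (m + n). {North i, North j} \<notin> D}. exchange \<phi> m m' D (North i) (North j)) =
    (\<Sum>u\<in>C. \<Sum>w\<in>C. t u w)"
    unfolding C_def by (rule sum_exchange_propagating) (auto simp: nodes_def)
  moreover have "(\<Sum>(i, j)\<in>{(i, j) \<in> pairs (m' + n'). {South i, South j} \<notin> D}. exchange \<phi> m m' D (South i) (South j)) =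
    (\<Sum>u\<in>E. \<Sum>w\<in>E. t u w)"
    unfolding E_def by (rule sum_exchange_propagating) (auto simp: nodes_def)
  ultimately show ?thesis using * by simp
qed

end

section \<open>Counting arcs and propagating lines\<close>

lemma finite_diagram: "finite D"
  using finite_elements[OF finite_nodes partition] .

lemma card_north: "m + n = card (propagating_lines D) + 2 * card (northern_arcs D)"
proof -
  let ?N = "North ` {1..m + n}"
  have N: "x \<in> ?N \<longleftrightarrow> x \<in> V \<and> (\<exists>i. x = North i)" for x by (auto simp: nodes_def)
  have A: "{u \<in> ?N. \<pi> u \<in> ?N} = \<Union>(northern_arcs D)"
  proof (intro equalityI subsetI)
    fix u assume "u \<in> {u \<in> ?N. \<pi> u \<in> ?N}"
    then obtain i j where ij: "u = North i" "\<pi> u = North j" "u \<in> V" by (auto simp: N)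
    then have "{North i, North j} \<in> northern_arcs D"
      using partner_edge[OF ij(3)] partner_neq[OF ij(3)] by (auto simp: northern_arcs_iff)
    then show "u \<in> \<Union>(northern_arcs D)" using ij by blast
  next
    fix u assume "u \<in> \<Union>(northern_arcs D)"
    then obtain e i j where e: "e \<in> D" "u \<in> e" "e = {North i, North j}" by (auto simp: northern_arcs_def)
    have "e = {u, \<pi> u}" "e \<subseteq> V"
      using edge_conv_partner[OF e(1,2)] edge_subset[OF e(1)] by simp_all
    then show "u \<in> {u \<in> ?N. \<pi> u \<in> ?N}" using e(3) unfolding mem_Collect_eq N by blast
  qed
  have "card (\<Union>(northern_arcs D)) = (\<Sum>e\<in>northern_arcs D. card e)"
    using partition_onD2[OF partition] card_edge
    by (intro card_Union_disjoint) (auto simp: northern_arcs_def disjoint_def pairwise_def disjnt_def)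
  also have "\<dots> = (\<Sum>e\<in>northern_arcs D. 2)" by (intro sum.cong) (auto simp: northern_arcs_def card_edge)
  finally have 1: "card {u \<in> ?N. \<pi> u \<in> ?N} = 2 * card (northern_arcs D)"
    unfolding A by simp
  have "bij_betw (\<lambda>u. {u, \<pi> u}) {u \<in> ?N. \<pi> u \<notin> ?N} (propagating_lines D)"
    unfolding bij_betw_def
  proof
    show "inj_on (\<lambda>u. {u, \<pi> u}) {u \<in> ?N. \<pi> u \<notin> ?N}" by (auto simp: inj_on_def doubleton_eq_iff)
    show "(\<lambda>u. {u, \<pi> u}) ` {u \<in> ?N. \<pi> u \<notin> ?N} = propagating_lines D"
    proof (intro equalityI subsetI)
      fix e assume "e \<in> (\<lambda>u. {u, \<pi> u}) ` {u \<in> ?N. \<pi> u \<notin> ?N}"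
      then obtain u where u: "u \<in> ?N" "\<pi> u \<notin> ?N" "e = {u, \<pi> u}" by blast
      then have uV: "u \<in> V" using N by blast
      then have "\<pi> u \<in> V" "{u, \<pi> u} \<in> D" using partner_in partner_edge by auto
      then obtain i j where "u = North i" "\<pi> u = South j"
        using u(1,2) N by (cases "\<pi> u") auto
      then show "e \<in> propagating_lines D"
        using u(3) \<open>{u, \<pi> u} \<in> D\<close> by (simp add: propagating_lines_iff)
    next
      fix e assume "e \<in> propagating_lines D"
      then obtain i j where e: "e \<in> D" "e = {North i, South j}" by (auto simp: propagating_lines_def)
      have "\<pi> (North i) = South j" using partner_eqI e by blast
      moreover have "North i \<in> ?N" using edge_subset[OF e(1)] e(2) unfolding N by blast
      ultimately
      show "e \<in> (\<lambda>u. {u, \<pi> u}) ` {u \<in> ?N. \<pi> u \<notin> ?N}" using e by (intro image_eqI[of _ _ "North i"]) auto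
    qed
  qed
  then have 2: "card {u \<in> ?N. \<pi> u \<notin> ?N} = card (propagating_lines D)" by (rule bij_betw_same_card)
  have "m + n = card ?N" by (subst card_image) (auto intro: inj_onI)
  also have "?N = {u \<in> ?N. \<pi> u \<in> ?N} \<union> {u \<in> ?N. \<pi> u \<notin> ?N}" by blast
  also have "card \<dots> = card {u \<in> ?N. \<pi> u \<in> ?N} + card {u \<in> ?N. \<pi> u \<notin> ?N}"
    by (intro card_Un_disjoint) auto
  finally show ?thesis using 1 2 by simp
qed

lemma card_pairs_northern_arcs:
  "card {(i, j) \<in> pairs (m + n). {North i, North j} \<in> D} = card (northern_arcs D)"
proof (rule bij_betw_same_card[of "\<lambda>(i, j). {North i, North j}"])
  show "bij_betw (\<lambda>(i, j). {North i, North j}) {(i, j) \<in> pairs (m + n). {North i, North j} \<in> D} (northern_arcs D)"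
    unfolding bij_betw_def
  proof
    show "inj_on (\<lambda>(i, j). {North i, North j}) {(i, j) \<in> pairs (m + n). {North i, North j} \<in> D}"
      by (auto simp: inj_on_def doubleton_eq_iff pairs_def)
    show "(\<lambda>(i, j). {North i, North j}) ` {(i, j) \<in> pairs (m + n). {North i, North j} \<in> D} = northern_arcs D"
    proof (intro equalityI subsetI)
      fix e assume "e \<in> (\<lambda>(i, j). {North i, North j}) ` {(i, j) \<in> pairs (m + n). {North i, North j} \<in> D}"
      then show "e \<in> northern_arcs D" by (auto simp: northern_arcs_iff pairs_def)
    next
      fix e assume "e \<in> northern_arcs D"
      then obtain i j where ij: "i \<noteq> j" "e = {North i, North j}" "e \<in> D" by (auto simp: northern_arcs_def)
      have *: "e \<in> (\<lambda>(i, j). {North i, North j}) ` {(i, j) \<in> pairs (m + n). {North i, North j} \<in> D}"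
        if "i < j" "e = {North i, North j}" for i j
        using that ij(3) edge_subset[OF ij(3)] by (auto simp: pairs_def intro!: image_eqI[of _ _ "(i, j)"])
      show "e \<in> (\<lambda>(i, j). {North i, North j}) ` {(i, j) \<in> pairs (m + n). {North i, North j} \<in> D}"
        using ij(1,2) *[of i j] *[of j i] by (cases "i < j") (auto simp: insert_commute)
    qed
  qed
qed

end

lemma walled_flip:
  assumes "D \<in> walled_diagrams m n m' n'" shows "flip D \<in> walled_diagrams m' n' m n"
  unfolding walled_diagrams_iff
proof (intro conjI ballI)
  show "partition_on (nodes (m' + n') (m + n)) (flip D)"
    by (rule partition_on_flip[OF walled_partition[OF assms]])
  have s: "source m' m (flip_node x) \<longleftrightarrow> \<not> source m m' x" for x by (cases x) auto
  fix e assume "e \<in> flip D"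
  then obtain f where f: "f \<in> D" "e = flip_node ` f" by (auto simp: flip_def)
  then obtain x y where "f = {x, y}" "source m m' x" "\<not> source m m' y"
    using assms unfolding walled_diagrams_iff by blast
  then show "\<exists>x y. e = {x, y} \<and> source m' m x \<and> \<not> source m' m y"
    using f by (intro exI[of _ "flip_node y"] exI[of _ "flip_node x"]) (auto simp: s)
qed

lemma flip_arcs:
  "northern_arcs (flip D) = flip (southern_arcs D)" "propagating_lines (flip D) = flip (propagating_lines D)"
proof -
  have "flip_node ` e = {North i, North j} \<longleftrightarrow> e = {South i, South j}"
    "flip_node ` e = {North i, South j} \<longleftrightarrow> e = {North j, South i}" for e i j
  proof -
    have "flip_node ` e = flip_node ` f \<longleftrightarrow> e = f" for f by (rule inj_image_eq_iff[OF inj_flip_node])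
    from this[of "{South i, South j}"] this[of "{South i, North j}"]
    show "flip_node ` e = {North i, North j} \<longleftrightarrow> e = {South i, South j}"
      "flip_node ` e = {North i, South j} \<longleftrightarrow> e = {North j, South i}" by (simp_all add: insert_commute)
  qed
  note * = this
  have filter: "{e \<in> (`) flip_node ` D. P e} = (`) flip_node ` {e \<in> D. P (flip_node ` e)}" for P
    by blast
  show "northern_arcs (flip D) = flip (southern_arcs D)"
    unfolding northern_arcs_def southern_arcs_def flip_def filter * ..
  have "(\<exists>i j. e = {North j, South i}) \<longleftrightarrow> (\<exists>i j. e = {North i, South j})" for e by blast
  then show "propagating_lines (flip D) = flip (propagating_lines D)"
    unfolding propagating_lines_def flip_def filter * by simp
qed

lemma card_flip: "card (flip D) = card D"
  unfolding flip_def by (rule card_image) (meson inj_image_flip inj_on_subset subset_UNIV)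

lemma card_south:
  assumes "D \<in> walled_diagrams m n m' n'"
  shows "m' + n' = card (propagating_lines D) + 2 * card (southern_arcs D)"
  using card_north[OF walled_flip[OF assms]] by (simp add: flip_arcs card_flip)

lemma card_pairs_southern_arcs:
  assumes "D \<in> walled_diagrams m n m' n'"
  shows "card {(i, j) \<in> pairs (m' + n'). {South i, South j} \<in> D} = card (southern_arcs D)"
proof -
  have "{North i, North j} \<in> flip D \<longleftrightarrow> {South i, South j} \<in> D" for i j
  proof -
    have "{North i, North j} = flip_node ` {South i, South j}" by simp
    then show ?thesis unfolding flip_def by (metis inj_image_flip inj_image_mem_iff)
  qed
  then show ?thesis
    using card_pairs_northern_arcs[OF walled_flip[OF assms]] by (simp add: flip_arcs card_flip)
qed

lemma finite_walled_diagrams: "finite (walled_diagrams m n m' n')"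
  by (rule finite_subset[OF _ finitely_many_partition_on[OF finite_nodes]])
    (auto simp: walled_diagrams_def)

lemma swap_walled:
  assumes "i \<in> {1..r + s}" "j \<in> {1..r + s}" "i \<le> r \<longleftrightarrow> j \<le> r"
  shows "swap_diagram (r + s) i j \<in> walled_diagrams r s r s"
  unfolding walled_diagrams_iff
proof (intro conjI ballI)
  show "partition_on (nodes (r + s) (r + s)) (swap_diagram (r + s) i j)"
    by (rule partition_on_swap[OF assms(1,2)])
  fix e assume "e \<in> swap_diagram (r + s) i j"
  then obtain k where k: "e = {North k, South (transpose i j k)}" by (auto simp: swap_diagram_def)
  have t: "transpose i j k \<le> r \<longleftrightarrow> k \<le> r" using assms(3) by (auto simp: transpose_def)
  show "\<exists>x y. e = {x, y} \<and> source r r x \<and> \<not> source r r y"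
  proof (cases "k \<le> r")
    case True then show ?thesis using k t by (intro exI[of _ "North k"] exI[of _ "South (transpose i j k)"]) auto
  next
    case False then show ?thesis using k t by (intro exI[of _ "South (transpose i j k)"] exI[of _ "North k"]) auto
  qed
qed

lemma identity_walled: "identity_diagram (r + s) \<in> walled_diagrams r s r s"
  unfolding walled_diagrams_iff
proof (intro conjI ballI)
  show "partition_on (nodes (r + s) (r + s)) (identity_diagram (r + s))" by (rule partition_on_identity)
  fix e assume "e \<in> identity_diagram (r + s)"
  then obtain k where k: "e = {North k, South k}" by (auto simp: identity_diagram_def)
  show "\<exists>x y. e = {x, y} \<and> source r r x \<and> \<not> source r r y"
  proof (cases "k \<le> r")
    case True then show ?thesis using k by (intro exI[of _ "North k"] exI[of _ "South k"]) auto
  next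
    case False then show ?thesis using k by (intro exI[of _ "South k"] exI[of _ "North k"]) auto
  qed
qed

lemma cup_walled:
  assumes "i \<in> {1..r + s}" "j \<in> {1..r + s}" "\<not> (i \<le> r \<longleftrightarrow> j \<le> r)"
  shows "cup_diagram (r + s) i j \<in> walled_diagrams r s r s"
  unfolding walled_diagrams_iff
proof (intro conjI ballI)
  show "partition_on (nodes (r + s) (r + s)) (cup_diagram (r + s) i j)"
    by (rule partition_on_cup[OF assms(1,2)])
  have ex: "(\<exists>x y. {u, v} = {x, y} \<and> source r r x \<and> \<not> source r r y) \<longleftrightarrow> source r r u \<noteq> source r r v" for u v
    by (auto simp: doubleton_eq_iff)
  fix e assume "e \<in> cup_diagram (r + s) i j"
  then consider "e = {North i, North j}" | "e = {South i, South j}" | k where "e = {North k, South k}"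
    by (auto simp: cup_diagram_def)
  then show "\<exists>x y. e = {x, y} \<and> source r r x \<and> \<not> source r r y"
    by cases (use assms(3) in \<open>auto simp only: ex source.simps\<close>)
qed

section \<open>The walled Brauer algebra and its Casimir element\<close>

text \<open>A pair of nodes joined by an arc of \<open>D\<close> contributes a closed loop, hence
  the multiple of \<open>\<delta>\<close>; every other pair performs a surgery. The parameter
  \<open>\<phi>\<close> lets one computation serve the algebra and the modules
  \<open>I\<^sup>t\<close>, where diagrams with southern arcs become zero.\<close>

lemma casimir_action_north:
  fixes \<phi> :: "diagram \<Rightarrow> (diagram \<Rightarrow>\<^sub>0 'k::field)" and \<delta> :: 'k
  assumes D: "D \<in> walled_diagrams r s m n"
  defines "f \<equiv> \<lambda>A. scale (\<delta> ^ closed_components A D) (\<phi> (concat_diagram A D))"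
  shows "(\<Sum>(i, j)\<in>pairs (r + s). if i \<le> r \<longleftrightarrow> j \<le> r then f (swap_diagram (r + s) i j) else - f (cup_diagram (r + s) i j)) =
    (\<Sum>(i, j)\<in>{(i, j) \<in> pairs (r + s). {North i, North j} \<notin> D}. exchange \<phi> r m D (North i) (North j))
    - scale (of_nat (card (northern_arcs D)) * \<delta>) (\<phi> D)"
proof -
  note M = matching_walled[OF D]
  interpret matching "nodes (r + s) (m + n)" D by (fact M)
  let ?P = "pairs (r + s)" and ?g = "\<lambda>(i, j). if i \<le> r \<longleftrightarrow> j \<le> r then f (swap_diagram (r + s) i j) else - f (cup_diagram (r + s) i j)"
  let ?A = "{(i, j) \<in> ?P. {North i, North j} \<notin> D}" and ?B = "{(i, j) \<in> ?P. {North i, North j} \<in> D}"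
  have fin: "finite ?A" "finite ?B" by (rule finite_subset[OF _ finite_pairs[of "r + s"]]; auto)+
  have ij: "i \<in> {1..r + s}" "j \<in> {1..r + s}" "i \<noteq> j" if "(i, j) \<in> ?P" for i j
    using that by (auto simp: pairs_def)
  have "sum ?g ?P = sum ?g (?A \<union> ?B)" by (rule arg_cong[of _ _ "sum ?g"]) auto
  also have "\<dots> = sum ?g ?A + sum ?g ?B" using fin by (intro sum.union_disjoint) auto
  also have "sum ?g ?A = (\<Sum>(i, j)\<in>?A. exchange \<phi> r m D (North i) (North j))"
  proof (intro sum.cong refl, clarify)
    fix i j assume p: "(i, j) \<in> ?P" and np: "{North i, North j} \<notin> D"
    show "(if i \<le> r \<longleftrightarrow> j \<le> r then f (swap_diagram (r + s) i j) else - f (cup_diagram (r + s) i j)) =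
      exchange \<phi> r m D (North i) (North j)"
      using concat_swap[OF M ij[OF p] np] concat_cup[OF M ij[OF p] np]
      by (simp add: f_def exchange_def)
  qed
  also have "sum ?g ?B = (\<Sum>(i, j)\<in>?B. - scale \<delta> (\<phi> D))"
  proof (intro sum.cong refl, clarify)
    fix i j assume p: "(i, j) \<in> ?P" and e: "{North i, North j} \<in> D"
    \<comment> \<open>An arc crosses the wall, so the generator at its two ends is an arc generator
      and never a transposition.\<close>
    have "\<not> (i \<le> r \<longleftrightarrow> j \<le> r)"
      using source_partner[OF D, of "North i"] ij[OF p] partner_eqI[OF e] by auto
    then show "(if i \<le> r \<longleftrightarrow> j \<le> r then f (swap_diagram (r + s) i j) else - f (cup_diagram (r + s) i j)) =
      - scale \<delta> (\<phi> D)"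
      using concat_cup_edge[OF M ij[OF p] e] by (simp add: f_def)
  qed
  also have "\<dots> = - scale (of_nat (card (northern_arcs D)) * \<delta>) (\<phi> D)"
  proof -
    have "(\<Sum>(i, j)\<in>?B. - scale \<delta> (\<phi> D)) = (\<Sum>p\<in>?B. scale (- \<delta>) (\<phi> D))"
      by (simp add: scale_minus_left split_def)
    also have "\<dots> = scale (\<Sum>p\<in>?B. - \<delta>) (\<phi> D)" by (rule scale_sum_left[symmetric])
    also have "(\<Sum>p\<in>?B. - \<delta>) = - (of_nat (card ?B) * \<delta>)" by simp
    finally show ?thesis by (simp add: card_pairs_northern_arcs[OF D] scale_minus_left)
  qed
  finally show ?thesis by simp
qed

lemma casimir_action_south:
  fixes \<phi> :: "diagram \<Rightarrow> (diagram \<Rightarrow>\<^sub>0 'k::field)" and \<delta> :: 'k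
  assumes D: "D \<in> walled_diagrams m n r s"
  defines "f \<equiv> \<lambda>A. scale (\<delta> ^ closed_components D A) (\<phi> (concat_diagram D A))"
  shows "(\<Sum>(i, j)\<in>pairs (r + s). if i \<le> r \<longleftrightarrow> j \<le> r then f (swap_diagram (r + s) i j) else - f (cup_diagram (r + s) i j)) =
    (\<Sum>(i, j)\<in>{(i, j) \<in> pairs (r + s). {South i, South j} \<notin> D}. exchange \<phi> m r D (South i) (South j))
    - scale (of_nat (card (southern_arcs D)) * \<delta>) (\<phi> D)"
proof -
  note M = matching_walled[OF D]
  interpret matching "nodes (m + n) (r + s)" D by (fact M)
  let ?P = "pairs (r + s)" and ?g = "\<lambda>(i, j). if i \<le> r \<longleftrightarrow> j \<le> r then f (swap_diagram (r + s) i j) else - f (cup_diagram (r + s) i j)"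
  let ?A = "{(i, j) \<in> ?P. {South i, South j} \<notin> D}" and ?B = "{(i, j) \<in> ?P. {South i, South j} \<in> D}"
  have fin: "finite ?A" "finite ?B" by (rule finite_subset[OF _ finite_pairs[of "r + s"]]; auto)+
  have ij: "i \<in> {1..r + s}" "j \<in> {1..r + s}" "i \<noteq> j" if "(i, j) \<in> ?P" for i j
    using that by (auto simp: pairs_def)
  have "sum ?g ?P = sum ?g (?A \<union> ?B)" by (rule arg_cong[of _ _ "sum ?g"]) auto
  also have "\<dots> = sum ?g ?A + sum ?g ?B" using fin by (intro sum.union_disjoint) auto
  also have "sum ?g ?A = (\<Sum>(i, j)\<in>?A. exchange \<phi> m r D (South i) (South j))"
  proof (intro sum.cong refl, clarify)
    fix i j assume p: "(i, j) \<in> ?P" and np: "{South i, South j} \<notin> D"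
    show "(if i \<le> r \<longleftrightarrow> j \<le> r then f (swap_diagram (r + s) i j) else - f (cup_diagram (r + s) i j)) =
      exchange \<phi> m r D (South i) (South j)"
      using concat_swap_right[OF M ij[OF p] np] concat_cup_right[OF M ij[OF p] np]
      by (simp add: f_def exchange_def)
  qed
  also have "sum ?g ?B = (\<Sum>(i, j)\<in>?B. - scale \<delta> (\<phi> D))"
  proof (intro sum.cong refl, clarify)
    fix i j assume p: "(i, j) \<in> ?P" and e: "{South i, South j} \<in> D"
    have "\<not> (i \<le> r \<longleftrightarrow> j \<le> r)"
      using source_partner[OF D, of "South i"] ij[OF p] partner_eqI[OF e] by auto
    then show "(if i \<le> r \<longleftrightarrow> j \<le> r then f (swap_diagram (r + s) i j) else - f (cup_diagram (r + s) i j)) =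
      - scale \<delta> (\<phi> D)"
      using concat_cup_edge_right[OF M ij[OF p] e] by (simp add: f_def)
  qed
  also have "\<dots> = - scale (of_nat (card (southern_arcs D)) * \<delta>) (\<phi> D)"
  proof -
    have "(\<Sum>(i, j)\<in>?B. - scale \<delta> (\<phi> D)) = (\<Sum>p\<in>?B. scale (- \<delta>) (\<phi> D))"
      by (simp add: scale_minus_left split_def)
    also have "\<dots> = scale (\<Sum>p\<in>?B. - \<delta>) (\<phi> D)" by (rule scale_sum_left[symmetric])
    also have "(\<Sum>p\<in>?B. - \<delta>) = - (of_nat (card ?B) * \<delta>)" by simp
    finally show ?thesis by (simp add: card_pairs_southern_arcs[OF D] scale_minus_left)
  qed
  finally show ?thesis by simp
qed

text \<open>Up to constants, the Casimir element of the general linear Lie algebra on mixed tensors.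
  Its component on two tensor factors is the flip if both are vectors or both are covectors, and
  minus evaluation followed by coevaluation otherwise; hence the signs.\<close>

definition casimir :: "nat \<Rightarrow> nat \<Rightarrow> (diagram \<Rightarrow>\<^sub>0 'k::field)" where
  "casimir r s = (\<Sum>(i, j)\<in>pairs (r + s). if i \<le> r \<longleftrightarrow> j \<le> r
     then Poly_Mapping.single (swap_diagram (r + s) i j) 1
     else Poly_Mapping.single (cup_diagram (r + s) i j) (- 1))"

lemma casimir_closed: "casimir r s \<in> lin_comb (walled_diagrams r s r s)"
  unfolding casimir_def
  by (intro lin_comb_sum) (auto simp: pairs_def intro!: lin_comb_single swap_walled cup_walled)

lemma bilinear_extend_casimir:
  "bilinear_extend f (casimir r s) (Poly_Mapping.single D 1) =
    (\<Sum>(i, j)\<in>pairs (r + s). if i \<le> r \<longleftrightarrow> j \<le> r then f (swap_diagram (r + s) i j) D else - f (cup_diagram (r + s) i j) D)"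
  "bilinear_extend f (Poly_Mapping.single D 1) (casimir r s) =
    (\<Sum>(i, j)\<in>pairs (r + s). if i \<le> r \<longleftrightarrow> j \<le> r then f D (swap_diagram (r + s) i j) else - f D (cup_diagram (r + s) i j))"
  unfolding casimir_def bilinear_extend_sum_left bilinear_extend_sum_right
  by (auto intro!: sum.cong simp: scale_minus_left)

lemma walled_brauer_simps [simp]:
  "carrier (walled_brauer \<delta> r s) = lin_comb (walled_diagrams r s r s)"
  "\<zero>\<^bsub>walled_brauer \<delta> r s\<^esub> = 0" "x \<oplus>\<^bsub>walled_brauer \<delta> r s\<^esub> y = x + y"
  "\<one>\<^bsub>walled_brauer \<delta> r s\<^esub> = Poly_Mapping.single (identity_diagram (r + s)) 1"
  "x \<otimes>\<^bsub>walled_brauer \<delta> r s\<^esub> y =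
    bilinear_extend (\<lambda>A B. Poly_Mapping.single (concat_diagram A B) (\<delta> ^ closed_components A B)) x y"
  by (auto simp: walled_brauer_def)

lemma ring_walled_brauer: "ring (walled_brauer \<delta> r s)"
proof (rule ringI)
  let ?B = "walled_brauer \<delta> r s" and ?W = "walled_diagrams r s r s"
  let ?f = "\<lambda>A B. Poly_Mapping.single (concat_diagram A B) (\<delta> ^ closed_components A B)"
  show "abelian_group ?B"
  proof (rule abelian_groupI)
    fix x assume "x \<in> carrier ?B"
    then show "\<exists>y\<in>carrier ?B. y \<oplus>\<^bsub>?B\<^esub> x = \<zero>\<^bsub>?B\<^esub>" by (intro bexI[of _ "- x"]) auto
  qed (auto simp: add_ac)
  have closed: "bilinear_extend ?f x y \<in> lin_comb ?W" if "x \<in> lin_comb ?W" "y \<in> lin_comb ?W" for x y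
    using that by (rule bilinear_extend_closed) (auto intro: concat_walled)
  show "Group.monoid ?B"
  proof (rule monoidI)
    fix x y z assume "x \<in> carrier ?B" "y \<in> carrier ?B" "z \<in> carrier ?B"
    then show "x \<otimes>\<^bsub>?B\<^esub> y \<otimes>\<^bsub>?B\<^esub> z = x \<otimes>\<^bsub>?B\<^esub> (y \<otimes>\<^bsub>?B\<^esub> z)"
      unfolding walled_brauer_simps
    proof (rule bilinear_extend_assoc)
      fix A B C assume "A \<in> ?W" "B \<in> ?W" "C \<in> ?W"
      note p = this[THEN walled_partition]
      show "bilinear_extend ?f (?f A B) (Poly_Mapping.single C 1) = bilinear_extend ?f (Poly_Mapping.single A 1) (?f B C)"
        using concat_assoc[OF p] by (simp add: power_add[symmetric] add.commute)
    qed
  next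
    fix x assume x: "x \<in> carrier ?B"
    then have x: "x \<in> lin_comb ?W" by simp
    show "\<one>\<^bsub>?B\<^esub> \<otimes>\<^bsub>?B\<^esub> x = x" unfolding walled_brauer_simps
      using x by (induction x rule: lin_comb_induct)
        (simp_all add: bilinear_extend_add_right concat_identity_left[OF walled_partition])
    show "x \<otimes>\<^bsub>?B\<^esub> \<one>\<^bsub>?B\<^esub> = x" unfolding walled_brauer_simps
      using x by (induction x rule: lin_comb_induct)
        (simp_all add: bilinear_extend_add_left concat_identity_right[OF walled_partition])
  qed (use closed identity_walled in auto)
qed (auto simp: bilinear_extend_add_left bilinear_extend_add_right)

text \<open>The surgery terms from above and from below agree, and so do the multiples of
  \<open>\<delta>\<close>, because a diagram with rows of equal length has as many southern as
  northern arcs.\<close>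

lemma casimir_central:
  fixes \<delta> :: "'k::field"
  assumes "x \<in> carrier (walled_brauer \<delta> r s)"
  shows "casimir r s \<otimes>\<^bsub>walled_brauer \<delta> r s\<^esub> x = x \<otimes>\<^bsub>walled_brauer \<delta> r s\<^esub> casimir r s"
  unfolding walled_brauer_simps
proof (rule bilinear_extend_commute_basis)
  show "x \<in> lin_comb (walled_diagrams r s r s)" using assms by simp
  fix D assume D: "D \<in> walled_diagrams r s r s"
  let ?f = "\<lambda>A B. Poly_Mapping.single (concat_diagram A B) (\<delta> ^ closed_components A B)"
  let ?\<phi> = "\<lambda>C. Poly_Mapping.single C (1::'k)"
  have "card (northern_arcs D) = card (southern_arcs D)"
    using card_north[OF D] card_south[OF D] by simp
  then show "bilinear_extend ?f (casimir r s) (Poly_Mapping.single D 1) =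
      bilinear_extend ?f (Poly_Mapping.single D 1) (casimir r s)"
    using casimir_action_north[OF D, of \<delta> ?\<phi>] casimir_action_south[OF D, of \<delta> ?\<phi>]
      sum_exchange_north_south[OF D, of ?\<phi>]
    unfolding bilinear_extend_casimir by (simp cong: if_cong)
qed

definition brauer_scalar :: "nat \<Rightarrow> nat \<Rightarrow> 'k::field \<Rightarrow> (diagram \<Rightarrow>\<^sub>0 'k)" where
  "brauer_scalar r s c = Poly_Mapping.single (identity_diagram (r + s)) c"

lemma brauer_scalar_mult:
  assumes "x \<in> carrier (walled_brauer \<delta> r s)"
  shows "brauer_scalar r s c \<otimes>\<^bsub>walled_brauer \<delta> r s\<^esub> x = scale c x"
    "x \<otimes>\<^bsub>walled_brauer \<delta> r s\<^esub> brauer_scalar r s c = scale c x"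
proof -
  interpret ring "walled_brauer \<delta> r s" by (rule ring_walled_brauer)
  have s: "brauer_scalar r s c = scale c \<one>\<^bsub>walled_brauer \<delta> r s\<^esub>" by (simp add: brauer_scalar_def)
  show "brauer_scalar r s c \<otimes>\<^bsub>walled_brauer \<delta> r s\<^esub> x = scale c x"
    using l_one[OF assms] unfolding s walled_brauer_simps bilinear_extend_scale_left by simp
  show "x \<otimes>\<^bsub>walled_brauer \<delta> r s\<^esub> brauer_scalar r s c = scale c x"
    using r_one[OF assms] unfolding s walled_brauer_simps bilinear_extend_scale_right by simp
qed

lemma algebra_walled_brauer: "algebra_over_field (walled_brauer \<delta> r s) (brauer_scalar r s)"
proof -
  interpret ring "walled_brauer \<delta> r s" by (rule ring_walled_brauer)
  have closed: "brauer_scalar r s c \<in> carrier (walled_brauer \<delta> r s)" for c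
    by (auto simp: brauer_scalar_def intro: identity_walled)
  show ?thesis
    by unfold_locales
      (use closed in \<open>auto simp: brauer_scalar_mult simp del: walled_brauer_simps(1,5)\<close>,
       auto simp: brauer_scalar_def single_add mult.commute)
qed

text \<open>All powers of \<open>z\<close> lie in the span of finitely many diagrams, so one more
  power than there are diagrams already yields a linear relation.\<close>

lemma annihilating_polynomial:
  fixes \<delta> :: "'k::field"
  assumes z: "z \<in> carrier (walled_brauer \<delta> r s)"
    and zc: "\<And>x. x \<in> carrier (walled_brauer \<delta> r s) \<Longrightarrow> z \<otimes>\<^bsub>walled_brauer \<delta> r s\<^esub> x = x \<otimes>\<^bsub>walled_brauer \<delta> r s\<^esub> z"
  obtains P where "P \<noteq> 0" "algebra_over_field.eval_poly (walled_brauer \<delta> r s) (brauer_scalar r s) z P = 0"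
proof -
  interpret algebra_over_field "walled_brauer \<delta> r s" "brauer_scalar r s" by (rule algebra_walled_brauer)
  interpret vs: vector_space "scale :: 'k \<Rightarrow> (diagram \<Rightarrow>\<^sub>0 'k) \<Rightarrow> _"
    by unfold_locales (simp_all add: scale_add scale_add_left)
  note ev_add = eval_poly_add[OF z zc, unfolded walled_brauer_simps]
  have ev_smult: "eval_poly z (smult c p) = scale c (eval_poly z p)" for c p
    using eval_poly_smult[OF z zc] brauer_scalar_mult(1)[OF eval_poly_closed[OF z zc]] by simp
  have ev0: "eval_poly z 0 = 0" using eval_poly_0[OF z zc] by simp
  have ev_sum: "eval_poly z (sum q A) = (\<Sum>a\<in>A. eval_poly z (q a))" for q and A :: "nat set"
    by (induction A rule: infinite_finite_induct) (simp_all add: ev0 ev_add)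
  let ?W = "walled_diagrams r s r s"
  define B where "B = (\<lambda>A. Poly_Mapping.single A (1::'k)) ` ?W"
  have finB: "finite B" by (simp add: B_def finite_walled_diagrams)
  have span: "x \<in> vs.span B" if "x \<in> lin_comb ?W" for x
    using that
  proof (induction x rule: lin_comb_induct)
    case (single a c)
    have "Poly_Mapping.single a c = scale c (Poly_Mapping.single a 1)" by simp
    then show ?case using single vs.span_scale[OF vs.span_base[of "Poly_Mapping.single a 1" B], of c]
      by (simp add: B_def)
  qed (auto intro: vs.span_zero vs.span_add)
  define v where "v n = eval_poly z (Polynomial.monom 1 n)" for n
  have v: "v n \<in> vs.span B" for n
    using eval_poly_closed[OF z zc] by (simp add: v_def span)
  show thesis
  proof (cases "inj_on v {..card B}")
    \<comment> \<open>Linear dependence concerns the set of powers, so a repetition among them is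
      treated apart; it yields a difference of two monomials.\<close>
    case False
    then obtain i j where ij: "i \<noteq> j" "v i = v j" by (auto simp: inj_on_def)
    define P where "P = Polynomial.monom (1::'k) i + smult (- 1) (Polynomial.monom 1 j)"
    have "Polynomial.coeff P i = 1" using ij by (simp add: P_def)
    then have P: "P \<noteq> 0" by auto
    have "eval_poly z P = v i + scale (- 1) (v j)"
      by (simp only: P_def ev_add ev_smult v_def)
    with ij have "eval_poly z P = 0" by (simp add: scale_minus_left)
    with P show ?thesis by (rule that)
  next
    case True
    have "\<not> vs.independent (v ` {..card B})"
    proof
      assume "vs.independent (v ` {..card B})"
      then have "card (v ` {..card B}) \<le> card B"
        using vs.independent_span_bound[OF finB] v by blast
      then show False using True by (simp add: card_image)
    qed
    then obtain u where u: "(\<Sum>x\<in>v ` {..card B}. scale (u x) x) = 0" "\<exists>x\<in>v ` {..card B}. u x \<noteq> 0"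
      using vs.dependent_finite[of "v ` {..card B}"] by auto
    define P where "P = (\<Sum>n\<le>card B. smult (u (v n)) (Polynomial.monom 1 n))"
    obtain n where n: "n \<le> card B" "u (v n) \<noteq> 0" using u(2) by auto
    have "Polynomial.coeff P n = u (v n)"
      using n(1) by (simp add: P_def coeff_sum sum.delta' if_distrib[of "(*) _"] cong: if_cong)
    then have "P \<noteq> 0" using n by auto
    moreover have "eval_poly z P = 0"
      using u(1) True by (simp add: P_def ev_sum ev_smult v_def[symmetric] sum.reindex)
    ultimately show ?thesis by (rule that)
  qed
qed

text \<open>Counting the nodes of both rows shows that there are \<open>t\<close> northern arcs
  exactly when there are no southern ones. In that case every southern node is on a propagating
  line.\<close>

lemma half_diagrams_eq:
  assumes t: "t \<le> min r s"
  shows "half_diagrams r s t = {D \<in> walled_diagrams r s (r - t) (s - t). southern_arcs D = {}}"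
proof -
  have "(card (northern_arcs D) = t \<and>
      (\<forall>j\<in>{1..(r - t) + (s - t)}. \<exists>e\<in>propagating_lines D. South j \<in> e)) \<longleftrightarrow> southern_arcs D = {}"
    if D: "D \<in> walled_diagrams r s (r - t) (s - t)" for D
  proof -
    interpret matching "nodes (r + s) ((r - t) + (s - t))" D by (rule matching_walled[OF D])
    have fin: "finite (southern_arcs D)"
      using finite_diagram[OF D] by (auto simp: southern_arcs_def)
    have card: "card (northern_arcs D) = t \<longleftrightarrow> card (southern_arcs D) = 0"
      using card_north[OF D] card_south[OF D] t by linarith
    have "\<exists>e\<in>propagating_lines D. South j \<in> e" if j: "j \<in> {1..(r - t) + (s - t)}" and no: "southern_arcs D = {}" for j
    proof -
      have jV: "South j \<in> nodes (r + s) ((r - t) + (s - t))" using j by simp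
      show ?thesis
      proof (cases "partner D (South j)")
        case (North i)
        then have "{North i, South j} \<in> D" using partner_edge[OF jV] by (simp add: insert_commute)
        then show ?thesis by (intro bexI[of _ "{North i, South j}"]) (auto simp: propagating_lines_iff)
      next
        case (South i)
        then have "{South j, South i} \<in> southern_arcs D"
          using partner_edge[OF jV] partner_neq[OF jV] by (auto simp: southern_arcs_iff)
        then show ?thesis using no by simp
      qed
    qed
    then show ?thesis using card fin by auto
  qed
  then show ?thesis unfolding half_diagrams_def by blast
qed

lemma propagating_less_iff:
  assumes "D \<in> walled_diagrams m n m' n'"
  shows "card (propagating_lines D) < m' + n' \<longleftrightarrow> southern_arcs D \<noteq> {}"
proof -
  have "finite (southern_arcs D)"
    using finite_diagram[OF assms] by (auto simp: southern_arcs_def)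
  then have "card (southern_arcs D) = 0 \<longleftrightarrow> southern_arcs D = {}" by simp
  then show ?thesis using card_south[OF assms] by linarith
qed

text \<open>The block of the product at the southern node \<open>i\<close> is a colour class and
  lifts to a colouring of \<open>D\<close>. There \<open>i\<close> and \<open>j\<close> have one
  colour, so the block is the arc of \<open>D\<close>. The persistence of southern arcs is what
  makes the truncated action on half diagrams associative.\<close>

lemma southern_arcs_concat:
  assumes A: "A \<in> walled_diagrams m n m' n'" and D: "D \<in> walled_diagrams m' n' m'' n''"
    and arc: "southern_arcs D \<noteq> {}"
  shows "southern_arcs (concat_diagram A D) \<noteq> {}"
proof -
  obtain i j where ij: "{South i, South j} \<in> D" "i \<noteq> j" using arc by (auto simp: southern_arcs_def)
  let ?C = "concat_diagram A D"
  have C: "?C \<in> walled_diagrams m n m'' n''" by (rule concat_walled[OF A D])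
  interpret C: matching "nodes (m + n) (m'' + n'')" ?C by (rule matching_walled[OF C])
  interpret D: matching "nodes (m' + n') (m'' + n'')" D by (rule matching_walled[OF D])
  have V: "South i \<in> nodes (m + n) (m'' + n'')" "South j \<in> nodes (m + n) (m'' + n'')"
    using D.edge_subset[OF ij(1)] by auto
  define e where "e = {South i, partner ?C (South i)}"
  have e: "e \<in> ?C" using C.partner_edge[OF V(1)] by (simp add: e_def)
  have "colouring e ?C" using C.edge_eq e by (auto simp: colouring_def)
  then have "colouring (rows (North -` e) (South -` e)) ?C" by (simp add: rows_vimage)
  then have "card {G. G \<subseteq> {1..m' + n'} \<and> colouring (rows (North -` e) G) A \<and> colouring (rows G (South -` e)) D} \<noteq> 0"
    using card_colourings[OF walled_partition[OF A] walled_partition[OF D]] by simp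
  then have "{G. G \<subseteq> {1..m' + n'} \<and> colouring (rows (North -` e) G) A \<and> colouring (rows G (South -` e)) D} \<noteq> {}"
    by (metis card.empty)
  then obtain G where "colouring (rows G (South -` e)) D" by blast
  then have "South j \<in> e" using ij(1) by (auto simp: colouring_def e_def)
  then have "e = {South i, South j}" using ij(2) by (auto simp: e_def)
  then have "{South i, South j} \<in> southern_arcs ?C" using e ij(2) by (simp add: southern_arcs_iff)
  then show ?thesis by blast
qed

section \<open>Half diagrams\<close>

abbreviation young_group :: "nat \<Rightarrow> nat \<Rightarrow> ((nat \<Rightarrow> nat) \<times> (nat \<Rightarrow> nat)) monoid" where
  "young_group m n \<equiv> sym_group m \<times>\<times> sym_group n"

lemma sym_group_simps [simp]:
  "p \<in> carrier (sym_group n) \<longleftrightarrow> p permutes {1..n}" "p \<otimes>\<^bsub>sym_group n\<^esub> q = p \<circ> q" "\<one>\<^bsub>sym_group n\<^esub> = id"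
  by (auto simp: sym_group_def)

lemma group_sym_group: "group (sym_group n)"
  by (rule sym_group_is_group)

lemma finite_sym_group: "finite (carrier (sym_group n))"
  by (simp add: sym_group_def finite_permutations)

lemma group_young_group: "group (young_group m n)"
  by (intro DirProd_group group_sym_group)

lemma finite_young_group: "finite (carrier (young_group m n))"
  using finite_sym_group by (simp add: DirProd_def)

definition south_act :: "nat \<Rightarrow> (nat \<Rightarrow> nat) \<times> (nat \<Rightarrow> nat) \<Rightarrow> diagram \<Rightarrow> diagram" where
  "south_act m g D = (\<lambda>e. perm_south m g -` e) ` D"

lemma perm_south_id: "perm_south m (id, id) = id"
proof
  fix x show "perm_south m (id, id) x = id x" by (cases x) auto
qed

lemma permutes_le_iff:
  assumes "v permutes {1..m::nat}" shows "v j \<le> m \<longleftrightarrow> j \<le> m"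
proof (cases "j \<in> {1..m}")
  case True then show ?thesis using permutes_in_image[OF assms, of j] by auto
next
  case False then show ?thesis using permutes_not_in[OF assms, of j] by auto
qed

lemma permutes_ge1:
  assumes "v permutes {1..m::nat}" "1 \<le> j" shows "1 \<le> v j"
proof (cases "j \<in> {1..m}")
  case True then show ?thesis using permutes_in_image[OF assms(1), of j] by auto
next
  case False then show ?thesis using permutes_not_in[OF assms(1), of j] assms(2) by auto
qed

lemma perm_south_mult:
  assumes "g \<in> carrier (young_group m n)" "h \<in> carrier (young_group m n)"
  shows "perm_south m (g \<otimes>\<^bsub>young_group m n\<^esub> h) = perm_south m g \<circ> perm_south m h"
proof
  obtain v w v' w' where gh: "g = (v, w)" "h = (v', w')" by (cases g; cases h) auto
  have p: "v' permutes {1..m}" "w' permutes {1..n}" using assms gh by auto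
  fix x
  show "perm_south m (g \<otimes>\<^bsub>young_group m n\<^esub> h) x = (perm_south m g \<circ> perm_south m h) x"
  proof (cases x)
    case (South j)
    have "\<not> j \<le> m \<Longrightarrow> 1 \<le> w' (j - m)" by (rule permutes_ge1[OF p(2)]) auto
    then show ?thesis using South permutes_le_iff[OF p(1), of j] by (auto simp: gh)
  qed (simp add: gh)
qed

lemma south_act_one [simp]: "south_act m (id, id) D = D"
  by (simp add: south_act_def perm_south_id)

lemma south_act_mult:
  assumes "g \<in> carrier (young_group m n)" "h \<in> carrier (young_group m n)"
  shows "south_act m h (south_act m g D) = south_act m (g \<otimes>\<^bsub>young_group m n\<^esub> h) D"
  unfolding perm_south_mult[OF assms] south_act_def image_image vimage_comp ..

lemma bij_perm_south:
  assumes "g \<in> carrier (young_group m n)" shows "bij (perm_south m g)"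
proof -
  interpret group "young_group m n" by (rule group_young_group)
  have one: "\<one>\<^bsub>young_group m n\<^esub> = (id, id)" by simp
  have "perm_south m g \<circ> perm_south m (inv\<^bsub>young_group m n\<^esub> g) = id"
    "perm_south m (inv\<^bsub>young_group m n\<^esub> g) \<circ> perm_south m g = id"
    unfolding perm_south_mult[OF assms inv_closed[OF assms], symmetric]
      perm_south_mult[OF inv_closed[OF assms] assms, symmetric] r_inv[OF assms] l_inv[OF assms]
      one perm_south_id by simp_all
  then show ?thesis by (rule o_bij[rotated])
qed

lemma perm_south_nodes:
  assumes "g \<in> carrier (young_group m n)"
  shows "perm_south m g x \<in> nodes N (m + n) \<longleftrightarrow> x \<in> nodes N (m + n)"
    and "source k m (perm_south m g x) \<longleftrightarrow> source k m x"
proof -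
  obtain v w where g: "g = (v, w)" "v permutes {1..m}" "w permutes {1..n}"
    using assms by (cases g) auto
  have w: "\<not> j \<le> m \<Longrightarrow> 1 \<le> w (j - m)" for j by (rule permutes_ge1[OF g(3)]) auto
  have w2: "w (j - m) \<le> n \<longleftrightarrow> j \<le> m + n" for j
    using permutes_le_iff[OF g(3), of "j - m"] by auto
  have v: "1 \<le> v j \<longleftrightarrow> 1 \<le> j" for j
    using permutes_ge1[OF g(2), of j] permutes_not_in[OF g(2), of 0] by (cases "j = 0") auto
  show "perm_south m g x \<in> nodes N (m + n) \<longleftrightarrow> x \<in> nodes N (m + n)"
    using w w2 v permutes_le_iff[OF g(2)] unfolding g(1)
    by (cases x) (auto intro: trans_le_add1 simp: Suc_le_eq)
  show "source k m (perm_south m g x) \<longleftrightarrow> source k m x"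
    using w permutes_le_iff[OF g(2)] unfolding g(1) by (cases x) (auto simp: Suc_le_eq)
qed

lemma partition_on_south_act:
  assumes g: "g \<in> carrier (young_group m n)" and D: "partition_on (nodes N (m + n)) D"
  shows "partition_on (nodes N (m + n)) (south_act m g D)"
proof -
  have "perm_south m g -` nodes N (m + n) = nodes N (m + n)" using perm_south_nodes(1)[OF g] by auto
  moreover have "{} \<notin> south_act m g D"
    using partition_onD3[OF D] bij_is_surj[OF bij_perm_south[OF g]]
    by (auto simp: south_act_def) (metis empty_iff surj_image_vimage_eq image_empty)
  ultimately show ?thesis
    using partition_on_vimage[OF D, of "perm_south m g"] by (simp add: south_act_def)
qed

lemma colouring_south_act:
  assumes g: "g \<in> carrier (young_group m n)"
  shows "colouring Z (south_act m g D) \<longleftrightarrow> colouring (perm_south m g ` Z) D"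
proof -
  have bij: "bij (perm_south m g)" by (rule bij_perm_south[OF g])
  have "(perm_south m g -` e \<subseteq> Z \<or> perm_south m g -` e \<inter> Z = {}) \<longleftrightarrow>
      (e \<subseteq> perm_south m g ` Z \<or> e \<inter> perm_south m g ` Z = {})" for e
  proof -
    have e: "e = perm_south m g ` (perm_south m g -` e)"
      by (rule surj_image_vimage_eq[OF bij_is_surj[OF bij], symmetric])
    have "x \<in> Z \<longleftrightarrow> perm_south m g x \<in> perm_south m g ` Z" for x
      by (simp add: inj_image_mem_iff[OF bij_is_inj[OF bij]])
    from constant_on_image[OF this[symmetric], of "perm_south m g -` e"] show ?thesis
      unfolding e[symmetric] by simp
  qed
  then show ?thesis by (simp add: colouring_def south_act_def)
qed

text \<open>Only the colouring of the southern row is relabelled and the middle row is untouched.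
  The actions from above and from below therefore commute.\<close>

lemma concat_south_act:
  assumes g: "g \<in> carrier (young_group m n)"
    and A: "partition_on (nodes N M) A" and D: "partition_on (nodes M (m + n)) D"
  shows "concat_diagram A (south_act m g D) = south_act m g (concat_diagram A D)"
    and "closed_components A (south_act m g D) = closed_components A D"
proof -
  have "card {G. G \<subseteq> {1..M} \<and> colouring (rows F G) A \<and> colouring (rows G H) (south_act m g D)}
    = (if colouring (rows F H) (south_act m g (concat_diagram A D)) then 2 ^ closed_components A D else 0)" for F H
  proof -
    define H' where "H' = (\<lambda>j. if j \<le> m then fst g j else m + snd g (j - m)) ` H"
    have r: "perm_south m g ` rows K H = rows K H'" for K
      unfolding H'_def rows_def image_Un image_image by (cases g) (simp cong: if_cong)
    show ?thesis unfolding colouring_south_act[OF g] r by (rule card_colourings[OF A D])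
  qed
  from concat_diagramI[OF A partition_on_south_act[OF g D] partition_on_south_act[OF g partition_on_concat[OF A D]] this]
  show "concat_diagram A (south_act m g D) = south_act m g (concat_diagram A D)"
    "closed_components A (south_act m g D) = closed_components A D" by auto
qed

lemma vimage_doubleton:
  assumes "bij f" shows "f -` {f x, f y} = {x, y}"
  using bij_is_inj[OF assms] by (auto simp: inj_eq)

lemma south_act_walled:
  assumes g: "g \<in> carrier (young_group m' n')" and D: "D \<in> walled_diagrams m n m' n'"
  shows "south_act m' g D \<in> walled_diagrams m n m' n'"
  unfolding walled_diagrams_iff
proof (intro conjI ballI)
  show "partition_on (nodes (m + n) (m' + n')) (south_act m' g D)"
    by (rule partition_on_south_act[OF g walled_partition[OF D]])
  note bij = bij_perm_south[OF g]
  fix e assume "e \<in> south_act m' g D"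
  then obtain f where f: "f \<in> D" "e = perm_south m' g -` f" by (auto simp: south_act_def)
  then obtain x y where xy: "f = {x, y}" "source m m' x" "\<not> source m m' y"
    using D unfolding walled_diagrams_iff by blast
  obtain x' y' where x': "x = perm_south m' g x'" "y = perm_south m' g y'"
    using bij_is_surj[OF bij] by (metis surjD)
  have "e = {x', y'}" unfolding f xy x' by (rule vimage_doubleton[OF bij])
  moreover have "source m m' x'" "\<not> source m m' y'"
    using xy(2,3) perm_south_nodes(2)[OF g] unfolding x' by auto
  ultimately show "\<exists>x y. e = {x, y} \<and> source m m' x \<and> \<not> source m m' y" by blast
qed

lemma southern_arcs_south_act:
  assumes g: "g \<in> carrier (young_group m n)"
  shows "southern_arcs (south_act m g D) = {} \<longleftrightarrow> southern_arcs D = {}"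
proof -
  note bij = bij_perm_south[OF g]
  have S: "\<exists>k. perm_south m g (South j) = South k" for j by (cases g) simp
  have S': "\<exists>k. South j = perm_south m g (South k)" for j
  proof -
    obtain x where x: "South j = perm_south m g x" using bij_is_surj[OF bij] by (metis surjD)
    then show ?thesis by (cases x; cases g) auto
  qed
  have inj: "perm_south m g x = perm_south m g y \<longleftrightarrow> x = y" for x y by (rule inj_eq[OF bij_is_inj[OF bij]])
  have "{South i, South j} \<in> south_act m g D \<longleftrightarrow> {perm_south m g (South i), perm_south m g (South j)} \<in> D" for i j
  proof
    assume "{South i, South j} \<in> south_act m g D"
    then obtain e where "e \<in> D" "{South i, South j} = perm_south m g -` e" by (auto simp: south_act_def)
    moreover have "e = perm_south m g ` (perm_south m g -` e)"
      by (rule surj_image_vimage_eq[OF bij_is_surj[OF bij], symmetric])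
    ultimately show "{perm_south m g (South i), perm_south m g (South j)} \<in> D" by (metis image_empty image_insert)
  next
    assume a: "{perm_south m g (South i), perm_south m g (South j)} \<in> D"
    have "{South i, South j} = perm_south m g -` {perm_south m g (South i), perm_south m g (South j)}"
      by (rule vimage_doubleton[OF bij, symmetric])
    then show "{South i, South j} \<in> south_act m g D"
      unfolding south_act_def using a by (rule image_eqI)
  qed
  note mem = this
  show ?thesis
  proof
    assume a: "southern_arcs (south_act m g D) = {}"
    show "southern_arcs D = {}"
    proof (rule ccontr)
      assume "southern_arcs D \<noteq> {}"
      then obtain i j where ij: "i \<noteq> j" "{South i, South j} \<in> D" by (auto simp: southern_arcs_def)
      obtain i' j' where ij': "South i = perm_south m g (South i')" "South j = perm_south m g (South j')"
        using S' by metis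
      have "i' \<noteq> j'" using ij(1) ij' by (metis node.inject(2))
      then have "{South i', South j'} \<in> southern_arcs (south_act m g D)"
        using ij(2) ij' by (simp add: southern_arcs_iff mem)
      then show False using a by auto
    qed
  next
    assume a: "southern_arcs D = {}"
    show "southern_arcs (south_act m g D) = {}"
    proof (rule ccontr)
      assume "southern_arcs (south_act m g D) \<noteq> {}"
      then obtain i j where ij: "i \<noteq> j" "{South i, South j} \<in> south_act m g D" by (auto simp: southern_arcs_def)
      obtain i' j' where ij': "South i' = perm_south m g (South i)" "South j' = perm_south m g (South j)"
        using S by metis
      have "i' \<noteq> j'" using inj[of "South i" "South j"] ij(1) ij' by auto
      then have "{South i', South j'} \<in> southern_arcs D"
        using ij(2)[unfolded mem, folded ij'] by (simp add: southern_arcs_iff)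
      then show False using a by auto
    qed
  qed
qed

text \<open>The south nodes of a half diagram are attached to distinct north nodes.\<close>

lemma south_act_free:
  assumes D: "D \<in> walled_diagrams m n m' n'" "southern_arcs D = {}"
    and g: "g \<in> carrier (young_group m' n')" and fixed: "south_act m' g D = D"
  shows "g = (id, id)"
proof -
  obtain v w where vw: "g = (v, w)" "v permutes {1..m'}" "w permutes {1..n'}"
    using g by (cases g) auto
  interpret matching "nodes (m + n) (m' + n')" D by (rule matching_walled[OF D(1)])
  have fixed_south: "perm_south m' g (South j) = South j" if j: "j \<in> {1..m' + n'}" for j
  proof -
    have jV: "South j \<in> nodes (m + n) (m' + n')" using j by simp
    obtain i where i: "partner D (South j) = North i"
    proof (cases "partner D (South j)")
      case (South i)
      then have "{South j, South i} \<in> southern_arcs D"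
        using partner_edge[OF jV] partner_neq[OF jV] by (auto simp: southern_arcs_iff)
      then show ?thesis using D(2) by simp
    qed (use that in auto)
    let ?e = "{South j, North i}"
    have e: "?e \<in> D" using partner_edge[OF jV] i by simp
    \<comment> \<open>The preimage of an edge is an edge with the same northern node, so it is the
      same edge, and its southern node is fixed.\<close>
    then have "perm_south m' g -` ?e \<in> D" using fixed unfolding south_act_def by blast
    moreover have "North i \<in> perm_south m' g -` ?e" by (cases g) simp
    ultimately have "perm_south m' g -` ?e = ?e" using edge_eq e by blast
    then have "perm_south m' g (South j) \<in> ?e" by blast
    then show ?thesis by (cases g) auto
  qed
  have "v j = j" for j
  proof (cases "j \<in> {1..m'}")
    case True then show ?thesis using fixed_south[of j] vw by auto
  qed (simp add: permutes_not_in[OF vw(2)])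
  moreover have "w j = j" for j
  proof (cases "j \<in> {1..n'}")
    case True then show ?thesis using fixed_south[of "m' + j"] vw by auto
  qed (simp add: permutes_not_in[OF vw(3)])
  ultimately show ?thesis using vw by (auto simp: fun_eq_iff)
qed

definition young_transposition :: "nat \<Rightarrow> nat \<Rightarrow> nat \<Rightarrow> (nat \<Rightarrow> nat) \<times> (nat \<Rightarrow> nat)" where
  "young_transposition m i j = (if i \<le> m then (transpose i j, id) else (id, transpose (i - m) (j - m)))"

lemma young_transposition_closed:
  assumes "(i, j) \<in> pairs (m + n)" "i \<le> m \<longleftrightarrow> j \<le> m"
  shows "young_transposition m i j \<in> carrier (young_group m n)"
  using assms by (auto simp: young_transposition_def pairs_def permutes_id intro!: permutes_swap_id)

lemma perm_south_young_transposition: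
  assumes "(i, j) \<in> pairs (m + n)" "i \<le> m \<longleftrightarrow> j \<le> m"
  shows "perm_south m (young_transposition m i j) = transpose (South i) (South j)"
proof
  fix x
  show "perm_south m (young_transposition m i j) x = transpose (South i) (South j) x"
    using assms by (cases x) (auto simp: young_transposition_def transpose_def pairs_def)
qed

text \<open>Both sides exchange the partners of two southern nodes. The surgery terms at southern
  nodes on one side of the wall thereby become the right action of transpositions.\<close>

lemma south_act_transposition:
  assumes D: "D \<in> walled_diagrams m n m' n'" and ij: "(i, j) \<in> pairs (m' + n')" "i \<le> m' \<longleftrightarrow> j \<le> m'"
    and np: "{South i, South j} \<notin> D"
  shows "south_act m' (young_transposition m' i j) D = reconnect D (South i) (partner D (South j))"
proof (rule partition_on_eqI)
  interpret matching "nodes (m + n) (m' + n')" D by (rule matching_walled[OF D])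
  note g = young_transposition_closed[OF ij]
  show "partition_on (nodes (m + n) (m' + n')) (south_act m' (young_transposition m' i j) D)"
    by (rule partition_on_south_act[OF g walled_partition[OF D]])
  have V: "South i \<in> nodes (m + n) (m' + n')" "South j \<in> nodes (m + n) (m' + n')" "South j \<noteq> South i"
    using ij by (auto simp: pairs_def)
  have np': "South j \<noteq> partner D (South i)" using np partner_edge[OF V(1)] by metis
  then have w: "partner D (South j) \<in> nodes (m + n) (m' + n')" "partner D (South j) \<noteq> South i"
      "partner D (South j) \<noteq> partner D (South i)"
    using V partner_in partner_partner by metis+
  show "partition_on (nodes (m + n) (m' + n')) (reconnect D (South i) (partner D (South j)))"
    using matching.partition[OF matching_reconnect[OF V(1) w]] .
  fix Z
  have "transpose (South i) (South j) ` Z = {x. transpose (South i) (South j) x \<in> Z}"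
    by (auto simp: image_iff) (metis transpose_involutory)
  then show "colouring Z (south_act m' (young_transposition m' i j) D) \<longleftrightarrow>
      colouring Z (reconnect D (South i) (partner D (South j)))"
    unfolding colouring_south_act[OF g] perm_south_young_transposition[OF ij]
    using colouring_transpose[OF V(1,2,3) np'] by simp
qed

lemma bilinear_extend_commute:
  assumes x: "x \<in> lin_comb A" and y: "y \<in> lin_comb B" and z: "z \<in> lin_comb C"
    and basis: "\<And>a b c. a \<in> A \<Longrightarrow> b \<in> B \<Longrightarrow> c \<in> C \<Longrightarrow>
      bilinear_extend f (Poly_Mapping.single a 1) (g b c) = bilinear_extend g (Poly_Mapping.single b 1) (f a c)"
  shows "bilinear_extend f x (bilinear_extend g y z) = bilinear_extend g y (bilinear_extend f x z)"
  using x
proof (induction x rule: lin_comb_induct)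
  case (single a c1)
  show ?case using y
  proof (induction y rule: lin_comb_induct)
    case (single b c2)
    show ?case using z
    proof (induction z rule: lin_comb_induct)
      case (single c c3)
      have "bilinear_extend f (scale c1 (Poly_Mapping.single a 1)) (g b c)
        = scale c1 (bilinear_extend g (Poly_Mapping.single b 1) (f a c))"
        unfolding bilinear_extend_scale_left using \<open>a \<in> A\<close> \<open>b \<in> B\<close> \<open>c \<in> C\<close> by (simp add: basis)
      moreover have "bilinear_extend g (scale c2 (Poly_Mapping.single b 1)) (f a c)
        = scale c2 (bilinear_extend g (Poly_Mapping.single b 1) (f a c))"
        by (rule bilinear_extend_scale_left)
      ultimately show ?case by (simp add: bilinear_extend_scale_right mult_ac)
    qed (auto simp: bilinear_extend_add_right)
  qed (auto simp: bilinear_extend_add_left bilinear_extend_add_right)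
qed (auto simp: bilinear_extend_add_left bilinear_extend_add_right)

lemma half_right_module_simps [simp]:
  "carrier (half_right_module r s t) = lin_comb (half_diagrams r s t)"
  "\<zero>\<^bsub>half_right_module r s t\<^esub> = 0" "x \<oplus>\<^bsub>half_right_module r s t\<^esub> y = x + y"
  "a \<odot>\<^bsub>half_right_module r s t\<^esub> x =
    bilinear_extend (\<lambda>g D. Poly_Mapping.single (south_act (r - t) g D) 1) a x"
  by (simp_all add: half_right_module_def south_act_def)

text \<open>The class of a diagram modulo the span of all diagrams with southern arcs; the algebra
  acts on \<open>I\<^sup>t\<close> by stacking followed by this map.\<close>

definition survivor :: "diagram \<Rightarrow> (diagram \<Rightarrow>\<^sub>0 'k::field)" where
  "survivor C = (if southern_arcs C = {} then Poly_Mapping.single C 1 else 0)"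

definition half_op :: "'k::field \<Rightarrow> nat \<Rightarrow> nat \<Rightarrow> nat \<Rightarrow> diagram \<Rightarrow> diagram \<Rightarrow> (diagram \<Rightarrow>\<^sub>0 'k)" where
  "half_op \<delta> r s t A D =
     (if card (propagating_lines (concat_diagram A D)) < (r - t) + (s - t) then 0
      else Poly_Mapping.single (concat_diagram A D) (\<delta> ^ closed_components A D))"

lemma half_left_module_smult:
  "a \<odot>\<^bsub>half_left_module \<delta> r s t\<^esub> x = bilinear_extend (half_op \<delta> r s t) a x"
  by (simp add: half_left_module_def half_op_def[abs_def])

definition transposition_sum :: "nat \<Rightarrow> nat \<Rightarrow> ((nat \<Rightarrow> nat) \<times> (nat \<Rightarrow> nat) \<Rightarrow>\<^sub>0 'k::field)" where
  "transposition_sum m n = (\<Sum>(i, j)\<in>{(i, j) \<in> pairs (m + n). i \<le> m \<longleftrightarrow> j \<le> m}.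
     Poly_Mapping.single (young_transposition m i j) 1)"

lemma transposition_sum_closed: "transposition_sum m n \<in> lin_comb (carrier (young_group m n))"
  unfolding transposition_sum_def
  by (intro lin_comb_sum) (auto intro!: lin_comb_single simp del: carrier_DirProd intro: young_transposition_closed)

context
  fixes r s t :: nat and \<delta> :: "'k::field"
  assumes t: "t \<le> min r s"
begin

lemma half_op_eq:
  assumes "A \<in> walled_diagrams r s r s" "D \<in> walled_diagrams r s (r - t) (s - t)"
  shows "half_op \<delta> r s t A D = scale (\<delta> ^ closed_components A D) (survivor (concat_diagram A D))"
  using propagating_less_iff[OF concat_walled[OF assms]] by (simp add: half_op_def survivor_def)

lemma half_walled: "D \<in> half_diagrams r s t \<Longrightarrow> D \<in> walled_diagrams r s (r - t) (s - t)"
  and half_no_arcs: "D \<in> half_diagrams r s t \<Longrightarrow> southern_arcs D = {}"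
  using half_diagrams_eq[OF t] by auto

lemma half_op_closed:
  assumes "A \<in> walled_diagrams r s r s" "D \<in> half_diagrams r s t"
  shows "half_op \<delta> r s t A D \<in> lin_comb (half_diagrams r s t)"
proof -
  have "survivor (concat_diagram A D) \<in> lin_comb (half_diagrams r s t)"
    using concat_walled[OF assms(1) half_walled[OF assms(2)]]
    unfolding survivor_def half_diagrams_eq[OF t] by (auto intro!: lin_comb_single)
  then show ?thesis
    unfolding half_op_eq[OF assms(1) half_walled[OF assms(2)]] by (rule lin_comb_scale)
qed

lemma half_left_closed:
  "a \<in> lin_comb (walled_diagrams r s r s) \<Longrightarrow> x \<in> lin_comb (half_diagrams r s t) \<Longrightarrow>
    a \<odot>\<^bsub>half_left_module \<delta> r s t\<^esub> x \<in> lin_comb (half_diagrams r s t)"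
  unfolding half_left_module_smult by (erule (1) bilinear_extend_closed) (rule half_op_closed)

text \<open>If the inner product already has a southern arc, so has the triple product, and both
  sides vanish. Otherwise this is associativity of stacking together with its count of
  loops.\<close>

lemma half_left_assoc:
  assumes "a \<in> lin_comb (walled_diagrams r s r s)" "b \<in> lin_comb (walled_diagrams r s r s)"
    "x \<in> lin_comb (half_diagrams r s t)"
  shows "(a \<otimes>\<^bsub>walled_brauer \<delta> r s\<^esub> b) \<odot>\<^bsub>half_left_module \<delta> r s t\<^esub> x =
    a \<odot>\<^bsub>half_left_module \<delta> r s t\<^esub> (b \<odot>\<^bsub>half_left_module \<delta> r s t\<^esub> x)"
  unfolding half_left_module_smult walled_brauer_simps
  using assms
proof (rule bilinear_extend_assoc)
  fix A B D assume A: "A \<in> walled_diagrams r s r s" and B: "B \<in> walled_diagrams r s r s" and D: "D \<in> half_diagrams r s t"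
  note D' = half_walled[OF D]
  note BD = concat_walled[OF B D']
  note c = concat_assoc[OF walled_partition[OF A] walled_partition[OF B] walled_partition[OF D']]
  have lhs: "bilinear_extend (half_op \<delta> r s t) (Poly_Mapping.single (concat_diagram A B) (\<delta> ^ closed_components A B)) (Poly_Mapping.single D 1)
    = scale (\<delta> ^ closed_components A B * \<delta> ^ closed_components (concat_diagram A B) D) (survivor (concat_diagram (concat_diagram A B) D))"
    by (simp add: half_op_eq[OF concat_walled[OF A B] D'])
  have rhs: "bilinear_extend (half_op \<delta> r s t) (Poly_Mapping.single A 1) (half_op \<delta> r s t B D)
    = scale (\<delta> ^ closed_components B D * \<delta> ^ closed_components A (concat_diagram B D)) (survivor (concat_diagram A (concat_diagram B D)))"
    using southern_arcs_concat[OF A BD]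
    by (cases "southern_arcs (concat_diagram B D) = {}")
      (simp_all add: half_op_eq[OF B D'] survivor_def[of "concat_diagram B D"] half_op_eq[OF A BD]
        survivor_def[of "concat_diagram A (concat_diagram B D)"])
  show "bilinear_extend (half_op \<delta> r s t) (Poly_Mapping.single (concat_diagram A B) (\<delta> ^ closed_components A B)) (Poly_Mapping.single D 1)
    = bilinear_extend (half_op \<delta> r s t) (Poly_Mapping.single A 1) (half_op \<delta> r s t B D)"
    unfolding lhs rhs power_add[symmetric] c ..
qed

lemma half_left_scalar:
  assumes "x \<in> lin_comb (half_diagrams r s t)"
  shows "brauer_scalar r s c \<odot>\<^bsub>half_left_module \<delta> r s t\<^esub> x = scale c x"
  unfolding half_left_module_smult brauer_scalar_def using assms
proof (induction x rule: lin_comb_induct)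
  case (single D d)
  show ?case
    using concat_identity_left[OF walled_partition[OF half_walled[OF single]]] half_no_arcs[OF single]
    by (simp add: half_op_eq[OF identity_walled half_walled[OF single]] survivor_def)
qed (auto simp: bilinear_extend_add_right scale_add)

lemma south_act_half:
  assumes "g \<in> carrier (young_group (r - t) (s - t))" "D \<in> half_diagrams r s t"
  shows "south_act (r - t) g D \<in> half_diagrams r s t"
  using assms south_act_walled[OF assms(1)] southern_arcs_south_act[OF assms(1), of D]
  by (auto simp: half_diagrams_eq[OF t])

lemma half_right_closed:
  "a \<in> lin_comb (carrier (young_group (r - t) (s - t))) \<Longrightarrow> x \<in> lin_comb (half_diagrams r s t) \<Longrightarrow>
    a \<odot>\<^bsub>half_right_module r s t\<^esub> x \<in> lin_comb (half_diagrams r s t)"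
  unfolding half_right_module_simps by (erule (1) bilinear_extend_closed) (rule lin_comb_single, rule south_act_half)

lemma half_left_right_commute:
  assumes "b \<in> lin_comb (walled_diagrams r s r s)" "a \<in> lin_comb (carrier (young_group (r - t) (s - t)))"
    "x \<in> lin_comb (half_diagrams r s t)"
  shows "b \<odot>\<^bsub>half_left_module \<delta> r s t\<^esub> (a \<odot>\<^bsub>half_right_module r s t\<^esub> x) =
    a \<odot>\<^bsub>half_right_module r s t\<^esub> (b \<odot>\<^bsub>half_left_module \<delta> r s t\<^esub> x)"
  unfolding half_left_module_smult half_right_module_simps
  using assms
proof (rule bilinear_extend_commute)
  fix A g D assume A: "A \<in> walled_diagrams r s r s" and g: "g \<in> carrier (young_group (r - t) (s - t))"
    and D: "D \<in> half_diagrams r s t"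
  note D' = half_walled[OF D]
  note c = concat_south_act[OF g walled_partition[OF A] walled_partition[OF D']]
  show "bilinear_extend (half_op \<delta> r s t) (Poly_Mapping.single A 1) (Poly_Mapping.single (south_act (r - t) g D) 1)
    = bilinear_extend (\<lambda>g D. Poly_Mapping.single (south_act (r - t) g D) 1) (Poly_Mapping.single g 1) (half_op \<delta> r s t A D)"
    by (simp add: half_op_eq[OF A D'] half_op_eq[OF A half_walled[OF south_act_half[OF g D]]] c
        survivor_def southern_arcs_south_act[OF g])
qed

text \<open>The surgery terms are moved from the northern to the southern row. There a pair across
  the wall creates a southern arc and dies, while a pair on one side is a transposition acting from
  the right. The \<open>t\<close> northern arcs leave the multiple of
  \<open>\<delta>\<close>.\<close>

lemma casimir_half:
  assumes "x \<in> lin_comb (half_diagrams r s t)"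
  shows "casimir r s \<odot>\<^bsub>half_left_module \<delta> r s t\<^esub> x =
    transposition_sum (r - t) (s - t) \<odot>\<^bsub>half_right_module r s t\<^esub> x - scale (of_nat t * \<delta>) x"
  using assms
proof (induction x rule: lin_comb_induct)
  case zero then show ?case by (simp add: half_left_module_smult)
next
  case (add x y)
  then show ?case
    by (simp add: half_left_module_smult bilinear_extend_add_right scale_add)
next
  case (single D d)
  let ?m = "r - t" and ?n = "s - t"
  note D = half_walled[OF single] and na = half_no_arcs[OF single]
  let ?\<phi> = "survivor :: diagram \<Rightarrow> (diagram \<Rightarrow>\<^sub>0 'k)"
  interpret matching "nodes (r + s) (?m + ?n)" D by (rule matching_walled[OF D])
  have np: "{South i, South j} \<notin> D" if "(i, j) \<in> pairs (?m + ?n)" for i j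
    using na southern_arcs_iff[of i j D] that by (auto simp: pairs_def)
  have S: "{(i, j) \<in> pairs (?m + ?n). {South i, South j} \<notin> D} = pairs (?m + ?n)" using np by auto
  have card: "card (northern_arcs D) = t" using single by (simp add: half_diagrams_def)
  have "casimir r s \<odot>\<^bsub>half_left_module \<delta> r s t\<^esub> (Poly_Mapping.single D 1) =
    (\<Sum>(i, j)\<in>pairs (r + s). if i \<le> r \<longleftrightarrow> j \<le> r
       then scale (\<delta> ^ closed_components (swap_diagram (r + s) i j) D) (?\<phi> (concat_diagram (swap_diagram (r + s) i j) D))
       else - scale (\<delta> ^ closed_components (cup_diagram (r + s) i j) D) (?\<phi> (concat_diagram (cup_diagram (r + s) i j) D)))"
    unfolding half_left_module_smult bilinear_extend_casimir
  proof (intro sum.cong refl, clarify)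
    fix i j assume "(i, j) \<in> pairs (r + s)"
    then have ij: "i \<in> {1..r + s}" "j \<in> {1..r + s}" by (auto simp: pairs_def)
    show "(if i \<le> r \<longleftrightarrow> j \<le> r then half_op \<delta> r s t (swap_diagram (r + s) i j) D
        else - half_op \<delta> r s t (cup_diagram (r + s) i j) D) =
      (if i \<le> r \<longleftrightarrow> j \<le> r
       then scale (\<delta> ^ closed_components (swap_diagram (r + s) i j) D) (?\<phi> (concat_diagram (swap_diagram (r + s) i j) D))
       else - scale (\<delta> ^ closed_components (cup_diagram (r + s) i j) D) (?\<phi> (concat_diagram (cup_diagram (r + s) i j) D)))"
      using half_op_eq[OF swap_walled[OF ij] D] half_op_eq[OF cup_walled[OF ij] D] by simp
  qed
  also have "\<dots> = (\<Sum>(i, j)\<in>pairs (?m + ?n). exchange ?\<phi> r ?m D (South i) (South j)) - scale (of_nat t * \<delta>) (?\<phi> D)"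
    unfolding casimir_action_north[OF D, of \<delta> ?\<phi>] sum_exchange_north_south[OF D] S card ..
  also have "(\<Sum>(i, j)\<in>pairs (?m + ?n). exchange ?\<phi> r ?m D (South i) (South j)) =
    (\<Sum>(i, j)\<in>{(i, j) \<in> pairs (?m + ?n). i \<le> ?m \<longleftrightarrow> j \<le> ?m}.
      Poly_Mapping.single (south_act ?m (young_transposition ?m i j) D) 1)"
  proof (rule sum.mono_neutral_cong_right)
    show "\<forall>p\<in>pairs (?m + ?n) - {(i, j) \<in> pairs (?m + ?n). i \<le> ?m \<longleftrightarrow> j \<le> ?m}.
        (case p of (i, j) \<Rightarrow> exchange ?\<phi> r ?m D (South i) (South j)) = 0"
    proof
      fix p assume "p \<in> pairs (?m + ?n) - {(i, j) \<in> pairs (?m + ?n). i \<le> ?m \<longleftrightarrow> j \<le> ?m}"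
      then obtain i j where p: "p = (i, j)" and ij: "(i, j) \<in> pairs (?m + ?n)" "\<not> (i \<le> ?m \<longleftrightarrow> j \<le> ?m)"
        by (cases p) auto
      have "{South i, South j} \<in> southern_arcs (reconnect D (South i) (South j))"
        using ij(1) by (auto simp: southern_arcs_iff reconnect_def pairs_def)
      then have "exchange ?\<phi> r ?m D (South i) (South j) = 0"
        using ij(2) by (auto simp: exchange_def survivor_def)
      then show "(case p of (i, j) \<Rightarrow> exchange ?\<phi> r ?m D (South i) (South j)) = 0" by (simp add: p)
    qed
  next
    fix p assume "p \<in> {(i, j) \<in> pairs (?m + ?n). i \<le> ?m \<longleftrightarrow> j \<le> ?m}"
    then obtain i j where p: "p = (i, j)" and ij: "(i, j) \<in> pairs (?m + ?n)" "i \<le> ?m \<longleftrightarrow> j \<le> ?m" by auto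
    have "southern_arcs (south_act ?m (young_transposition ?m i j) D) = {}"
      using southern_arcs_south_act[OF young_transposition_closed[OF ij]] na by auto
    then show "(case p of (i, j) \<Rightarrow> exchange ?\<phi> r ?m D (South i) (South j)) =
        (case p of (i, j) \<Rightarrow> Poly_Mapping.single (south_act ?m (young_transposition ?m i j) D) 1)"
      using ij(2) south_act_transposition[OF D ij np[OF ij(1)]]
      by (simp add: p exchange_def survivor_def)
  qed auto
  also have "?\<phi> D = Poly_Mapping.single D 1" using na by (simp add: survivor_def)
  also have "(\<Sum>(i, j)\<in>{(i, j) \<in> pairs (?m + ?n). i \<le> ?m \<longleftrightarrow> j \<le> ?m}.
      Poly_Mapping.single (south_act ?m (young_transposition ?m i j) D) 1) =
    transposition_sum ?m ?n \<odot>\<^bsub>half_right_module r s t\<^esub> (Poly_Mapping.single D 1)"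
    unfolding transposition_sum_def half_right_module_simps bilinear_extend_sum_left
    by (auto intro!: sum.cong)
  finally have 1: "casimir r s \<odot>\<^bsub>half_left_module \<delta> r s t\<^esub> (Poly_Mapping.single D 1) =
    transposition_sum ?m ?n \<odot>\<^bsub>half_right_module r s t\<^esub> (Poly_Mapping.single D 1) -
    scale (of_nat t * \<delta>) (Poly_Mapping.single D 1)" .
  have s: "Poly_Mapping.single D d = scale d (Poly_Mapping.single D 1)" by simp
  have diff: "scale d (x - y) = scale d x - scale d y" for x y :: "diagram \<Rightarrow>\<^sub>0 'k"
    using scale_add[of d x "- y"] by (simp add: scale_minus)
  show ?case
    unfolding s half_left_module_smult half_right_module_simps bilinear_extend_scale_right
    unfolding 1[unfolded half_left_module_smult half_right_module_simps] diff
    by (simp add: mult_ac)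
qed

text \<open>Left nodes go straight down, right nodes go down with a shift, and arcs join the last
  \<open>t\<close> nodes of the two sides. This is the basis element at which coordinates in
  \<open>I\<^sup>t\<close> are read.\<close>

definition base_half :: diagram where
  "base_half = (\<lambda>i. {North i, South i}) ` {1..r - t} \<union>
     (\<lambda>i. {North (r - t + i), North (r + (s - t) + i)}) ` {1..t} \<union>
     (\<lambda>i. {North (r + i), South (r - t + i)}) ` {1..s - t}"

lemma base_half: "base_half \<in> half_diagrams r s t"
proof -
  have rs: "t \<le> r" "t \<le> s" using t by auto
  have "base_half \<in> walled_diagrams r s (r - t) (s - t)"
    unfolding walled_diagrams_iff
  proof (intro conjI ballI)
    show "partition_on (nodes (r + s) ((r - t) + (s - t))) base_half"
    proof (rule partition_onI)
      have Union: "\<Union>((\<lambda>i. {f i, g i}) ` I) = f ` I \<union> g ` I" for f g :: "nat \<Rightarrow> node" and I by blast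
      have "\<Union>base_half = North ` ({1..r - t} \<union> (+) (r - t) ` {1..t} \<union> (+) r ` {1..s - t} \<union> (+) (r + (s - t)) ` {1..t})
          \<union> South ` ({1..r - t} \<union> (+) (r - t) ` {1..s - t})"
        unfolding base_half_def Union_Un_distrib Union image_Un image_image by (simp only: Un_ac)
      also have "{1..r - t} \<union> (+) (r - t) ` {1..t} \<union> (+) r ` {1..s - t} \<union> (+) (r + (s - t)) ` {1..t} = {1..r + s}"
        unfolding image_add_atLeastAtMost using rs by auto
      also have "{1..r - t} \<union> (+) (r - t) ` {1..s - t} = {1..(r - t) + (s - t)}"
        unfolding image_add_atLeastAtMost by auto
      finally show "\<Union>base_half = nodes (r + s) ((r - t) + (s - t))" by (simp add: nodes_def)
      show "disjnt p q" if "p \<in> base_half" "q \<in> base_half" "p \<noteq> q" for p q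
      proof -
        define L where "L = (\<lambda>i. {North i, South i}) ` {1..r - t}"
        define M where "M = (\<lambda>i. {North (r - t + i), North (r + (s - t) + i)}) ` {1..t}"
        define R where "R = (\<lambda>i. {North (r + i), South (r - t + i)}) ` {1..s - t}"
        have LL: "disjnt p q" if "p \<in> L" "q \<in> L" "p \<noteq> q" for p q using that by (auto simp: L_def disjnt_def)
        have MM: "disjnt p q" if "p \<in> M" "q \<in> M" "p \<noteq> q" for p q
        proof -
          obtain i j where i: "i \<in> {1..t}" "p = {North (r - t + i), North (r + (s - t) + i)}"
            and j: "j \<in> {1..t}" "q = {North (r - t + j), North (r + (s - t) + j)}"
            using \<open>p \<in> M\<close> \<open>q \<in> M\<close> unfolding M_def by blast
          have "i \<noteq> j" using \<open>p \<noteq> q\<close> i j by blast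
          moreover have "r - t + i \<noteq> r + (s - t) + j" "r - t + j \<noteq> r + (s - t) + i"
            using i(1) j(1) rs by auto
          ultimately show ?thesis unfolding i(2) j(2) by (simp add: disjnt_def)
        qed
        have RR: "disjnt p q" if "p \<in> R" "q \<in> R" "p \<noteq> q" for p q using that by (auto simp: R_def disjnt_def)
        have LM: "disjnt p q" "disjnt q p" if "p \<in> L" "q \<in> M" for p q
          using that rs by (auto simp: L_def M_def disjnt_def)
        have LR: "disjnt p q" "disjnt q p" if "p \<in> L" "q \<in> R" for p q
          using that rs by (auto simp: L_def R_def disjnt_def)
        have MR: "disjnt p q" "disjnt q p" if "p \<in> M" "q \<in> R" for p q
          using that rs by (auto simp: M_def R_def disjnt_def)
        have "base_half = L \<union> M \<union> R" unfolding base_half_def L_def M_def R_def ..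
        then have "p \<in> L \<union> M \<union> R" "q \<in> L \<union> M \<union> R" using \<open>p \<in> base_half\<close> \<open>q \<in> base_half\<close> by blast+
        then show ?thesis
          using \<open>p \<noteq> q\<close> by (elim UnE) (simp_all add: LL MM RR LM LR MR)
      qed
      show "{} \<notin> base_half" by (auto simp: base_half_def)
    qed
    fix e assume "e \<in> base_half"
    then consider i where "i \<in> {1..r - t}" "e = {North i, South i}"
      | i where "i \<in> {1..t}" "e = {North (r - t + i), North (r + (s - t) + i)}"
      | i where "i \<in> {1..s - t}" "e = {South (r - t + i), North (r + i)}"
      by (auto simp: base_half_def insert_commute)
    then show "\<exists>x y. e = {x, y} \<and> source r (r - t) x \<and> \<not> source r (r - t) y"
    proof cases
      case 1 then show ?thesis using rs by (intro exI[of _ "North i"] exI[of _ "South i"]) auto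
    next
      case 2 then show ?thesis using rs
        by (intro exI[of _ "North (r - t + i)"] exI[of _ "North (r + (s - t) + i)"]) auto
    next
      case 3 then show ?thesis using rs
        by (intro exI[of _ "South (r - t + i)"] exI[of _ "North (r + i)"]) auto
    qed
  qed
  moreover have "southern_arcs base_half = {}"
    by (auto simp: southern_arcs_def base_half_def doubleton_eq_iff)
  ultimately show ?thesis by (simp add: half_diagrams_eq[OF t])
qed

end

section \<open>Specht modules\<close>

definition tabloid_act :: "(nat \<Rightarrow> nat) \<Rightarrow> tabloid \<Rightarrow> tabloid" where
  "tabloid_act \<sigma> t = (\<lambda>i. \<sigma> ` t i)"

lemma tabloid_act_comp: "tabloid_act (\<sigma> \<circ> \<tau>) t = tabloid_act \<sigma> (tabloid_act \<tau> t)"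
  by (simp add: tabloid_act_def image_comp)

lemma tabloid_act_id [simp]: "tabloid_act id t = t"
  by (simp add: tabloid_act_def)

lemma tabloid_act_ident [simp]: "tabloid_act (\<lambda>x. x) t = t"
  by (simp add: tabloid_act_def)

lemma tabloid_of_comp: "tabloid_of \<alpha> (\<sigma> \<circ> T) = tabloid_act \<sigma> (tabloid_of \<alpha> T)"
  by (auto simp: tabloid_of_def tabloid_act_def)

lemma tabloid_act_transpose_same_row:
  assumes inj: "inj_on T (young_diagram \<alpha>)" and "(i, a) \<in> young_diagram \<alpha>" "(i, b) \<in> young_diagram \<alpha>"
  shows "tabloid_act (transpose (T (i, a)) (T (i, b))) (tabloid_of \<alpha> T) = tabloid_of \<alpha> T"
proof
  fix k
  let ?R = "{T (k, j) | j. (k, j) \<in> young_diagram \<alpha>}"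
  have "T (i, a) \<in> ?R \<longleftrightarrow> k = i" "T (i, b) \<in> ?R \<longleftrightarrow> k = i"
    using assms by (auto dest: inj_onD)
  then have "transpose (T (i, a)) (T (i, b)) ` ?R = ?R" by (intro transpose_image_eq) blast
  then show "tabloid_act (transpose (T (i, a)) (T (i, b))) (tabloid_of \<alpha> T) k = tabloid_of \<alpha> T k"
    by (simp add: tabloid_act_def tabloid_of_def)
qed

text \<open>James' signed column sum of \<open>T\<close>, applied to an arbitrary tabloid so that
  tabloids altered by a transposition can be inserted.\<close>

definition column_sum :: "nat list \<Rightarrow> (nat \<times> nat \<Rightarrow> nat) \<Rightarrow> tabloid \<Rightarrow> (tabloid \<Rightarrow>\<^sub>0 'k::field)" where
  "column_sum \<alpha> T t = (\<Sum>\<pi>\<in>column_stabilizer \<alpha> T. Poly_Mapping.single (tabloid_act \<pi> t) (of_int (sign \<pi>)))"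

lemma polytabloid_eq: "polytabloid \<alpha> T = column_sum \<alpha> T (tabloid_of \<alpha> T)"
  by (simp add: polytabloid_def column_sum_def tabloid_of_comp)

lemma column_stabilizer_permutes: "\<pi> \<in> column_stabilizer \<alpha> T \<Longrightarrow> \<pi> permutes {1..sum_list \<alpha>}"
  by (simp add: column_stabilizer_def)

lemma column_stabilizer_permutation: "\<pi> \<in> column_stabilizer \<alpha> T \<Longrightarrow> permutation \<pi>"
  using column_stabilizer_permutes permutation_permutes by blast

lemma finite_column_stabilizer: "finite (column_stabilizer \<alpha> T)"
  by (rule finite_subset[OF _ finite_permutations[of "{1..sum_list \<alpha>}"]]) (auto simp: column_stabilizer_def)

lemma column_stabilizer_comp:
  assumes "\<pi> \<in> column_stabilizer \<alpha> T" "\<rho> \<in> column_stabilizer \<alpha> T"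
  shows "\<pi> \<circ> \<rho> \<in> column_stabilizer \<alpha> T"
proof -
  have "\<exists>i'. (i', j) \<in> young_diagram \<alpha> \<and> \<pi> (\<rho> (T (i, j))) = T (i', j)" if d: "(i, j) \<in> young_diagram \<alpha>" for i j
  proof -
    obtain k where k: "(k, j) \<in> young_diagram \<alpha>" "\<rho> (T (i, j)) = T (k, j)"
      using assms(2) d by (auto simp: column_stabilizer_def)
    then show ?thesis using assms(1) by (auto simp: column_stabilizer_def)
  qed
  then show ?thesis
    using assms permutes_compose[of \<rho> "{1..sum_list \<alpha>}" \<pi>] by (auto simp: column_stabilizer_def)
qed

lemma id_column_stabilizer: "id \<in> column_stabilizer \<alpha> T"
  by (auto simp: column_stabilizer_def permutes_id)

lemma transpose_column_stabilizer:
  assumes T: "T \<in> tableaux \<alpha>" and d: "(i, j) \<in> young_diagram \<alpha>" "(i', j) \<in> young_diagram \<alpha>"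
  shows "transpose (T (i, j)) (T (i', j)) \<in> column_stabilizer \<alpha> T"
proof -
  have bij: "bij_betw T (young_diagram \<alpha>) {1..sum_list \<alpha>}" using T by (simp add: tableaux_def)
  have "T (i, j) \<in> {1..sum_list \<alpha>}" "T (i', j) \<in> {1..sum_list \<alpha>}"
    using bij_betwE[OF bij] d by blast+
  then have "transpose (T (i, j)) (T (i', j)) permutes {1..sum_list \<alpha>}" by (rule permutes_swap_id)
  moreover have "\<exists>k'. (k', l) \<in> young_diagram \<alpha> \<and> transpose (T (i, j)) (T (i', j)) (T (k, l)) = T (k', l)"
    if kl: "(k, l) \<in> young_diagram \<alpha>" for k l
  proof -
    have inj: "T (k, l) = T (i, j) \<longleftrightarrow> k = i \<and> l = j" "T (k, l) = T (i', j) \<longleftrightarrow> k = i' \<and> l = j"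
      using inj_on_eq_iff[OF bij_betw_imp_inj_on[OF bij]] kl d by auto
    show ?thesis
      using d kl by (cases "T (k, l) = T (i, j)"; cases "T (k, l) = T (i', j)") (auto simp: inj)
  qed
  ultimately show ?thesis by (auto simp: column_stabilizer_def)
qed

context
  fixes \<alpha> T x y
  assumes \<rho>: "transpose x y \<in> column_stabilizer \<alpha> T" and xy: "x \<noteq> y"
begin

lemma sign_transpose_comp:
  "\<pi> \<in> column_stabilizer \<alpha> T \<Longrightarrow> sign (\<pi> \<circ> transpose x y) = - sign \<pi>"
  using column_stabilizer_permutation[of \<pi>] xy
  by (simp add: sign_compose permutation_swap_id sign_swap_id)

text \<open>Composing with an odd element of the column stabilizer permutes the terms and reverses
  every sign.\<close>

lemma column_sum_transpose:
  "column_sum \<alpha> T (tabloid_act (transpose x y) t) = - column_sum \<alpha> T t"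
proof -
  have "column_sum \<alpha> T (tabloid_act (transpose x y) t) =
    (\<Sum>\<pi>\<in>column_stabilizer \<alpha> T. - Poly_Mapping.single (tabloid_act \<pi> t) (of_int (sign \<pi>)))"
    unfolding column_sum_def
    by (rule sum.reindex_bij_witness[of _ "\<lambda>\<pi>. \<pi> \<circ> transpose x y" "\<lambda>\<pi>. \<pi> \<circ> transpose x y"])
      (auto simp: comp_assoc column_stabilizer_comp \<rho> sign_transpose_comp tabloid_act_comp single_uminus)
  then show ?thesis by (simp add: sum_negf column_sum_def)
qed

text \<open>Even and odd elements of the column stabilizer are matched, so that characteristic 2 is covered.\<close>

lemma column_sum_eq_0:
  assumes "tabloid_act (transpose x y) t = t"
  shows "column_sum \<alpha> T t = (0 :: tabloid \<Rightarrow>\<^sub>0 'k::field)"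
proof -
  let ?C = "column_stabilizer \<alpha> T"
  let ?g = "\<lambda>\<pi>. Poly_Mapping.single (tabloid_act \<pi> t) (of_int (sign \<pi>) :: 'k)"
  let ?A = "{\<pi> \<in> ?C. sign \<pi> = 1}" and ?B = "{\<pi> \<in> ?C. sign \<pi> \<noteq> 1}"
  have sgn: "sign \<pi> = 1 \<or> sign \<pi> = -1" for \<pi> :: "nat \<Rightarrow> nat" by (auto simp: sign_def)
  have t: "tabloid_act (\<pi> \<circ> transpose x y) t = tabloid_act \<pi> t" for \<pi>
    by (simp add: tabloid_act_comp assms)
  have "sum ?g ?B = (\<Sum>\<pi>\<in>?A. - ?g \<pi>)"
    by (rule sum.reindex_bij_witness[of _ "\<lambda>\<pi>. \<pi> \<circ> transpose x y" "\<lambda>\<pi>. \<pi> \<circ> transpose x y"])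
      (use sgn in \<open>auto simp: comp_assoc column_stabilizer_comp \<rho> sign_transpose_comp t single_uminus\<close>)
  moreover have "sum ?g ?C = sum ?g ?A + sum ?g ?B"
    using sum.union_disjoint[of ?A ?B ?g] finite_column_stabilizer[of \<alpha> T]
    by (subst sum.union_disjoint[symmetric]) (auto intro!: arg_cong[of _ _ "sum ?g"])
  ultimately show ?thesis unfolding column_sum_def sum_negf by (simp only: add.right_inverse)
qed

end

lemma column_stabilizer_conj:
  assumes \<sigma>: "\<sigma> permutes {1..sum_list \<alpha>}" and \<pi>: "\<pi> \<in> column_stabilizer \<alpha> T"
  shows "\<sigma> \<circ> \<pi> \<circ> inv' \<sigma> \<in> column_stabilizer \<alpha> (\<sigma> \<circ> T)"
proof -
  have "\<sigma> \<circ> \<pi> \<circ> inv' \<sigma> permutes {1..sum_list \<alpha>}"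
    by (intro permutes_compose permutes_inv \<sigma> column_stabilizer_permutes[OF \<pi>])
  moreover have "\<exists>i'. (i', j) \<in> young_diagram \<alpha> \<and> (\<sigma> \<circ> \<pi> \<circ> inv' \<sigma>) ((\<sigma> \<circ> T) (i, j)) = (\<sigma> \<circ> T) (i', j)"
    if d: "(i, j) \<in> young_diagram \<alpha>" for i j
  proof -
    obtain k where "(k, j) \<in> young_diagram \<alpha>" "\<pi> (T (i, j)) = T (k, j)"
      using \<pi> d by (auto simp: column_stabilizer_def)
    then show ?thesis by (intro exI[of _ k]) (simp add: permutes_inverses(2)[OF \<sigma>])
  qed
  ultimately show ?thesis unfolding column_stabilizer_def by blast
qed

lemma tableaux_comp:
  assumes "\<sigma> permutes {1..sum_list \<alpha>}" "T \<in> tableaux \<alpha>" shows "\<sigma> \<circ> T \<in> tableaux \<alpha>"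
  using assms bij_betw_trans[OF _ permutes_imp_bij[OF assms(1)]] by (auto simp: tableaux_def)

text \<open>Conjugation by \<open>\<sigma>\<close> carries the column stabilizer of \<open>T\<close>
  to that of \<open>\<sigma> \<circ> T\<close> and preserves signs. So the symmetric group permutes
  the polytabloids.\<close>

lemma polytabloid_comp:
  assumes \<sigma>: "\<sigma> permutes {1..sum_list \<alpha>}"
  shows "polytabloid \<alpha> (\<sigma> \<circ> T) =
    (\<Sum>\<pi>\<in>column_stabilizer \<alpha> T. Poly_Mapping.single (tabloid_act \<sigma> (tabloid_act \<pi> (tabloid_of \<alpha> T))) (of_int (sign \<pi>)))"
proof -
  note inv\<sigma>\<sigma> = permutes_inv_o[OF \<sigma>]
  have inv\<sigma>: "inv' \<sigma> permutes {1..sum_list \<alpha>}" by (rule permutes_inv[OF \<sigma>])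
  have backwards: "inv' \<sigma> \<circ> \<pi> \<circ> \<sigma> \<in> column_stabilizer \<alpha> T" if "\<pi> \<in> column_stabilizer \<alpha> (\<sigma> \<circ> T)" for \<pi>
    using column_stabilizer_conj[OF inv\<sigma> that]
    by (simp add: o_assoc inv\<sigma>\<sigma> permutes_inv_inv[OF \<sigma>])
  show ?thesis
    unfolding polytabloid_eq column_sum_def
  proof (rule sum.reindex_bij_witness[of _ "\<lambda>\<pi>. \<sigma> \<circ> \<pi> \<circ> inv' \<sigma>" "\<lambda>\<pi>. inv' \<sigma> \<circ> \<pi> \<circ> \<sigma>"])
    fix \<pi> assume \<pi>: "\<pi> \<in> column_stabilizer \<alpha> (\<sigma> \<circ> T)"
    show "\<sigma> \<circ> (inv' \<sigma> \<circ> \<pi> \<circ> \<sigma>) \<circ> inv' \<sigma> = \<pi>"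
      by (metis (no_types, lifting) comp_assoc comp_id id_comp inv\<sigma>\<sigma>(1))
    show "inv' \<sigma> \<circ> \<pi> \<circ> \<sigma> \<in> column_stabilizer \<alpha> T" by (rule backwards[OF \<pi>])
    have "sign (inv' \<sigma> \<circ> \<pi> \<circ> \<sigma>) = sign \<pi>"
    proof -
      have p: "permutation \<sigma>" "permutation (inv' \<sigma>)" "permutation \<pi>"
        using \<sigma> inv\<sigma> column_stabilizer_permutation[OF \<pi>] permutation_permutes by blast+
      show ?thesis
        using p sign_idempotent[of \<sigma>] by (simp add: sign_compose permutation_compose sign_inverse algebra_simps)
    qed
    moreover have "tabloid_act \<sigma> (tabloid_act (inv' \<sigma> \<circ> \<pi> \<circ> \<sigma>) (tabloid_of \<alpha> T)) = tabloid_act \<pi> (tabloid_of \<alpha> (\<sigma> \<circ> T))"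
      unfolding tabloid_of_comp tabloid_act_comp[symmetric]
      by (metis (no_types, lifting) comp_assoc id_comp inv\<sigma>\<sigma>(1))
    ultimately show "Poly_Mapping.single (tabloid_act \<sigma> (tabloid_act (inv' \<sigma> \<circ> \<pi> \<circ> \<sigma>) (tabloid_of \<alpha> T)))
        (of_int (sign (inv' \<sigma> \<circ> \<pi> \<circ> \<sigma>))) = Poly_Mapping.single (tabloid_act \<pi> (tabloid_of \<alpha> (\<sigma> \<circ> T))) (of_int (sign \<pi>))"
      by simp
  next
    fix \<pi> assume \<pi>: "\<pi> \<in> column_stabilizer \<alpha> T"
    show "inv' \<sigma> \<circ> (\<sigma> \<circ> \<pi> \<circ> inv' \<sigma>) \<circ> \<sigma> = \<pi>"
      by (metis (no_types, lifting) comp_assoc comp_id id_comp inv\<sigma>\<sigma>(2))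
    show "\<sigma> \<circ> \<pi> \<circ> inv' \<sigma> \<in> column_stabilizer \<alpha> (\<sigma> \<circ> T)" by (rule column_stabilizer_conj[OF \<sigma> \<pi>])
  qed
qed

text \<open>A column permutation that preserves all rows fixes every entry, so the tabloid of
  \<open>T\<close> occurs once, with coefficient 1. Polytabloids are therefore nonzero in every
  characteristic.\<close>

lemma lookup_polytabloid:
  assumes T: "T \<in> tableaux \<alpha>"
  shows "Poly_Mapping.lookup (polytabloid \<alpha> T) (tabloid_of \<alpha> T) = (1::'k::field)"
proof -
  have bij: "bij_betw T (young_diagram \<alpha>) {1..sum_list \<alpha>}" using T by (simp add: tableaux_def)
  have "\<pi> = id" if \<pi>: "\<pi> \<in> column_stabilizer \<alpha> T" and eq: "tabloid_act \<pi> (tabloid_of \<alpha> T) = tabloid_of \<alpha> T" for \<pi>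
  proof
    fix k
    show "\<pi> k = id k"
    proof (cases "k \<in> {1..sum_list \<alpha>}")
      case True
      then obtain i j where d: "(i, j) \<in> young_diagram \<alpha>" "T (i, j) = k"
        using bij_betw_imp_surj_on[OF bij] by (metis imageE surj_pair)
      obtain i' where i': "(i', j) \<in> young_diagram \<alpha>" "\<pi> (T (i, j)) = T (i', j)"
        using \<pi> d by (auto simp: column_stabilizer_def)
      have "T (i, j) \<in> tabloid_of \<alpha> T i" using d by (auto simp: tabloid_of_def)
      then have "\<pi> (T (i, j)) \<in> tabloid_act \<pi> (tabloid_of \<alpha> T) i" by (simp add: tabloid_act_def)
      then have "\<pi> (T (i, j)) \<in> tabloid_of \<alpha> T i" by (simp add: eq)
      then obtain j' where "(i, j') \<in> young_diagram \<alpha>" "T (i', j) = T (i, j')"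
        using i' by (auto simp: tabloid_of_def)
      then have "i' = i" using bij_betw_imp_inj_on[OF bij] i' by (auto dest: inj_onD)
      then show ?thesis using i' d by simp
    next
      case False then show ?thesis
        using permutes_not_in[OF column_stabilizer_permutes[OF \<pi>]] by simp
    qed
  qed
  then have "Poly_Mapping.lookup (polytabloid \<alpha> T) (tabloid_of \<alpha> T) =
    (\<Sum>\<pi>\<in>column_stabilizer \<alpha> T. if \<pi> = id then 1 else (0::'k))"
    unfolding polytabloid_eq column_sum_def lookup_sum
    by (intro sum.cong) (auto simp: lookup_single when_def sign_id)
  then show ?thesis
    using id_column_stabilizer finite_column_stabilizer by (simp add: sum.delta)
qed

lemma tabloid_module_smult:
  "a \<odot>\<^bsub>specht_module \<alpha>\<^esub> x = bilinear_extend (\<lambda>\<sigma> t. Poly_Mapping.single (tabloid_act \<sigma> t) 1) a x"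
  by (simp add: specht_module_def tabloid_module_def tabloid_act_def)

lemma specht_module_simps [simp]:
  "\<zero>\<^bsub>specht_module \<alpha>\<^esub> = 0" "x \<oplus>\<^bsub>specht_module \<alpha>\<^esub> y = x + y"
  by (simp_all add: specht_module_def tabloid_module_def)

lemma specht_act_polytabloid:
  assumes "\<sigma> permutes {1..sum_list \<alpha>}"
  shows "Poly_Mapping.single \<sigma> c \<odot>\<^bsub>specht_module \<alpha>\<^esub> polytabloid \<alpha> T = scale c (polytabloid \<alpha> (\<sigma> \<circ> T))"
  unfolding tabloid_module_smult polytabloid_comp[OF assms] polytabloid_eq[of \<alpha> T] column_sum_def
    bilinear_extend_sum_right scale_sum by simp

lemma specht_carrier: "carrier (specht_module \<alpha>) =
    {\<Sum>T\<in>F. scale (c T) (polytabloid \<alpha> T) | F c. finite F \<and> F \<subseteq> tableaux \<alpha>}"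
  by (simp add: specht_module_def)

lemma specht_polytabloid:
  assumes "T \<in> tableaux \<alpha>" shows "scale c (polytabloid \<alpha> T) \<in> carrier (specht_module \<alpha>)"
  unfolding specht_carrier using assms
  by (intro CollectI exI[of _ "{T}"] exI[of _ "\<lambda>_. c"]) simp

lemma specht_zero: "0 \<in> carrier (specht_module \<alpha>)"
  unfolding specht_carrier by (intro CollectI exI[of _ "{}"]) simp

lemma specht_add:
  assumes "x \<in> carrier (specht_module \<alpha>)" "y \<in> carrier (specht_module \<alpha>)"
  shows "x + y \<in> carrier (specht_module \<alpha>)"
proof -
  obtain F c where x: "x = (\<Sum>T\<in>F. scale (c T) (polytabloid \<alpha> T))" "finite F" "F \<subseteq> tableaux \<alpha>"
    using assms(1) unfolding specht_carrier by auto
  obtain G d where y: "y = (\<Sum>T\<in>G. scale (d T) (polytabloid \<alpha> T))" "finite G" "G \<subseteq> tableaux \<alpha>"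
    using assms(2) unfolding specht_carrier by auto
  let ?c = "\<lambda>T. if T \<in> F then c T else 0" and ?d = "\<lambda>T. if T \<in> G then d T else 0"
  have "x = (\<Sum>T\<in>F \<union> G. scale (?c T) (polytabloid \<alpha> T))"
    unfolding x(1) using x(2) y(2) by (intro sum.mono_neutral_cong_left) auto
  moreover have "y = (\<Sum>T\<in>F \<union> G. scale (?d T) (polytabloid \<alpha> T))"
    unfolding y(1) using x(2) y(2) by (intro sum.mono_neutral_cong_left) auto
  ultimately have "x + y = (\<Sum>T\<in>F \<union> G. scale (?c T + ?d T) (polytabloid \<alpha> T))"
    by (simp add: sum.distrib scale_add_left)
  then show ?thesis unfolding specht_carrier using x y
    by (intro CollectI exI[of _ "F \<union> G"] exI[of _ "\<lambda>T. ?c T + ?d T"]) auto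
qed

lemma specht_induct [consumes 1, case_names zero polytabloid add]:
  assumes "x \<in> carrier (specht_module \<alpha>)"
    and zero: "P 0" and poly: "\<And>T c. T \<in> tableaux \<alpha> \<Longrightarrow> P (scale c (polytabloid \<alpha> T))"
    and add: "\<And>x y. x \<in> carrier (specht_module \<alpha>) \<Longrightarrow> y \<in> carrier (specht_module \<alpha>) \<Longrightarrow> P x \<Longrightarrow> P y \<Longrightarrow> P (x + y)"
  shows "P x"
proof -
  have "(\<Sum>T\<in>F. scale (c T) (polytabloid \<alpha> T)) \<in> carrier (specht_module \<alpha>) \<and> P (\<Sum>T\<in>F. scale (c T) (polytabloid \<alpha> T))"
    if "finite F" "F \<subseteq> tableaux \<alpha>" for F c
    using that
  proof (induction F rule: finite_induct)
    case (insert T F)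
    then show ?case by (auto intro!: add poly specht_add specht_polytabloid)
  qed (auto simp: specht_zero zero)
  then show ?thesis using assms(1) unfolding specht_carrier by auto
qed

lemma specht_scale:
  "x \<in> carrier (specht_module \<alpha>) \<Longrightarrow> scale c x \<in> carrier (specht_module \<alpha>)"
  by (induction x rule: specht_induct) (auto simp: specht_zero scale_add intro: specht_polytabloid specht_add)

lemma specht_act_closed:
  assumes "\<sigma> permutes {1..sum_list \<alpha>}" and "x \<in> carrier (specht_module \<alpha>)"
  shows "Poly_Mapping.single \<sigma> c \<odot>\<^bsub>specht_module \<alpha>\<^esub> x \<in> carrier (specht_module \<alpha>)"
  using assms(2)
proof (induction x rule: specht_induct)
  case (polytabloid T d)
  have "Poly_Mapping.single \<sigma> c \<odot>\<^bsub>specht_module \<alpha>\<^esub> scale d (polytabloid \<alpha> T) =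
      scale d (Poly_Mapping.single \<sigma> c \<odot>\<^bsub>specht_module \<alpha>\<^esub> polytabloid \<alpha> T)"
    unfolding tabloid_module_smult by (rule bilinear_extend_scale_right)
  then show ?case
    using tableaux_comp[OF assms(1) polytabloid] by (simp add: specht_act_polytabloid[OF assms(1)] specht_polytabloid)
qed (auto simp: tabloid_module_smult bilinear_extend_add_right specht_zero specht_add)

lemma specht_act_id: "Poly_Mapping.single id c \<odot>\<^bsub>specht_module \<alpha>\<^esub> x = scale c x"
proof -
  have "x \<in> lin_comb UNIV" by (simp add: lin_comb_def)
  then show ?thesis unfolding tabloid_module_smult
    by (induction x rule: lin_comb_induct) (auto simp: bilinear_extend_add_right scale_add)
qed

lemma pairs_alt: "pairs n = {(x, y). x \<in> {1..n} \<and> y \<in> {1..n} \<and> x < y}"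
  by (auto simp: pairs_def)

text \<open>Conjugation permutes the transpositions, so their sum can be moved past the column stabilizer.\<close>

lemma transpositions_polytabloid:
  "(\<Sum>(x, y)\<in>pairs (sum_list \<alpha>). Poly_Mapping.single (transpose x y) 1) \<odot>\<^bsub>specht_module \<alpha>\<^esub> polytabloid \<alpha> T =
   (\<Sum>(x, y)\<in>pairs (sum_list \<alpha>). column_sum \<alpha> T (tabloid_act (transpose x y) (tabloid_of \<alpha> T)) ::
     tabloid \<Rightarrow>\<^sub>0 'k::field)"
proof -
  let ?n = "sum_list \<alpha>" and ?t = "tabloid_of \<alpha> T"
  have conj: "(\<Sum>(x, y)\<in>pairs ?n. Poly_Mapping.single (tabloid_act (transpose x y) (tabloid_act \<pi> ?t)) c) =
      (\<Sum>(x, y)\<in>pairs ?n. Poly_Mapping.single (tabloid_act \<pi> (tabloid_act (transpose x y) ?t)) c)"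
    if \<pi>: "\<pi> permutes {1..?n}" for \<pi> and c :: 'k
  proof -
    let ?g = "\<lambda>x y. Poly_Mapping.single (tabloid_act (transpose x y) (tabloid_act \<pi> ?t)) c"
    have P: "pairs ?n = {(x, y). x \<in> {1..?n} \<and> y \<in> {1..?n} \<and> x < y \<and> inv' \<pi> x \<noteq> inv' \<pi> y}"
      unfolding pairs_alt using permutes_inj[OF permutes_inv[OF \<pi>]] by (auto simp: inj_eq)
    \<comment> \<open>Ranking the pairs by their preimages under \<open>\<pi>\<close> instead of by
      themselves turns them into the images of \<open>pairs\<close> under
      \<open>\<pi>\<close>.\<close>
    have "(\<Sum>(x, y)\<in>pairs ?n. ?g x y) =
      (\<Sum>(x, y)\<in>{(x, y). x \<in> {1..?n} \<and> y \<in> {1..?n} \<and> inv' \<pi> x < inv' \<pi> y \<and> x \<noteq> y}. ?g x y)"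
      unfolding P by (rule sum_reorient) (auto simp: transpose_commute)
    also have "\<dots> = (\<Sum>(x, y)\<in>pairs ?n. ?g (\<pi> x) (\<pi> y))"
      unfolding pairs_alt
      by (rule sum.reindex_bij_witness[of _ "map_prod \<pi> \<pi>" "map_prod (inv' \<pi>) (inv' \<pi>)"])
        (auto simp: permutes_inverses[OF \<pi>] permutes_in_image[OF \<pi>] inj_eq[OF permutes_inj[OF \<pi>]]
          permutes_in_image[OF permutes_inv[OF \<pi>]] simp del: atLeastAtMost_iff One_nat_def)
    also have "\<dots> = (\<Sum>(x, y)\<in>pairs ?n. Poly_Mapping.single (tabloid_act \<pi> (tabloid_act (transpose x y) ?t)) c)"
    proof -
      have "transpose (\<pi> x) (\<pi> y) \<circ> \<pi> = \<pi> \<circ> transpose x y" for x y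
        using permutes_inj[OF \<pi>] by (auto simp: fun_eq_iff transpose_def inj_eq)
      then show ?thesis unfolding tabloid_act_comp[symmetric] by (simp only:)
    qed
    finally show ?thesis .
  qed
  have "(\<Sum>(x, y)\<in>pairs ?n. Poly_Mapping.single (transpose x y) 1) \<odot>\<^bsub>specht_module \<alpha>\<^esub> polytabloid \<alpha> T =
    (\<Sum>\<pi>\<in>column_stabilizer \<alpha> T. \<Sum>(x, y)\<in>pairs ?n.
      Poly_Mapping.single (tabloid_act (transpose x y) (tabloid_act \<pi> ?t)) (of_int (sign \<pi>) :: 'k))"
    unfolding tabloid_module_smult polytabloid_eq column_sum_def bilinear_extend_sum_right
      bilinear_extend_sum_left by (auto intro!: sum.cong)
  also have "\<dots> = (\<Sum>\<pi>\<in>column_stabilizer \<alpha> T. \<Sum>(x, y)\<in>pairs ?n.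
      Poly_Mapping.single (tabloid_act \<pi> (tabloid_act (transpose x y) ?t)) (of_int (sign \<pi>) :: 'k))"
    by (rule sum.cong[OF refl], rule conj, rule column_stabilizer_permutes)
  also have "\<dots> = (\<Sum>(x, y)\<in>pairs ?n. column_sum \<alpha> T (tabloid_act (transpose x y) ?t))"
    unfolding column_sum_def split_def by (rule sum.swap)
  finally show ?thesis .
qed

section \<open>Contents as eigenvalues of the sum of transpositions\<close>

lemma young_diagram_Sigma: "young_diagram \<alpha> = (SIGMA i:{1..length \<alpha>}. {1..\<alpha> ! (i - 1)})"
  by (auto simp: young_diagram_def)

lemma finite_young_diagram: "finite (young_diagram \<alpha>)"
  by (simp add: young_diagram_Sigma)

lemma card_young_diagram: "card (young_diagram \<alpha>) = sum_list \<alpha>"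
proof -
  have "card (young_diagram \<alpha>) = (\<Sum>i\<in>{1..length \<alpha>}. \<alpha> ! (i - 1))"
    by (simp add: young_diagram_Sigma)
  also have "\<dots> = (\<Sum>i\<in>{0..<length \<alpha>}. \<alpha> ! i)"
    by (rule sum.reindex_bij_witness[of _ Suc "\<lambda>i. i - 1"]) auto
  finally show ?thesis by (simp add: sum_list_sum_nth)
qed

lemma tableau_exists: obtains T where "T \<in> tableaux \<alpha>"
proof -
  have "\<exists>T. bij_betw T (young_diagram \<alpha>) {1..sum_list \<alpha>}"
    by (rule finite_same_card_bij) (simp_all add: finite_young_diagram card_young_diagram)
  then show thesis using that by (auto simp: tableaux_def)
qed

text \<open>A tableau is a function with arbitrary values outside the Young diagram, so finiteness
  is not a matter of counting tableaux. Only the values on the diagram affect the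
  polytabloid.\<close>

lemma finite_polytabloids: "finite (polytabloid \<alpha> ` tableaux \<alpha> :: (tabloid \<Rightarrow>\<^sub>0 'k::field) set)"
proof -
  let ?Y = "young_diagram \<alpha>"
  have restrict: "polytabloid \<alpha> (restrict T ?Y) = (polytabloid \<alpha> T :: tabloid \<Rightarrow>\<^sub>0 'k)" for T
  proof -
    have "column_stabilizer \<alpha> (restrict T ?Y) = column_stabilizer \<alpha> T"
      by (fastforce simp: column_stabilizer_def)
    moreover have "tabloid_of \<alpha> (restrict T ?Y) = tabloid_of \<alpha> T"
      by (force simp: tabloid_of_def fun_eq_iff)
    ultimately show ?thesis by (simp add: polytabloid_eq column_sum_def)
  qed
  have "polytabloid \<alpha> ` tableaux \<alpha> \<subseteq> (polytabloid \<alpha> ` (?Y \<rightarrow>\<^sub>E {1..sum_list \<alpha>}) :: (tabloid \<Rightarrow>\<^sub>0 'k) set)"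
  proof
    fix x :: "tabloid \<Rightarrow>\<^sub>0 'k" assume "x \<in> polytabloid \<alpha> ` tableaux \<alpha>"
    then obtain T where T: "bij_betw T ?Y {1..sum_list \<alpha>}" "x = polytabloid \<alpha> T"
      by (auto simp: tableaux_def)
    then have "restrict T ?Y \<in> ?Y \<rightarrow>\<^sub>E {1..sum_list \<alpha>}" using bij_betwE[OF T(1)] by auto
    then have "polytabloid \<alpha> (restrict T ?Y) \<in> (polytabloid \<alpha> ` (?Y \<rightarrow>\<^sub>E {1..sum_list \<alpha>}) :: (tabloid \<Rightarrow>\<^sub>0 'k) set)"
      by (rule imageI)
    then show "x \<in> polytabloid \<alpha> ` (?Y \<rightarrow>\<^sub>E {1..sum_list \<alpha>})" unfolding restrict T(2) .
  qed
  then show ?thesis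
    by (rule finite_subset) (intro finite_imageI finite_PiE finite_young_diagram, simp)
qed

lemma young_diagram_row: "(i, j) \<in> young_diagram \<alpha> \<Longrightarrow> 1 \<le> j' \<Longrightarrow> j' \<le> j \<Longrightarrow> (i, j') \<in> young_diagram \<alpha>"
  by (auto simp: young_diagram_def)

context
  fixes \<alpha> n assumes \<alpha>: "is_partition \<alpha> n"
begin

lemma sum_list_partition: "sum_list \<alpha> = n"
  using \<alpha> by (simp add: is_partition_def)

lemma young_diagram_column:
  assumes "(i, j) \<in> young_diagram \<alpha>" "1 \<le> i'" "i' \<le> i" shows "(i', j) \<in> young_diagram \<alpha>"
proof (cases "i' = i")
  case False
  have "\<alpha> ! (i' - 1) \<ge> \<alpha> ! (i - 1)"
    using \<alpha> sorted_wrt_nth_less[of "(\<ge>)" \<alpha> "i' - 1" "i - 1"] assms False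
    by (auto simp: is_partition_def young_diagram_def)
  then show ?thesis using assms by (auto simp: young_diagram_def)
qed (use assms in simp)

text \<open>In one row the transposition fixes the tabloid, and in one column it is an odd element
  of the column stabilizer. In any other position it brings two entries of one column of
  \<open>T\<close> into one row, and the signed column sum vanishes.\<close>

lemma column_sum_transposition:
  assumes T: "T \<in> tableaux \<alpha>" and d: "(i, j) \<in> young_diagram \<alpha>" "(i', j') \<in> young_diagram \<alpha>" "(i, j) \<noteq> (i', j')"
  shows "column_sum \<alpha> T (tabloid_act (transpose (T (i, j)) (T (i', j'))) (tabloid_of \<alpha> T)) =
    scale (if i = i' then 1 else if j = j' then - 1 else 0) (polytabloid \<alpha> T :: tabloid \<Rightarrow>\<^sub>0 'k::field)"
proof -
  have inj: "inj_on T (young_diagram \<alpha>)" using T by (auto simp: tableaux_def dest: bij_betw_imp_inj_on)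
  have zero: "column_sum \<alpha> T (tabloid_act (transpose (T (i, j)) (T (i', j'))) (tabloid_of \<alpha> T)) = (0 :: tabloid \<Rightarrow>\<^sub>0 'k)"
    if d: "(i, j) \<in> young_diagram \<alpha>" "(i', j') \<in> young_diagram \<alpha>" and lt: "i < i'" "j \<noteq> j'" for i j i' j'
  proof -
    \<comment> \<open>Exchanging \<open>?x\<close> and \<open>?y\<close> moves \<open>?y\<close> into the row of \<open>?u\<close>, and \<open>?u\<close>, \<open>?y\<close> share a column of \<open>T\<close>.\<close>
    let ?x = "T (i, j)" and ?y = "T (i', j')" and ?u = "T (i, j')"
    have u: "(i, j') \<in> young_diagram \<alpha>"
      using young_diagram_column[OF d(2), of i] d(1) lt by (auto simp: young_diagram_def)
    have ne: "?x \<noteq> ?y" "?u \<noteq> ?y" "?u \<noteq> ?x" using inj_on_eq_iff[OF inj] d u lt by auto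
    let ?T = "transpose ?x ?y \<circ> T"
    have "inj_on ?T (young_diagram \<alpha>)"
      by (rule comp_inj_on[OF inj]) simp
    from tabloid_act_transpose_same_row[OF this u d(1)]
    have "tabloid_act (transpose ?u ?y) (tabloid_act (transpose ?x ?y) (tabloid_of \<alpha> T)) =
        tabloid_act (transpose ?x ?y) (tabloid_of \<alpha> T)"
      using ne by (simp add: tabloid_of_comp transpose_apply_other)
    then show ?thesis
      by (rule column_sum_eq_0[OF transpose_column_stabilizer[OF T u d(2)] ne(2)])
  qed
  consider "i = i'" | "i \<noteq> i'" "j = j'" | "i < i'" "j \<noteq> j'" | "i' < i" "j' \<noteq> j" by force
  then show ?thesis
  proof cases
    case 1
    then show ?thesis using tabloid_act_transpose_same_row[OF inj, of i j j'] d by (simp add: polytabloid_eq)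
  next
    case 2
    have "T (i, j) \<noteq> T (i', j)" using inj_on_eq_iff[OF inj] d 2 by auto
    then show ?thesis
      using column_sum_transpose[OF transpose_column_stabilizer[OF T, of i j i']] d 2
      by (simp add: polytabloid_eq scale_minus_left)
  next
    case 3
    then show ?thesis using zero[OF d(1,2)] by simp
  next
    case 4
    then show ?thesis using zero[OF d(2,1)] by (simp add: transpose_commute)
  qed
qed

text \<open>For a fixed later box \<open>(i', j')\<close>, the earlier boxes in its row are the
  \<open>j' - 1\<close> boxes to the left and the earlier ones in its column are the
  \<open>i' - 1\<close> boxes above, so the signed count is the content. On these boxes
  \<open>key\<close> is the row by row reading order.\<close>

lemma sum_contents:
  defines "key \<equiv> \<lambda>(i, j). i * Suc n + j"
  shows "(\<Sum>(d, d')\<in>{(d, d'). d \<in> young_diagram \<alpha> \<and> d' \<in> young_diagram \<alpha> \<and> key d < key d'}.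
      if fst d = fst d' then 1 else if snd d = snd d' then - 1 else 0) =
    (\<Sum>d\<in>young_diagram \<alpha>. of_int (box_content d) :: 'k::field)"
proof -
  let ?Y = "young_diagram \<alpha>"
  let ?c = "\<lambda>d d'. if fst d = fst d' then 1 else if snd d = snd d' then - 1 else (0::'k)"
  have "(\<Sum>(d, d')\<in>{(d, d'). d \<in> ?Y \<and> d' \<in> ?Y \<and> key d < key d'}. ?c d d') =
    (\<Sum>(d, d')\<in>?Y \<times> ?Y. if key d < key d' then ?c d d' else 0)"
    by (rule sum.mono_neutral_cong_left) (auto simp: finite_young_diagram split: if_splits)
  also have "\<dots> = (\<Sum>d\<in>?Y. \<Sum>d'\<in>?Y. if key d < key d' then ?c d d' else 0)"
    by (rule sum.cartesian_product[symmetric])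
  also have "\<dots> = (\<Sum>d'\<in>?Y. \<Sum>d\<in>?Y. if key d < key d' then ?c d d' else 0)"
    by (rule sum.swap)
  also have "\<dots> = (\<Sum>d'\<in>?Y. of_int (box_content d'))"
  proof (rule sum.cong[OF refl])
    fix d' assume d': "d' \<in> ?Y"
    obtain i' j' where ij: "d' = (i', j')" by (cases d')
    have pos: "1 \<le> i'" "1 \<le> j'" using d' by (auto simp: ij young_diagram_def)
    let ?R = "Pair i' ` {1..<j'}" and ?C = "(\<lambda>i. (i, j')) ` {1..<i'}"
    have sub: "?R \<union> ?C \<subseteq> ?Y"
    proof
      fix d assume "d \<in> ?R \<union> ?C"
      then consider j where "d = (i', j)" "1 \<le> j" "j < j'" | i where "d = (i, j')" "1 \<le> i" "i < i'" by auto
      then show "d \<in> ?Y"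
      proof cases
        case 1 then show ?thesis using young_diagram_row[OF d'[unfolded ij], of j] by simp
      next
        case 2 then show ?thesis using young_diagram_column[OF d'[unfolded ij], of i] by simp
      qed
    qed
    have keyR: "key (i', j) < key (i', j') \<longleftrightarrow> j < j'" for j by (simp add: key_def)
    have keyC: "key (i, j') < key (i', j') \<longleftrightarrow> i < i'" for i
      unfolding key_def split by (simp only: add_less_cancel_right mult_less_cancel2) simp
    have zero: "(if key d < key d' then ?c d d' else 0) = 0" if d: "d \<in> ?Y - (?R \<union> ?C)" for d
    proof -
      obtain i j where d_eq: "d = (i, j)" by (cases d)
      have "1 \<le> i" "1 \<le> j" using d by (auto simp: d_eq young_diagram_def)
      moreover have "(i, j) \<notin> ?R" "(i, j) \<notin> ?C" using d unfolding d_eq by blast+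
      ultimately have "\<not> (i = i' \<and> j < j')" "\<not> (j = j' \<and> i < i')" by auto
      then show ?thesis using keyR[of j] keyC[of i] unfolding d_eq ij by auto
    qed
    have "(\<Sum>d\<in>?Y. if key d < key d' then ?c d d' else 0) = (\<Sum>d\<in>?R \<union> ?C. if key d < key d' then ?c d d' else 0)"
      by (rule sum.mono_neutral_right[OF finite_young_diagram sub]) (rule ballI, rule zero)
    also have "\<dots> = (\<Sum>d\<in>?R. if key d < key d' then ?c d d' else 0) + (\<Sum>d\<in>?C. if key d < key d' then ?c d d' else 0)"
      by (rule sum.union_disjoint) auto
    also have "(\<Sum>d\<in>?R. if key d < key d' then ?c d d' else 0) = (\<Sum>d\<in>?R. 1)"
      by (rule sum.cong) (auto simp: keyR ij)
    also have "\<dots> = of_nat (j' - 1)" by (simp add: card_image inj_on_def)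
    also have "(\<Sum>d\<in>?C. if key d < key d' then ?c d d' else 0) = (\<Sum>d\<in>?C. - 1)"
      by (rule sum.cong) (auto simp: keyC ij)
    also have "\<dots> = - of_nat (i' - 1)" by (simp add: card_image inj_on_def)
    also have "of_nat (j' - 1) + - of_nat (i' - 1) = (of_int (box_content d') :: 'k)"
      using pos by (simp add: box_content_def ij of_nat_diff)
    finally show "(\<Sum>d\<in>?Y. if key d < key d' then ?c d d' else 0) = of_int (box_content d')" .
  qed
  finally show ?thesis .
qed

text \<open>Transpositions are indexed by pairs of entries. Rewritten as pairs of boxes in reading
  order, each term is a known multiple of the polytabloid, and the coefficients add up to the
  contents.\<close>

lemma transpositions_polytabloid_content:
  assumes T: "T \<in> tableaux \<alpha>"
  shows "(\<Sum>(x, y)\<in>pairs n. Poly_Mapping.single (transpose x y) 1) \<odot>\<^bsub>specht_module \<alpha>\<^esub> polytabloid \<alpha> T =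
    scale (\<Sum>d\<in>young_diagram \<alpha>. of_int (box_content d)) (polytabloid \<alpha> T :: tabloid \<Rightarrow>\<^sub>0 'k::field)"
proof -
  let ?Y = "young_diagram \<alpha>" and ?e = "polytabloid \<alpha> T :: tabloid \<Rightarrow>\<^sub>0 'k"
  define key where "key = (\<lambda>(i, j). i * Suc n + j)"
  let ?g = "\<lambda>x y. column_sum \<alpha> T (tabloid_act (transpose x y) (tabloid_of \<alpha> T)) :: tabloid \<Rightarrow>\<^sub>0 'k"
  have bij: "bij_betw T ?Y {1..n}" using T by (simp add: tableaux_def sum_list_partition)
  have inj: "T d = T d' \<longleftrightarrow> d = d'" if "d \<in> ?Y" "d' \<in> ?Y" for d d'
    using inj_on_eq_iff[OF bij_betw_imp_inj_on[OF bij]] that by auto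
  \<comment> \<open>Column indices are at most \<open>n\<close>, so row and column are the quotient
    and the remainder of \<open>key\<close> by \<open>Suc n\<close>.\<close>
  have key_inj: "key d = key d' \<longleftrightarrow> d = d'" if "d \<in> ?Y" "d' \<in> ?Y" for d d'
  proof
    have le: "j \<le> n" if "(i, j) \<in> ?Y" for i j
    proof -
      have "\<alpha> ! (i - 1) \<in> set \<alpha>" using that by (auto simp: young_diagram_def)
      then have "\<alpha> ! (i - 1) \<le> sum_list \<alpha>" by (simp add: member_le_sum_list)
      then show ?thesis using that by (auto simp: young_diagram_def sum_list_partition)
    qed
    assume eq: "key d = key d'"
    obtain i j i' j' where ij: "d = (i, j)" "d' = (i', j')" by (cases d; cases d')
    have j: "j < Suc n" "j' < Suc n" using that le unfolding ij by (auto intro: le_imp_less_Suc)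
    have "(i * Suc n + j) div Suc n = i" "(i' * Suc n + j') div Suc n = i'"
      "(i * Suc n + j) mod Suc n = j" "(i' * Suc n + j') mod Suc n = j'"
      using j by (simp_all only: div_mult_self3 mod_mult_self3 div_less mod_less)
    then show "d = d'" using eq unfolding key_def ij split by metis
  qed simp
  have "(\<Sum>(x, y)\<in>pairs n. ?g x y) =
    (\<Sum>(d, d')\<in>{(d, d'). d \<in> ?Y \<and> d' \<in> ?Y \<and> T d < T d' \<and> key d \<noteq> key d'}. ?g (T d) (T d'))"
  proof -
    have "pairs n = map_prod T T ` {(d, d'). d \<in> ?Y \<and> d' \<in> ?Y \<and> T d < T d' \<and> key d \<noteq> key d'}"
    proof (intro equalityI subsetI)
      fix p assume "p \<in> pairs n"
      then obtain x y where p: "p = (x, y)" "x \<in> {1..n}" "y \<in> {1..n}" "x < y" by (auto simp: pairs_alt)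
      then obtain d d' where dd: "d \<in> ?Y" "x = T d" "d' \<in> ?Y" "y = T d'"
        using bij_betw_imp_surj_on[OF bij] by blast
      then have "key d \<noteq> key d'" using p(4) key_inj by auto
      then show "p \<in> map_prod T T ` {(d, d'). d \<in> ?Y \<and> d' \<in> ?Y \<and> T d < T d' \<and> key d \<noteq> key d'}"
        using dd p by (intro image_eqI[of _ _ "(d, d')"]) auto
    next
      fix p assume "p \<in> map_prod T T ` {(d, d'). d \<in> ?Y \<and> d' \<in> ?Y \<and> T d < T d' \<and> key d \<noteq> key d'}"
      then show "p \<in> pairs n" using bij_betwE[OF bij] by (auto simp: pairs_alt)
    qed
    moreover have "inj_on (map_prod T T) {(d, d'). d \<in> ?Y \<and> d' \<in> ?Y \<and> T d < T d' \<and> key d \<noteq> key d'}"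
      by (auto simp: inj_on_def inj)
    ultimately show ?thesis by (simp add: sum.reindex split_def)
  qed
  also have "\<dots> = (\<Sum>(d, d')\<in>{(d, d'). d \<in> ?Y \<and> d' \<in> ?Y \<and> key d < key d' \<and> T d \<noteq> T d'}. ?g (T d) (T d'))"
    by (rule sum_reorient) (auto simp: finite_young_diagram transpose_commute)
  also have "\<dots> = (\<Sum>(d, d')\<in>{(d, d'). d \<in> ?Y \<and> d' \<in> ?Y \<and> key d < key d'}.
      scale (if fst d = fst d' then 1 else if snd d = snd d' then - 1 else 0) ?e)"
  proof (rule sum.cong)
    show "{(d, d'). d \<in> ?Y \<and> d' \<in> ?Y \<and> key d < key d' \<and> T d \<noteq> T d'} = {(d, d'). d \<in> ?Y \<and> d' \<in> ?Y \<and> key d < key d'}"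
      by (auto simp: inj)
    fix p assume "p \<in> {(d, d'). d \<in> ?Y \<and> d' \<in> ?Y \<and> key d < key d'}"
    then obtain i j i' j' where p: "p = ((i, j), (i', j'))" "(i, j) \<in> ?Y" "(i', j') \<in> ?Y" "(i, j) \<noteq> (i', j')" by auto
    show "(case p of (d, d') \<Rightarrow> ?g (T d) (T d')) =
        (case p of (d, d') \<Rightarrow> scale (if fst d = fst d' then 1 else if snd d = snd d' then - 1 else 0) ?e)"
      unfolding p(1) split fst_conv snd_conv by (rule column_sum_transposition[OF T p(2,3,4)])
  qed
  also have "\<dots> = scale (\<Sum>d\<in>?Y. of_int (box_content d)) ?e"
    unfolding sum_contents[symmetric, folded key_def] scale_sum_left by (simp add: split_def)
  finally show ?thesis
    using transpositions_polytabloid[of \<alpha> T, where 'k='k] by (simp add: sum_list_partition)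
qed

lemma transpositions_specht:
  fixes x :: "tabloid \<Rightarrow>\<^sub>0 'k::field"
  assumes "x \<in> carrier (specht_module \<alpha>)"
  shows "(\<Sum>(i, j)\<in>pairs n. Poly_Mapping.single (transpose i j) 1) \<odot>\<^bsub>specht_module \<alpha>\<^esub> x =
    scale (\<Sum>d\<in>young_diagram \<alpha>. of_int (box_content d)) x"
  using assms
proof (induction x rule: specht_induct)
  case (polytabloid T c)
  show ?case
    using transpositions_polytabloid_content[OF polytabloid, where 'k='k]
    unfolding tabloid_module_smult bilinear_extend_scale_right by (simp add: mult.commute)
qed (auto simp: tabloid_module_smult bilinear_extend_add_right scale_add)

end

section \<open>Tensor products\<close>

text \<open>Closure under the operations places the relations inside the free group; biadditivity
  and balance are then supplied by the relations themselves.\<close>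

locale tensor_factors =
  fixes A :: "'a ring" and M :: "('a, 'm) module" and N :: "('a, 'n) module"
  assumes left_add_closed: "m \<in> carrier M \<Longrightarrow> m' \<in> carrier M \<Longrightarrow> m \<oplus>\<^bsub>M\<^esub> m' \<in> carrier M"
    and left_smult_closed: "a \<in> carrier A \<Longrightarrow> m \<in> carrier M \<Longrightarrow> a \<odot>\<^bsub>M\<^esub> m \<in> carrier M"
    and right_add_closed: "n \<in> carrier N \<Longrightarrow> n' \<in> carrier N \<Longrightarrow> n \<oplus>\<^bsub>N\<^esub> n' \<in> carrier N"
    and right_smult_closed: "a \<in> carrier A \<Longrightarrow> n \<in> carrier N \<Longrightarrow> a \<odot>\<^bsub>N\<^esub> n \<in> carrier N"
begin

definition frags :: "('m \<times> 'n \<Rightarrow>\<^sub>0 int) set" where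
  "frags = {c. Poly_Mapping.keys c \<subseteq> carrier M \<times> carrier N}"

definition tkernel :: "('m \<times> 'n \<Rightarrow>\<^sub>0 int) set" where
  "tkernel = generate (free_Abelian_group (carrier M \<times> carrier N)) (tensor_relations A M N)"

definition tclass :: "('m \<times> 'n \<Rightarrow>\<^sub>0 int) \<Rightarrow> ('m \<times> 'n \<Rightarrow>\<^sub>0 int) set" where
  "tclass c = (\<lambda>\<rho>. \<rho> + c) ` tkernel"

definition pure :: "'m \<Rightarrow> 'n \<Rightarrow> ('m \<times> 'n \<Rightarrow>\<^sub>0 int) set" where
  "pure m n = tclass (frag_of (m, n))"

lemma frags_add [simp, intro]: "c \<in> frags \<Longrightarrow> d \<in> frags \<Longrightarrow> c + d \<in> frags"
  using Poly_Mapping.keys_add[of c d] by (auto simp: frags_def)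

lemma frags_uminus [simp, intro]: "c \<in> frags \<Longrightarrow> - c \<in> frags"
  by (simp add: frags_def in_keys_iff subset_iff)

lemma frags_diff [simp, intro]: "c \<in> frags \<Longrightarrow> d \<in> frags \<Longrightarrow> c - d \<in> frags"
  using frags_add[of c "- d"] by simp

lemma frags_0 [simp, intro]: "0 \<in> frags"
  by (simp add: frags_def)

lemma frags_of [simp]: "frag_of (m, n) \<in> frags \<longleftrightarrow> m \<in> carrier M \<and> n \<in> carrier N"
  by (simp add: frags_def)

lemma frags_sum: "(\<And>i. i \<in> I \<Longrightarrow> f i \<in> frags) \<Longrightarrow> sum f I \<in> frags"
  by (induction I rule: infinite_finite_induct) auto

lemma frags_induct [consumes 1, case_names zero of diff]:
  assumes "c \<in> frags" and "P 0"
    and "\<And>m n. m \<in> carrier M \<Longrightarrow> n \<in> carrier N \<Longrightarrow> P (frag_of (m, n))"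
    and "\<And>c d. c \<in> frags \<Longrightarrow> d \<in> frags \<Longrightarrow> P c \<Longrightarrow> P d \<Longrightarrow> P (c - d)"
  shows "P c"
proof -
  have "Poly_Mapping.keys c \<subseteq> carrier M \<times> carrier N" using assms(1) by (simp add: frags_def)
  then show ?thesis
  proof (rule free_Abelian_group_induct)
    show "P (x - y)" if "Poly_Mapping.keys x \<subseteq> carrier M \<times> carrier N"
        "Poly_Mapping.keys y \<subseteq> carrier M \<times> carrier N" "P x" "P y" for x y
      using assms(4)[of x y] that by (simp add: frags_def)
  qed (use assms(2,3) in auto)
qed

lemma frags_induct_add [consumes 1, case_names zero of neg add]:
  assumes "c \<in> frags" and "P 0"
    and "\<And>m n. m \<in> carrier M \<Longrightarrow> n \<in> carrier N \<Longrightarrow> P (frag_of (m, n))"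
    and neg: "\<And>c. c \<in> frags \<Longrightarrow> P c \<Longrightarrow> P (- c)"
    and add: "\<And>c d. c \<in> frags \<Longrightarrow> d \<in> frags \<Longrightarrow> P c \<Longrightarrow> P d \<Longrightarrow> P (c + d)"
  shows "P c"
  using assms(1)
proof (induction rule: frags_induct)
  case (diff c d)
  then show ?case using add[of c "- d"] neg[of d] by simp
qed (use assms in auto)

lemma relations_subset: "tensor_relations A M N \<subseteq> frags"
  by (auto simp: tensor_relations_def left_add_closed left_smult_closed right_add_closed right_smult_closed)

lemma free_group: "group (free_Abelian_group (carrier M \<times> carrier N))"
  by (rule group_free_Abelian_group)

lemma carrier_free: "carrier (free_Abelian_group (carrier M \<times> carrier N)) = frags"
  by (simp add: frags_def free_Abelian_group_def)

lemma kernel_subgroup: "subgroup tkernel (free_Abelian_group (carrier M \<times> carrier N))"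
  unfolding tkernel_def
  by (rule group.generate_is_subgroup[OF free_group]) (simp add: carrier_free relations_subset)

lemma kernel_frags: "c \<in> tkernel \<Longrightarrow> c \<in> frags"
  using subgroup.subset[OF kernel_subgroup] by (auto simp: carrier_free)

lemma kernel_0: "0 \<in> tkernel"
  using subgroup.one_closed[OF kernel_subgroup] by simp

lemma kernel_add: "c \<in> tkernel \<Longrightarrow> d \<in> tkernel \<Longrightarrow> c + d \<in> tkernel"
  using subgroup.m_closed[OF kernel_subgroup, of c d] by simp

lemma kernel_uminus: "c \<in> tkernel \<Longrightarrow> - c \<in> tkernel"
  using subgroup.m_inv_closed[OF kernel_subgroup, of c] kernel_frags[of c] by (simp add: frags_def)

lemma kernel_diff: "c \<in> tkernel \<Longrightarrow> d \<in> tkernel \<Longrightarrow> c - d \<in> tkernel"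
  using kernel_add[of c "- d"] kernel_uminus[of d] by simp

lemma kernel_sum: "(\<And>i. i \<in> I \<Longrightarrow> f i \<in> tkernel) \<Longrightarrow> sum f I \<in> tkernel"
  by (induction I rule: infinite_finite_induct) (auto simp: kernel_0 kernel_add)

lemma relation_in_kernel: "c \<in> tensor_relations A M N \<Longrightarrow> c \<in> tkernel"
  unfolding tkernel_def by (rule generate.incl)

lemma kernel_left_add: "m \<in> carrier M \<Longrightarrow> m' \<in> carrier M \<Longrightarrow> n \<in> carrier N \<Longrightarrow>
    frag_of (m \<oplus>\<^bsub>M\<^esub> m', n) - frag_of (m, n) - frag_of (m', n) \<in> tkernel"
  by (rule relation_in_kernel) (auto simp: tensor_relations_def)

lemma kernel_right_add: "m \<in> carrier M \<Longrightarrow> n \<in> carrier N \<Longrightarrow> n' \<in> carrier N \<Longrightarrow>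
    frag_of (m, n \<oplus>\<^bsub>N\<^esub> n') - frag_of (m, n) - frag_of (m, n') \<in> tkernel"
  by (rule relation_in_kernel) (auto simp: tensor_relations_def)

lemma kernel_balanced: "a \<in> carrier A \<Longrightarrow> m \<in> carrier M \<Longrightarrow> n \<in> carrier N \<Longrightarrow>
    frag_of (a \<odot>\<^bsub>M\<^esub> m, n) - frag_of (m, a \<odot>\<^bsub>N\<^esub> n) \<in> tkernel"
  by (rule relation_in_kernel) (auto simp: tensor_relations_def)

text \<open>The kernel is reached from the relations by negation and addition, so an additive
  statement has to be checked on the three kinds of relation only.\<close>

lemma kernel_induct [consumes 1, case_names zero neg add left right balanced]:
  assumes c: "c \<in> tkernel"
    and zero: "P 0" and neg: "\<And>c. c \<in> frags \<Longrightarrow> P c \<Longrightarrow> P (- c)"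
    and add: "\<And>c d. c \<in> frags \<Longrightarrow> d \<in> frags \<Longrightarrow> P c \<Longrightarrow> P d \<Longrightarrow> P (c + d)"
    and left: "\<And>m m' n. m \<in> carrier M \<Longrightarrow> m' \<in> carrier M \<Longrightarrow> n \<in> carrier N \<Longrightarrow>
      P (frag_of (m \<oplus>\<^bsub>M\<^esub> m', n) - frag_of (m, n) - frag_of (m', n))"
    and right: "\<And>m n n'. m \<in> carrier M \<Longrightarrow> n \<in> carrier N \<Longrightarrow> n' \<in> carrier N \<Longrightarrow>
      P (frag_of (m, n \<oplus>\<^bsub>N\<^esub> n') - frag_of (m, n) - frag_of (m, n'))"
    and balanced: "\<And>a m n. a \<in> carrier A \<Longrightarrow> m \<in> carrier M \<Longrightarrow> n \<in> carrier N \<Longrightarrow>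
      P (frag_of (a \<odot>\<^bsub>M\<^esub> m, n) - frag_of (m, a \<odot>\<^bsub>N\<^esub> n))"
  shows "P c"
proof -
  have rel: "P d" if "d \<in> tensor_relations A M N" for d
    using that left right balanced by (auto simp: tensor_relations_def)
  have "c \<in> frags \<and> P c"
    using c unfolding tkernel_def
  proof (induction c rule: generate.induct)
    case one then show ?case by (simp add: zero)
  next
    case (incl h) then show ?case using relations_subset rel by blast
  next
    case (inv h)
    then have "h \<in> frags" "P h" using relations_subset rel by blast+
    then show ?case using neg[of h] by (simp add: frags_def)
  next
    case (eng h1 h2) then show ?case using add by simp
  qed
  then show ?thesis by simp
qed

lemma tclass_eq_iff: "tclass c = tclass d \<longleftrightarrow> c - d \<in> tkernel"
proof
  assume "tclass c = tclass d"
  moreover have "c \<in> tclass c" using kernel_0 by (force simp: tclass_def)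
  ultimately obtain \<rho> where "\<rho> \<in> tkernel" "c = \<rho> + d" by (auto simp: tclass_def)
  then show "c - d \<in> tkernel" by simp
next
  have sub: "tclass c \<subseteq> tclass d" if "c - d \<in> tkernel" for c d
  proof
    fix x assume "x \<in> tclass c"
    then obtain \<rho> where "\<rho> \<in> tkernel" "x = \<rho> + c" by (auto simp: tclass_def)
    then have "x = (\<rho> + (c - d)) + d" "\<rho> + (c - d) \<in> tkernel"
      using kernel_add[OF _ that] by auto
    then show "x \<in> tclass d" unfolding tclass_def by blast
  qed
  assume "c - d \<in> tkernel"
  then show "tclass c = tclass d" using sub[of c d] sub[of d c] kernel_uminus[of "c - d"] by auto
qed

lemma tclass_add_cong: "tclass c = tclass c' \<Longrightarrow> tclass d = tclass d' \<Longrightarrow> tclass (c + d) = tclass (c' + d')"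
  unfolding tclass_eq_iff using kernel_add[of "c - c'" "d - d'"] by (simp add: algebra_simps)

lemma tclass_diff_cong: "tclass c = tclass c' \<Longrightarrow> tclass d = tclass d' \<Longrightarrow> tclass (c - d) = tclass (c' - d')"
  unfolding tclass_eq_iff using kernel_diff[of "c - c'" "d - d'"] by (simp add: algebra_simps)

context
  fixes act :: "'b \<Rightarrow> 'm \<times> 'n \<Rightarrow> ('m \<times> 'n \<Rightarrow>\<^sub>0 int)"
begin

abbreviation "T \<equiv> tensor_product A M N act"

lemma carrier_tensor: "carrier T = tclass ` frags"
  by (auto simp: tensor_product_def quot_module_def Let_def A_RCOSETS_def RCOSETS_def r_coset_def
      tclass_def tkernel_def[symmetric] carrier_free)

lemma zero_tensor: "\<zero>\<^bsub>T\<^esub> = tclass 0"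
  by (simp add: tensor_product_def quot_module_def Let_def tclass_def tkernel_def)

lemma set_add_tclass:
  assumes "add P = (+)"
  shows "tclass c <+>\<^bsub>P\<^esub> tclass d = tclass (c + d)"
proof -
  have "tclass c <+>\<^bsub>P\<^esub> tclass d = {x + y | x y. x \<in> tclass c \<and> y \<in> tclass d}"
    by (auto simp: set_add_def set_mult_def assms)
  also have "\<dots> = tclass (c + d)"
  proof (intro equalityI subsetI)
    fix z assume "z \<in> {x + y | x y. x \<in> tclass c \<and> y \<in> tclass d}"
    then obtain \<rho> \<sigma> where "\<rho> \<in> tkernel" "\<sigma> \<in> tkernel" "z = (\<rho> + c) + (\<sigma> + d)" by (auto simp: tclass_def)
    then have "z = (\<rho> + \<sigma>) + (c + d)" "\<rho> + \<sigma> \<in> tkernel" by (auto simp: algebra_simps kernel_add)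
    then show "z \<in> tclass (c + d)" unfolding tclass_def by blast
  next
    fix z assume "z \<in> tclass (c + d)"
    then obtain \<rho> where "\<rho> \<in> tkernel" "z = (\<rho> + c) + (0 + d)" by (auto simp: tclass_def algebra_simps)
    then show "z \<in> {x + y | x y. x \<in> tclass c \<and> y \<in> tclass d}" using kernel_0 unfolding tclass_def by blast
  qed
  finally show ?thesis .
qed

lemma add_tensor: "tclass c \<oplus>\<^bsub>T\<^esub> tclass d = tclass (c + d)"
  by (simp add: tensor_product_def quot_module_def Let_def set_add_tclass)

text \<open>The action on the quotient is defined on cosets as sets. It can be computed on
  representatives as soon as it preserves the kernel.\<close>

lemma smult_tensor:
  assumes "\<And>\<rho>. \<rho> \<in> tkernel \<Longrightarrow> frag_extend (act b) \<rho> \<in> tkernel"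
  shows "b \<odot>\<^bsub>T\<^esub> tclass c = tclass (frag_extend (act b) c)"
proof -
  let ?f = "frag_extend (act b)"
  have "b \<odot>\<^bsub>T\<^esub> tclass c = {x + y | x y. x \<in> tkernel \<and> y \<in> ?f ` tclass c}"
    by (auto simp: tensor_product_def quot_module_def Let_def set_add_def set_mult_def tkernel_def)
  also have "\<dots> = tclass (?f c)"
  proof (intro equalityI subsetI)
    fix z assume "z \<in> {x + y | x y. x \<in> tkernel \<and> y \<in> ?f ` tclass c}"
    then obtain \<rho> \<sigma> where "\<rho> \<in> tkernel" "\<sigma> \<in> tkernel" "z = \<rho> + ?f (\<sigma> + c)" by (auto simp: tclass_def)
    then have "z = (\<rho> + ?f \<sigma>) + ?f c" "\<rho> + ?f \<sigma> \<in> tkernel"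
      using assms by (auto simp: frag_extend_add algebra_simps kernel_add)
    then show "z \<in> tclass (?f c)" unfolding tclass_def by blast
  next
    fix z assume "z \<in> tclass (?f c)"
    then obtain \<rho> where "\<rho> \<in> tkernel" "z = \<rho> + ?f (0 + c)" by (auto simp: tclass_def)
    then show "z \<in> {x + y | x y. x \<in> tkernel \<and> y \<in> ?f ` tclass c}" using kernel_0 unfolding tclass_def by blast
  qed
  finally show ?thesis .
qed

lemma abelian_group_tensor: "abelian_group T"
proof (rule abelian_groupI)
  fix x y z assume "x \<in> carrier T" "y \<in> carrier T" "z \<in> carrier T"
  then obtain a b c where abc: "x = tclass a" "y = tclass b" "z = tclass c" "a \<in> frags" "b \<in> frags" "c \<in> frags"
    by (auto simp: carrier_tensor)
  then show "x \<oplus>\<^bsub>T\<^esub> y \<in> carrier T" by (auto simp: carrier_tensor add_tensor)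
  show "x \<oplus>\<^bsub>T\<^esub> y \<oplus>\<^bsub>T\<^esub> z = x \<oplus>\<^bsub>T\<^esub> (y \<oplus>\<^bsub>T\<^esub> z)" by (simp add: abc add_tensor add.assoc)
  show "x \<oplus>\<^bsub>T\<^esub> y = y \<oplus>\<^bsub>T\<^esub> x" by (simp add: abc add_tensor add.commute)
  show "\<zero>\<^bsub>T\<^esub> \<oplus>\<^bsub>T\<^esub> x = x" by (simp add: abc add_tensor zero_tensor)
  show "\<exists>w\<in>carrier T. w \<oplus>\<^bsub>T\<^esub> x = \<zero>\<^bsub>T\<^esub>"
    using abc by (intro bexI[of _ "tclass (- a)"]) (auto simp: carrier_tensor add_tensor zero_tensor)
qed (auto simp: carrier_tensor zero_tensor)

end

lemma pure_left_add: "m \<in> carrier M \<Longrightarrow> m' \<in> carrier M \<Longrightarrow> n \<in> carrier N \<Longrightarrow>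
    pure (m \<oplus>\<^bsub>M\<^esub> m') n = tclass (frag_of (m, n) + frag_of (m', n))"
  using kernel_left_add by (simp add: pure_def tclass_eq_iff algebra_simps)

lemma pure_right_add: "m \<in> carrier M \<Longrightarrow> n \<in> carrier N \<Longrightarrow> n' \<in> carrier N \<Longrightarrow>
    pure m (n \<oplus>\<^bsub>N\<^esub> n') = tclass (frag_of (m, n) + frag_of (m, n'))"
  using kernel_right_add by (simp add: pure_def tclass_eq_iff algebra_simps)

text \<open>The equation \<open>m \<oplus> m = m\<close> says that \<open>m\<close> is zero without
  reference to a group structure on \<open>M\<close>.\<close>

lemma pure_left_zero: "m \<in> carrier M \<Longrightarrow> m \<oplus>\<^bsub>M\<^esub> m = m \<Longrightarrow> n \<in> carrier N \<Longrightarrow> pure m n = tclass 0"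
  using kernel_uminus[OF kernel_left_add[of m m n]] by (simp add: pure_def tclass_eq_iff)

lemma pure_right_zero: "m \<in> carrier M \<Longrightarrow> n \<in> carrier N \<Longrightarrow> n \<oplus>\<^bsub>N\<^esub> n = n \<Longrightarrow> pure m n = tclass 0"
  using kernel_uminus[OF kernel_right_add[of m n n]] by (simp add: pure_def tclass_eq_iff)

lemma pure_balanced: "a \<in> carrier A \<Longrightarrow> m \<in> carrier M \<Longrightarrow> n \<in> carrier N \<Longrightarrow>
    pure (a \<odot>\<^bsub>M\<^esub> m) n = pure m (a \<odot>\<^bsub>N\<^esub> n)"
  using kernel_balanced by (simp add: pure_def tclass_eq_iff)

end

section \<open>A concrete model for detecting tensors\<close>

definition frag_linear :: "('c \<Rightarrow> ('d \<Rightarrow>\<^sub>0 'k::field)) \<Rightarrow> ('c \<Rightarrow>\<^sub>0 int) \<Rightarrow> ('d \<Rightarrow>\<^sub>0 'k)" where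
  "frag_linear f c = (\<Sum>x\<in>Poly_Mapping.keys c. scale (of_int (Poly_Mapping.lookup c x)) (f x))"

lemma frag_linear_superset:
  assumes "finite B" "Poly_Mapping.keys c \<subseteq> B"
  shows "frag_linear f c = (\<Sum>x\<in>B. scale (of_int (Poly_Mapping.lookup c x)) (f x))"
  unfolding frag_linear_def using assms by (intro sum.mono_neutral_left) (auto simp: in_keys_iff)

lemma frag_linear_0 [simp]: "frag_linear f 0 = 0"
  by (simp add: frag_linear_def)

lemma frag_linear_of [simp]: "frag_linear f (frag_of x) = f x"
  by (simp add: frag_linear_def)

lemma frag_linear_add: "frag_linear f (c + d) = frag_linear f c + frag_linear f d"
proof -
  let ?B = "Poly_Mapping.keys c \<union> Poly_Mapping.keys d"
  have "Poly_Mapping.keys (c + d) \<subseteq> ?B" by (rule Poly_Mapping.keys_add)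
  then show ?thesis
    by (simp add: frag_linear_superset[of ?B] lookup_add scale_add_left sum.distrib)
qed

lemma frag_linear_uminus: "frag_linear f (- c) = - frag_linear f c"
  using frag_linear_add[of f c "- c"] by (simp add: eq_neg_iff_add_eq_0 add.commute)

lemma frag_linear_diff: "frag_linear f (c - d) = frag_linear f c - frag_linear f d"
  using frag_linear_add[of f c "- d"] by (simp add: frag_linear_uminus)

lemma frag_linear_sum: "frag_linear f (sum g I) = (\<Sum>i\<in>I. frag_linear f (g i))"
  by (induction I rule: infinite_finite_induct) (auto simp: frag_linear_add)

text \<open>The permutation module of the product group on pairs of tabloids. The outer tensor
  product of two Specht modules maps to it, and there nonvanishing can be read off from
  coefficients.\<close>

definition pair_act :: "((nat \<Rightarrow> nat) \<times> (nat \<Rightarrow> nat) \<Rightarrow>\<^sub>0 'k::field) \<Rightarrow> (tabloid \<times> tabloid \<Rightarrow>\<^sub>0 'k) \<Rightarrow> (tabloid \<times> tabloid \<Rightarrow>\<^sub>0 'k)" where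
  "pair_act = bilinear_extend (\<lambda>g t. Poly_Mapping.single (tabloid_act (fst g) (fst t), tabloid_act (snd g) (snd t)) 1)"

definition tabloid_tensor :: "(tabloid \<Rightarrow>\<^sub>0 'k::field) \<Rightarrow> (tabloid \<Rightarrow>\<^sub>0 'k) \<Rightarrow> (tabloid \<times> tabloid \<Rightarrow>\<^sub>0 'k)" where
  "tabloid_tensor = bilinear_extend (\<lambda>t t'. Poly_Mapping.single (t, t') 1)"

lemma lookup_tabloid_tensor:
  "Poly_Mapping.lookup (tabloid_tensor v w) (t, t') = Poly_Mapping.lookup v t * Poly_Mapping.lookup w t'"
proof -
  have "v \<in> lin_comb UNIV" by (simp add: lin_comb_def)
  then show ?thesis
  proof (induction v rule: lin_comb_induct)
    case (single s c)
    have "w \<in> lin_comb UNIV" by (simp add: lin_comb_def)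
    then show ?case
      by (induction w rule: lin_comb_induct)
        (auto simp: tabloid_tensor_def bilinear_extend_add_right lookup_add lookup_single when_def distrib_left)
  qed (auto simp: tabloid_tensor_def bilinear_extend_add_left lookup_add distrib_right)
qed

lemma pair_act_tabloid_tensor:
  "pair_act (Poly_Mapping.single (g, h) c) (tabloid_tensor v w) =
    tabloid_tensor (Poly_Mapping.single g c \<odot>\<^bsub>specht_module \<alpha>\<^esub> v) (Poly_Mapping.single h 1 \<odot>\<^bsub>specht_module \<beta>\<^esub> w)"
proof -
  have "v \<in> lin_comb UNIV" by (simp add: lin_comb_def)
  then show ?thesis unfolding tabloid_module_smult
  proof (induction v rule: lin_comb_induct)
    case (single s d)
    have "w \<in> lin_comb UNIV" by (simp add: lin_comb_def)
    then show ?case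
      by (induction w rule: lin_comb_induct)
        (auto simp: tabloid_tensor_def pair_act_def bilinear_extend_add_right mult_ac)
  qed (auto simp: tabloid_tensor_def pair_act_def bilinear_extend_add_right bilinear_extend_add_left)
qed

text \<open>Elements of the group algebra act by a sum over their support, so different pairs must
  give different group elements for each transposition to be counted once.\<close>

lemma young_transposition_inj:
  assumes "(i, j) \<in> pairs (m + n)" "i \<le> m \<longleftrightarrow> j \<le> m" "(i', j') \<in> pairs (m + n)" "i' \<le> m \<longleftrightarrow> j' \<le> m"
    and eq: "young_transposition m i j = young_transposition m i' j'"
  shows "i = i' \<and> j = j'"
proof -
  have lt: "i < j" "i' < j'" using assms by (auto simp: pairs_def)
  have "transpose (South i) (South j) = transpose (South i') (South j')"
    using eq perm_south_young_transposition[OF assms(1,2)] perm_south_young_transposition[OF assms(3,4)] by simp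
  then have "transpose (South i') (South j') (South i) = South j" by (metis transpose_apply_first)
  then show ?thesis using lt by (auto simp: transpose_def split: if_splits)
qed

definition same_side_pairs :: "nat \<Rightarrow> nat \<Rightarrow> (nat \<times> nat) set" where
  "same_side_pairs m n = {(i, j) \<in> pairs (m + n). i \<le> m \<longleftrightarrow> j \<le> m}"

lemma finite_same_side_pairs: "finite (same_side_pairs m n)"
  by (rule finite_subset[OF _ finite_pairs[of "m + n"]]) (auto simp: same_side_pairs_def)

lemma inj_young_transposition: "inj_on (\<lambda>(i, j). young_transposition m i j) (same_side_pairs m n)"
  using young_transposition_inj by (fastforce simp: inj_on_def same_side_pairs_def)

lemma lookup_transposition_sum:
  "Poly_Mapping.lookup (transposition_sum m n) g =
    (if g \<in> (\<lambda>(i, j). young_transposition m i j) ` same_side_pairs m n then 1 else (0::'k::field))"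
proof -
  let ?y = "\<lambda>(i, j). young_transposition m i j"
  have "(transposition_sum m n :: _ \<Rightarrow>\<^sub>0 'k) = (\<Sum>p\<in>same_side_pairs m n. Poly_Mapping.single (?y p) 1)"
    by (simp add: transposition_sum_def same_side_pairs_def split_def)
  also have "\<dots> = (\<Sum>g\<in>?y ` same_side_pairs m n. Poly_Mapping.single g 1)"
    by (simp add: sum.reindex[OF inj_young_transposition])
  finally show ?thesis
    by (auto simp: lookup_sum lookup_single when_def sum.delta finite_same_side_pairs)
qed

lemma keys_transposition_sum:
  "Poly_Mapping.keys (transposition_sum m n :: _ \<Rightarrow>\<^sub>0 'k::field) = (\<lambda>(i, j). young_transposition m i j) ` same_side_pairs m n"
  by (auto simp: in_keys_iff lookup_transposition_sum split: if_splits)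

lemma sum_same_side_pairs:
  "(\<Sum>(i, j)\<in>same_side_pairs m n. f (young_transposition m i j)) =
    (\<Sum>(i, j)\<in>pairs m. f (transpose i j, id)) + (\<Sum>(i, j)\<in>pairs n. f (id, transpose i j))"
proof -
  let ?B = "{(i, j) \<in> pairs (m + n). \<not> i \<le> m \<and> \<not> j \<le> m}"
  have split: "same_side_pairs m n = pairs m \<union> ?B" by (auto simp: same_side_pairs_def pairs_def)
  have "finite ?B" by (rule finite_subset[OF _ finite_pairs[of "m + n"]]) auto
  then have "(\<Sum>(i, j)\<in>same_side_pairs m n. f (young_transposition m i j)) =
    (\<Sum>(i, j)\<in>pairs m. f (young_transposition m i j)) + (\<Sum>(i, j)\<in>?B. f (young_transposition m i j))"
    unfolding split by (intro sum.union_disjoint[OF finite_pairs]) (auto simp: pairs_def)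
  also have "(\<Sum>(i, j)\<in>pairs m. f (young_transposition m i j)) = (\<Sum>(i, j)\<in>pairs m. f (transpose i j, id))"
    by (rule sum.cong) (auto simp: young_transposition_def pairs_def)
  also have "(\<Sum>(i, j)\<in>?B. f (young_transposition m i j)) = (\<Sum>(i, j)\<in>pairs n. f (id, transpose i j))"
    by (rule sum.reindex_bij_witness[of _ "\<lambda>(i, j). (m + i, m + j)" "\<lambda>(i, j). (i - m, j - m)"])
      (auto simp: young_transposition_def pairs_def)
  finally show ?thesis .
qed

section \<open>The outer tensor product of two Specht modules\<close>

lemma restrict_simps [simp]:
  "carrier (restrict_to_field (sym_group k) (specht_module \<gamma>)) = carrier (specht_module \<gamma>)"
  "x \<oplus>\<^bsub>restrict_to_field (sym_group k) (specht_module \<gamma>)\<^esub> y = x + y"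
  "c \<odot>\<^bsub>restrict_to_field (sym_group k) (specht_module \<gamma>)\<^esub> x = scale c x"
  by (simp_all add: restrict_to_field_def specht_act_id)

context
  fixes m n :: nat and \<alpha> \<beta> :: "nat list"
  assumes \<alpha>: "is_partition \<alpha> m" and \<beta>: "is_partition \<beta> n"
begin

abbreviation left_specht :: "('k::field, tabloid \<Rightarrow>\<^sub>0 'k) module" where
  "left_specht \<equiv> restrict_to_field (sym_group m) (specht_module \<alpha>)"

abbreviation right_specht :: "('k::field, tabloid \<Rightarrow>\<^sub>0 'k) module" where
  "right_specht \<equiv> restrict_to_field (sym_group n) (specht_module \<beta>)"

abbreviation outer :: "((nat \<Rightarrow> nat) \<times> (nat \<Rightarrow> nat) \<Rightarrow>\<^sub>0 'k::field, 'k specht_pair) module" where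
  "outer \<equiv> outer_tensor (sym_group m) (sym_group n) (specht_module \<alpha>) (specht_module \<beta>)"

lemma tensor_factors_outer:
  "tensor_factors (ring_of_type_algebra :: 'k::field ring) left_specht right_specht"
  by unfold_locales (auto intro: specht_add specht_scale)

interpretation O: tensor_factors "ring_of_type_algebra :: 'k::field ring" left_specht right_specht
  by (rule tensor_factors_outer)

definition outer_act :: "((nat \<Rightarrow> nat) \<times> (nat \<Rightarrow> nat) \<Rightarrow>\<^sub>0 'k::field) \<Rightarrow>
    (tabloid \<Rightarrow>\<^sub>0 'k) \<times> (tabloid \<Rightarrow>\<^sub>0 'k) \<Rightarrow> ((tabloid \<Rightarrow>\<^sub>0 'k) \<times> (tabloid \<Rightarrow>\<^sub>0 'k) \<Rightarrow>\<^sub>0 int)" where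
  "outer_act x = (\<lambda>(v, w). \<Sum>(g, h)\<in>Poly_Mapping.keys x.
     frag_of (Poly_Mapping.single g (Poly_Mapping.lookup x (g, h)) \<odot>\<^bsub>specht_module \<alpha>\<^esub> v,
              Poly_Mapping.single h 1 \<odot>\<^bsub>specht_module \<beta>\<^esub> w))"

lemma outer_eq: "outer = tensor_product ring_of_type_algebra left_specht right_specht outer_act"
  by (simp add: outer_tensor_def outer_act_def[abs_def])

abbreviation "young_algebra_carrier \<equiv> lin_comb (carrier (young_group m n))"

lemma specht_smult_closed:
  assumes "x \<in> young_algebra_carrier" "(g, h) \<in> Poly_Mapping.keys x"
  shows "v \<in> carrier (specht_module \<alpha>) \<Longrightarrow> Poly_Mapping.single g c \<odot>\<^bsub>specht_module \<alpha>\<^esub> v \<in> carrier (specht_module \<alpha>)"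
    and "w \<in> carrier (specht_module \<beta>) \<Longrightarrow> Poly_Mapping.single h c \<odot>\<^bsub>specht_module \<beta>\<^esub> w \<in> carrier (specht_module \<beta>)"
proof -
  have "(g, h) \<in> carrier (young_group m n)" using assms unfolding lin_comb_def by blast
  then have p: "g permutes {1..sum_list \<alpha>}" "h permutes {1..sum_list \<beta>}"
    using \<alpha> \<beta> by (auto simp: is_partition_def)
  show "v \<in> carrier (specht_module \<alpha>) \<Longrightarrow> Poly_Mapping.single g c \<odot>\<^bsub>specht_module \<alpha>\<^esub> v \<in> carrier (specht_module \<alpha>)"
    by (rule specht_act_closed[OF p(1)])
  show "w \<in> carrier (specht_module \<beta>) \<Longrightarrow> Poly_Mapping.single h c \<odot>\<^bsub>specht_module \<beta>\<^esub> w \<in> carrier (specht_module \<beta>)"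
    by (rule specht_act_closed[OF p(2)])
qed

lemma outer_act_frags:
  assumes "x \<in> young_algebra_carrier" "c \<in> O.frags"
  shows "frag_extend (outer_act x) c \<in> O.frags"
  using assms(2)
proof (induction c rule: O.frags_induct)
  case (of v w)
  then show ?case using specht_smult_closed[OF assms(1)] by (auto simp: outer_act_def intro!: O.frags_sum)
qed (auto simp: frag_extend_diff)

lemma kernel_scale:
  assumes "v \<in> carrier (specht_module \<alpha>)" "w \<in> carrier (specht_module \<beta>)"
  shows "frag_of (scale a v, w) - frag_of (v, scale a w) \<in> O.tkernel"
  using O.kernel_balanced[of a v w] assms by (simp add: ring_of_type_algebra_def)

lemma outer_kernel:
  assumes x: "x \<in> young_algebra_carrier" and \<rho>: "\<rho> \<in> O.tkernel"
  shows "frag_extend (outer_act x) \<rho> \<in> O.tkernel"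
  using \<rho>
proof (induction \<rho> rule: O.kernel_induct)
  case (left v v' w)
  then show ?case
    using specht_smult_closed[OF x]
    by (auto simp: frag_extend_diff outer_act_def sum_subtractf[symmetric] split_def
        tabloid_module_smult bilinear_extend_add_right
        intro!: O.kernel_sum O.kernel_left_add[simplified])
next
  case (right v w w')
  then show ?case
    using specht_smult_closed[OF x]
    by (auto simp: frag_extend_diff outer_act_def sum_subtractf[symmetric] split_def
        tabloid_module_smult bilinear_extend_add_right
        intro!: O.kernel_sum O.kernel_right_add[simplified])
next
  case (balanced a v w)
  then show ?case
    using specht_smult_closed[OF x]
    by (auto simp: frag_extend_diff outer_act_def sum_subtractf[symmetric] split_def
        tabloid_module_smult bilinear_extend_scale_right intro!: O.kernel_sum kernel_scale)
qed (auto simp: frag_extend_add frag_extend_minus O.kernel_0 O.kernel_add O.kernel_uminus)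

lemma outer_smult:
  assumes "x \<in> young_algebra_carrier"
  shows "x \<odot>\<^bsub>outer\<^esub> O.tclass c = O.tclass (frag_extend (outer_act x) c)"
  unfolding outer_eq by (rule O.smult_tensor) (rule outer_kernel[OF assms])

lemma carrier_outer: "carrier outer = O.tclass ` O.frags"
  unfolding outer_eq by (rule O.carrier_tensor)

lemma outer_add: "O.tclass c \<oplus>\<^bsub>outer\<^esub> O.tclass d = O.tclass (c + d)"
  unfolding outer_eq by (rule O.add_tensor)

lemma outer_smult_closed:
  assumes "x \<in> young_algebra_carrier" "y \<in> carrier outer"
  shows "x \<odot>\<^bsub>outer\<^esub> y \<in> carrier outer"
  using assms by (auto simp: carrier_outer outer_smult intro!: imageI outer_act_frags)

lemma outer_act_scalar:
  assumes "v \<in> carrier (specht_module \<alpha>)" "w \<in> carrier (specht_module \<beta>)"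
  shows "O.tclass (outer_act (Poly_Mapping.single (id, id) c) (v, w)) = O.pure (scale c v) w"
proof (cases "c = 0")
  case True
  \<comment> \<open>For \<open>c = 0\<close> the support is empty and the action gives the formal
    sum 0, so \<open>frag_of (0, w)\<close> has to be recognised as a member of the kernel.\<close>
  have "frag_of (0 + 0, w) - frag_of (0, w) - frag_of (0, w) \<in> O.tkernel"
    using O.kernel_left_add[of 0 0 w] assms by (simp add: specht_zero)
  then have "frag_of (0, w) \<in> O.tkernel" using O.kernel_uminus by fastforce
  then show ?thesis
    using True O.kernel_uminus by (simp add: outer_act_def O.pure_def O.tclass_eq_iff)
next
  case False
  then show ?thesis by (simp add: outer_act_def O.pure_def specht_act_id)
qed

lemma identity_young: "(id, id) \<in> carrier (young_group m n)"
  by (simp add: permutes_id)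

lemma outer_scalar:
  assumes "v \<in> carrier (specht_module \<alpha>)" "w \<in> carrier (specht_module \<beta>)"
  shows "Poly_Mapping.single (id, id) c \<odot>\<^bsub>outer\<^esub> O.pure v w = O.pure (scale c v) w"
  unfolding O.pure_def[of v w] outer_smult[OF lin_comb_single[OF identity_young]] frag_extend_of
  by (rule outer_act_scalar[OF assms])

definition content_scalar :: "'k::field" where
  "content_scalar = (\<Sum>d\<in>young_diagram \<alpha>. of_int (box_content d)) + (\<Sum>d\<in>young_diagram \<beta>. of_int (box_content d))"

text \<open>A transposition on one side of the wall acts on one tensor factor only. The sum
  therefore splits into the sums of transpositions of the two symmetric groups, each acting on its
  Specht module by the sum of contents.\<close>

lemma outer_act_transpositions:
  assumes v: "v \<in> carrier (specht_module \<alpha>)" and w: "w \<in> carrier (specht_module \<beta>)"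
  shows "O.tclass (outer_act (transposition_sum m n) (v, w)) = O.pure (scale content_scalar v) w"
proof -
  let ?a = "\<lambda>g v. Poly_Mapping.single g 1 \<odot>\<^bsub>specht_module \<alpha>\<^esub> v"
    and ?b = "\<lambda>g w. Poly_Mapping.single g 1 \<odot>\<^bsub>specht_module \<beta>\<^esub> w"
  let ?c = "\<Sum>d\<in>young_diagram \<alpha>. of_int (box_content d)" and ?d = "\<Sum>d\<in>young_diagram \<beta>. of_int (box_content d)"
  have perm: "transpose i j permutes {1..sum_list \<alpha>}" if "(i, j) \<in> pairs m" for i j
    using that \<alpha> by (intro permutes_swap_id) (auto simp: pairs_def is_partition_def)
  have perm': "transpose i j permutes {1..sum_list \<beta>}" if "(i, j) \<in> pairs n" for i j
    using that \<beta> by (intro permutes_swap_id) (auto simp: pairs_def is_partition_def)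
  have left_sum: "(\<Sum>p\<in>P. f p) \<in> carrier (specht_module \<alpha>) \<and>
      O.tclass (\<Sum>p\<in>P. frag_of (f p, w)) = O.pure (\<Sum>p\<in>P. f p) w"
    if "finite P" "\<And>p. p \<in> P \<Longrightarrow> f p \<in> carrier (specht_module \<alpha>)" for P :: "(nat \<times> nat) set" and f
    using that
  proof (induction P rule: finite_induct)
    case empty
    show ?case using outer_act_scalar[OF v w, of 0] by (simp add: outer_act_def specht_zero)
  next
    case (insert p P)
    have "O.tclass (frag_of (f p, w) + (\<Sum>p\<in>P. frag_of (f p, w))) = O.tclass (frag_of (f p, w) + frag_of (\<Sum>p\<in>P. f p, w))"
      using insert by (intro O.tclass_add_cong) (auto simp: O.pure_def)
    also have "\<dots> = O.pure (f p + (\<Sum>p\<in>P. f p)) w"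
      using O.pure_left_add[of "f p" "\<Sum>p\<in>P. f p" w] insert w by simp
    finally show ?case using insert by (simp add: specht_add)
  qed
  have right_sum: "(\<Sum>p\<in>P. f p) \<in> carrier (specht_module \<beta>) \<and>
      O.tclass (\<Sum>p\<in>P. frag_of (v, f p)) = O.pure v (\<Sum>p\<in>P. f p)"
    if "finite P" "\<And>p. p \<in> P \<Longrightarrow> f p \<in> carrier (specht_module \<beta>)" for P :: "(nat \<times> nat) set" and f
    using that
  proof (induction P rule: finite_induct)
    case empty
    have "O.pure (scale 0 v) w = O.pure v (scale 0 w)"
      using kernel_scale[OF v w, of 0] by (simp add: O.pure_def O.tclass_eq_iff)
    then show ?case using outer_act_scalar[OF v w, of 0] by (simp add: outer_act_def specht_zero)
  next
    case (insert p P)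
    have "O.tclass (frag_of (v, f p) + (\<Sum>p\<in>P. frag_of (v, f p))) = O.tclass (frag_of (v, f p) + frag_of (v, \<Sum>p\<in>P. f p))"
      using insert by (intro O.tclass_add_cong) (auto simp: O.pure_def)
    also have "\<dots> = O.pure v (f p + (\<Sum>p\<in>P. f p))"
      using O.pure_right_add[of v "f p" "\<Sum>p\<in>P. f p"] insert v by simp
    finally show ?case using insert by (simp add: specht_add)
  qed
  have T: "(\<Sum>p\<in>pairs m. ?a (transpose (fst p) (snd p)) v) = scale ?c v"
    "(\<Sum>p\<in>pairs n. ?b (transpose (fst p) (snd p)) w) = scale ?d w"
    using transpositions_specht[OF \<alpha> v] transpositions_specht[OF \<beta> w]
    by (simp_all add: tabloid_module_smult bilinear_extend_sum_left split_def)
  have "outer_act (transposition_sum m n) (v, w) =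
    (\<Sum>g\<in>(\<lambda>(i, j). young_transposition m i j) ` same_side_pairs m n. frag_of (?a (fst g) v, ?b (snd g) w))"
    unfolding outer_act_def split keys_transposition_sum split_def
    by (intro sum.cong refl) (simp add: lookup_transposition_sum split_def)
  also have "\<dots> = (\<Sum>(i, j)\<in>same_side_pairs m n.
      frag_of (?a (fst (young_transposition m i j)) v, ?b (snd (young_transposition m i j)) w))"
    unfolding sum.reindex[OF inj_young_transposition] by (simp add: split_def comp_def)
  also have "\<dots> = (\<Sum>p\<in>pairs m. frag_of (?a (transpose (fst p) (snd p)) v, w)) +
      (\<Sum>p\<in>pairs n. frag_of (v, ?b (transpose (fst p) (snd p)) w))"
    unfolding sum_same_side_pairs[of "\<lambda>g. frag_of (?a (fst g) v, ?b (snd g) w)"]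
    by (simp add: specht_act_id split_def)
  finally have "O.tclass (outer_act (transposition_sum m n) (v, w)) =
    O.tclass ((\<Sum>p\<in>pairs m. frag_of (?a (transpose (fst p) (snd p)) v, w)) +
      (\<Sum>p\<in>pairs n. frag_of (v, ?b (transpose (fst p) (snd p)) w)))" by simp
  also have "\<dots> = O.tclass (frag_of (scale ?c v, w) + frag_of (v, scale ?d w))"
    using left_sum[of "pairs m" "\<lambda>p. ?a (transpose (fst p) (snd p)) v"]
      right_sum[of "pairs n" "\<lambda>p. ?b (transpose (fst p) (snd p)) w"]
      specht_act_closed[OF perm v] specht_act_closed[OF perm' w]
    by (intro O.tclass_add_cong) (auto simp: O.pure_def T)
  \<comment> \<open>The scalar of the right factor crosses the tensor sign, so that the two scalars
    can be added on the left.\<close>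
  also have "\<dots> = O.tclass (frag_of (scale ?c v, w) + frag_of (scale ?d v, w))"
    using O.kernel_uminus[OF kernel_scale[OF v w, of ?d]]
    by (intro O.tclass_add_cong refl) (simp add: O.tclass_eq_iff)
  also have "\<dots> = O.pure (scale content_scalar v) w"
    using O.pure_left_add[of "scale ?c v" "scale ?d v" w] v w
    by (simp add: specht_scale content_scalar_def scale_add_left)
  finally show ?thesis .
qed

lemma outer_transpositions:
  assumes "y \<in> carrier (outer :: (_, 'k::field specht_pair) module)"
  shows "transposition_sum m n \<odot>\<^bsub>outer\<^esub> y = Poly_Mapping.single (id, id) content_scalar \<odot>\<^bsub>outer\<^esub> y"
proof -
  obtain c where c: "c \<in> O.frags" "y = O.tclass c" using assms by (auto simp: carrier_outer)
  have "O.tclass (frag_extend (outer_act (transposition_sum m n)) c) =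
      O.tclass (frag_extend (outer_act (Poly_Mapping.single (id, id) content_scalar)) c)"
    using c(1)
  proof (induction c rule: O.frags_induct)
    case (of v w)
    then show ?case
      unfolding frag_extend_of by (simp only: outer_act_transpositions outer_act_scalar restrict_simps)
  next
    case (diff c d)
    then show ?case unfolding frag_extend_diff by (intro O.tclass_diff_cong)
  qed simp
  then show ?thesis
    unfolding c(2) outer_smult[OF transposition_sum_closed] outer_smult[OF lin_comb_single[OF identity_young]] .
qed

text \<open>Any representative may be chosen, because the bilinear map to pairs of tabloids vanishes
  on the relations.\<close>

definition outer_value :: "'k::field specht_pair \<Rightarrow> (tabloid \<times> tabloid \<Rightarrow>\<^sub>0 'k)" where
  "outer_value y = frag_linear (\<lambda>(v, w). tabloid_tensor v w) (SOME c. c \<in> y)"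

lemma outer_value_kernel:
  "\<rho> \<in> O.tkernel \<Longrightarrow> frag_linear (\<lambda>(v, w). tabloid_tensor v w) \<rho> = (0 :: tabloid \<times> tabloid \<Rightarrow>\<^sub>0 'k::field)"
  by (induction \<rho> rule: O.kernel_induct)
    (auto simp: frag_linear_add frag_linear_uminus frag_linear_diff tabloid_tensor_def
      bilinear_extend_add_left bilinear_extend_add_right bilinear_extend_scale_left bilinear_extend_scale_right)

lemma outer_value_tclass:
  "outer_value (O.tclass c) = frag_linear (\<lambda>(v, w). tabloid_tensor v w) c"
proof -
  have "c \<in> O.tclass c" using O.kernel_0 by (force simp: O.tclass_def)
  then have "(SOME c'. c' \<in> O.tclass c) \<in> O.tclass c" by (rule someI)
  then obtain \<rho> where "\<rho> \<in> O.tkernel" "(SOME c'. c' \<in> O.tclass c) = \<rho> + c" by (auto simp: O.tclass_def)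
  then show ?thesis by (simp add: outer_value_def frag_linear_add outer_value_kernel)
qed

lemma outer_value_add:
  assumes "y \<in> carrier outer" "z \<in> carrier outer"
  shows "outer_value (y \<oplus>\<^bsub>outer\<^esub> z) = outer_value y + (outer_value z :: tabloid \<times> tabloid \<Rightarrow>\<^sub>0 'k::field)"
  using assms by (auto simp: carrier_outer outer_add outer_value_tclass frag_linear_add)

lemma outer_value_smult:
  assumes x: "x \<in> young_algebra_carrier" and y: "y \<in> carrier (outer :: (_, 'k::field specht_pair) module)"
  shows "outer_value (x \<odot>\<^bsub>outer\<^esub> y) = pair_act x (outer_value y)"
proof -
  let ?f = "\<lambda>(v, w). tabloid_tensor v w :: tabloid \<times> tabloid \<Rightarrow>\<^sub>0 'k"
  obtain c where c: "c \<in> O.frags" "y = O.tclass c" using y by (auto simp: carrier_outer)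
  have "frag_linear ?f (frag_extend (outer_act x) c) = pair_act x (frag_linear ?f c)"
    using c(1)
  proof (induction c rule: O.frags_induct)
    case zero
    then show ?case by (simp add: pair_act_def)
  next
    case (of v w)
    have "frag_linear ?f (outer_act x (v, w)) =
      (\<Sum>(g, h)\<in>Poly_Mapping.keys x. pair_act (Poly_Mapping.single (g, h) (Poly_Mapping.lookup x (g, h))) (tabloid_tensor v w))"
      unfolding outer_act_def split frag_linear_sum pair_act_tabloid_tensor[of _ _ _ v w \<alpha> \<beta>]
      by (simp add: split_def)
    also have "\<dots> = pair_act (\<Sum>g\<in>Poly_Mapping.keys x. Poly_Mapping.single g (Poly_Mapping.lookup x g)) (tabloid_tensor v w)"
      unfolding pair_act_def bilinear_extend_sum_left by (simp add: split_def)
    also have "(\<Sum>g\<in>Poly_Mapping.keys x. Poly_Mapping.single g (Poly_Mapping.lookup x g)) = x"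
      by (rule poly_mapping_sum_single) auto
    finally show ?case by simp
  next
    case (diff c d)
    have "pair_act x (a - b) = pair_act x a - pair_act x b" for a b
      by (simp add: pair_act_def eq_diff_eq bilinear_extend_add_right[symmetric])
    then show ?case using diff by (simp add: frag_extend_diff frag_linear_diff)
  qed
  then show ?thesis by (simp add: c(2) outer_smult[OF x] outer_value_tclass)
qed

end

section \<open>Cell modules\<close>

context
  fixes r s t :: nat and \<delta> :: "'k::field" and \<alpha> \<beta> :: "nat list"
  assumes t: "t \<le> min r s" and \<alpha>: "is_partition \<alpha> (r - t)" and \<beta>: "is_partition \<beta> (s - t)"
begin

abbreviation "half \<equiv> half_diagrams r s t"
abbreviation "young \<equiv> young_group (r - t) (s - t)"
abbreviation "brauer \<equiv> walled_brauer \<delta> r s"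
abbreviation outer_specht :: "((nat \<Rightarrow> nat) \<times> (nat \<Rightarrow> nat) \<Rightarrow>\<^sub>0 'k, 'k specht_pair) module" where
  "outer_specht \<equiv> outer (r - t) (s - t) \<alpha> \<beta>"
abbreviation "cell \<equiv> cell_module \<delta> r s t (\<alpha>, \<beta>)"

interpretation O: tensor_factors "ring_of_type_algebra :: 'k ring" "left_specht (r - t) \<alpha>" "right_specht (s - t) \<beta>"
  by (rule tensor_factors_outer[OF \<alpha> \<beta>])

lemma tensor_factors_cell:
  "tensor_factors (group_algebra young) (half_right_module r s t) outer_specht"
proof
  fix y y' assume "y \<in> carrier outer_specht" "y' \<in> carrier outer_specht"
  then show "y \<oplus>\<^bsub>outer_specht\<^esub> y' \<in> carrier outer_specht"
    by (auto simp: carrier_outer[OF \<alpha> \<beta>] outer_add[OF \<alpha> \<beta>])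
next
  fix a :: "(nat \<Rightarrow> nat) \<times> (nat \<Rightarrow> nat) \<Rightarrow>\<^sub>0 'k" and y
  assume "a \<in> carrier (group_algebra young)" "y \<in> carrier outer_specht"
  then show "a \<odot>\<^bsub>outer_specht\<^esub> y \<in> carrier outer_specht"
    by (intro outer_smult_closed[OF \<alpha> \<beta>]) (simp_all add: group_algebra_def)
next
  fix a :: "(nat \<Rightarrow> nat) \<times> (nat \<Rightarrow> nat) \<Rightarrow>\<^sub>0 'k" and x
  assume "a \<in> carrier (group_algebra young)" "x \<in> carrier (half_right_module r s t :: (_, diagram \<Rightarrow>\<^sub>0 'k) module)"
  then show "a \<odot>\<^bsub>half_right_module r s t\<^esub> x \<in> carrier (half_right_module r s t)"
    using half_right_closed[OF t, of a x] by (simp only: half_right_module_simps(1) group_algebra_def partial_object.select_convs)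
qed simp

interpretation C: tensor_factors "group_algebra young" "half_right_module r s t" outer_specht
  by (rule tensor_factors_cell)

lemma carrier_young_algebra: "carrier (group_algebra young) = lin_comb (carrier young)"
  by (simp add: group_algebra_def)

definition cell_act :: "(diagram \<Rightarrow>\<^sub>0 'k) \<Rightarrow> (diagram \<Rightarrow>\<^sub>0 'k) \<times> 'k specht_pair \<Rightarrow> ((diagram \<Rightarrow>\<^sub>0 'k) \<times> 'k specht_pair \<Rightarrow>\<^sub>0 int)" where
  "cell_act b = (\<lambda>(x, y). frag_of (b \<odot>\<^bsub>half_left_module \<delta> r s t\<^esub> x, y))"

lemma cell_eq: "cell = tensor_product (group_algebra young) (half_right_module r s t) outer_specht cell_act"
  by (simp add: cell_module_def Let_def cell_act_def[abs_def])

lemma brauer_carrier: "b \<in> carrier brauer \<longleftrightarrow> b \<in> lin_comb (walled_diagrams r s r s)"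
  by simp

lemma cell_act_frags:
  assumes b: "b \<in> carrier brauer" and c: "c \<in> C.frags"
  shows "frag_extend (cell_act b) c \<in> C.frags"
  using c
proof (induction c rule: C.frags_induct)
  case (of x y)
  then show ?case using half_left_closed[OF t, of b x \<delta>] b by (simp add: cell_act_def)
qed (auto simp: frag_extend_diff)

lemma half_left_add_right:
  "b \<odot>\<^bsub>half_left_module \<delta> r s t\<^esub> (x + y) = b \<odot>\<^bsub>half_left_module \<delta> r s t\<^esub> x + b \<odot>\<^bsub>half_left_module \<delta> r s t\<^esub> y"
  by (simp add: half_left_module_smult bilinear_extend_add_right)

lemma half_left_add_left:
  "(a + b) \<odot>\<^bsub>half_left_module \<delta> r s t\<^esub> x = a \<odot>\<^bsub>half_left_module \<delta> r s t\<^esub> x + b \<odot>\<^bsub>half_left_module \<delta> r s t\<^esub> x"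
  by (simp add: half_left_module_smult bilinear_extend_add_left)

text \<open>The balance relations are preserved because the algebra acts on half diagrams from above
  and the group from below.\<close>

lemma cell_act_kernel:
  assumes b: "b \<in> carrier brauer" and \<rho>: "\<rho> \<in> C.tkernel"
  shows "frag_extend (cell_act b) \<rho> \<in> C.tkernel"
  using \<rho>
proof (induction \<rho> rule: C.kernel_induct)
  case (left x x' y)
  then show ?case
    using C.kernel_left_add[of "b \<odot>\<^bsub>half_left_module \<delta> r s t\<^esub> x" "b \<odot>\<^bsub>half_left_module \<delta> r s t\<^esub> x'" y]
      half_left_closed[OF t, of b _ \<delta>] b
    by (simp add: frag_extend_diff cell_act_def half_left_add_right)
next
  case (right x y y')
  then show ?case
    using C.kernel_right_add[of "b \<odot>\<^bsub>half_left_module \<delta> r s t\<^esub> x" y y'] half_left_closed[OF t, of b x \<delta>] b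
    by (simp add: frag_extend_diff cell_act_def)
next
  case (balanced a x y)
  have "b \<odot>\<^bsub>half_left_module \<delta> r s t\<^esub> (a \<odot>\<^bsub>half_right_module r s t\<^esub> x) =
      a \<odot>\<^bsub>half_right_module r s t\<^esub> (b \<odot>\<^bsub>half_left_module \<delta> r s t\<^esub> x)"
    using b balanced unfolding carrier_young_algebra brauer_carrier half_right_module_simps(1)
    by (intro half_left_right_commute[OF t])
  moreover have "b \<odot>\<^bsub>half_left_module \<delta> r s t\<^esub> x \<in> carrier (half_right_module r s t)"
    using half_left_closed[OF t, of b x \<delta>] b balanced by simp
  ultimately show ?case
    using C.kernel_balanced[of a "b \<odot>\<^bsub>half_left_module \<delta> r s t\<^esub> x" y] balanced(1,3)
    unfolding frag_extend_diff frag_extend_of cell_act_def split by simp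
qed (auto simp: frag_extend_add frag_extend_minus C.kernel_0 C.kernel_add C.kernel_uminus)

lemma cell_smult:
  assumes "b \<in> carrier brauer"
  shows "b \<odot>\<^bsub>cell\<^esub> C.tclass c = C.tclass (frag_extend (cell_act b) c)"
  unfolding cell_eq by (rule C.smult_tensor) (rule cell_act_kernel[OF assms])

lemma carrier_cell: "carrier cell = C.tclass ` C.frags"
  unfolding cell_eq by (rule C.carrier_tensor)

lemma cell_add: "C.tclass c \<oplus>\<^bsub>cell\<^esub> C.tclass d = C.tclass (c + d)"
  unfolding cell_eq by (rule C.add_tensor)

lemma cell_zero: "\<zero>\<^bsub>cell\<^esub> = C.tclass 0"
  unfolding cell_eq by (rule C.zero_tensor)

lemma scale_one_diagram: "brauer_scalar r s c \<in> carrier brauer"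
  by (auto simp: brauer_scalar_def intro: identity_walled)

lemma tclass_extend_cong:
  assumes c: "c \<in> C.frags"
    and "\<And>x y. x \<in> lin_comb half \<Longrightarrow> y \<in> carrier outer_specht \<Longrightarrow> C.tclass (f (x, y)) = C.tclass (g (x, y))"
  shows "C.tclass (frag_extend f c) = C.tclass (frag_extend g c)"
  using c
proof (induction c rule: C.frags_induct)
  case (of x y)
  then show ?case unfolding frag_extend_of by (intro assms(2)) simp_all
next
  case (diff c d)
  then show ?case unfolding frag_extend_diff by (intro C.tclass_diff_cong)
qed simp

lemma frag_extend_plus: "frag_extend (\<lambda>p. f p + g p) c = frag_extend f c + frag_extend g c"
  by (simp add: frag_extend_def frag_cmul_distrib2 sum.distrib)

lemma left_module_cell: "left_module brauer cell"
proof (intro left_module.intro left_module_axioms.intro)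
  show "ring brauer" by (rule ring_walled_brauer)
  show "abelian_group cell" unfolding cell_eq by (rule C.abelian_group_tensor)
  fix a b x y assume a: "a \<in> carrier brauer" and x: "x \<in> carrier cell"
  obtain c where c: "x = C.tclass c" "c \<in> C.frags" using x by (auto simp: carrier_cell)
  show "a \<odot>\<^bsub>cell\<^esub> x \<in> carrier cell"
    by (simp add: c cell_smult[OF a] carrier_cell cell_act_frags[OF a] del: walled_brauer_simps)
  show "a \<odot>\<^bsub>cell\<^esub> (x \<oplus>\<^bsub>cell\<^esub> y) = a \<odot>\<^bsub>cell\<^esub> x \<oplus>\<^bsub>cell\<^esub> a \<odot>\<^bsub>cell\<^esub> y" if y: "y \<in> carrier cell"
    using y c by (auto simp: carrier_cell cell_add cell_smult[OF a] frag_extend_add)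
  assume b: "b \<in> carrier brauer"
  have ab: "a \<oplus>\<^bsub>brauer\<^esub> b \<in> carrier brauer" "a \<otimes>\<^bsub>brauer\<^esub> b \<in> carrier brauer"
    using a b ring.ring_simprules(1,5)[OF ring_walled_brauer] by blast+
  \<comment> \<open>Additivity in the algebra element holds only modulo the relations, in contrast
    to the multiplicative law below, which already holds for formal sums.\<close>
  have "C.tclass (frag_extend (cell_act (a \<oplus>\<^bsub>brauer\<^esub> b)) c) =
      C.tclass (frag_extend (\<lambda>p. cell_act a p + cell_act b p) c)"
  proof (rule tclass_extend_cong[OF c(2)])
    fix x :: "diagram \<Rightarrow>\<^sub>0 'k" and y assume "x \<in> lin_comb half" "y \<in> carrier outer_specht"
    then show "C.tclass (cell_act (a \<oplus>\<^bsub>brauer\<^esub> b) (x, y)) = C.tclass (cell_act a (x, y) + cell_act b (x, y))"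
      using C.pure_left_add[of "a \<odot>\<^bsub>half_left_module \<delta> r s t\<^esub> x" "b \<odot>\<^bsub>half_left_module \<delta> r s t\<^esub> x" y]
        half_left_closed[OF t, of _ x \<delta>] a b
      by (simp add: cell_act_def C.pure_def half_left_add_left)
  qed
  then show "(a \<oplus>\<^bsub>brauer\<^esub> b) \<odot>\<^bsub>cell\<^esub> x = a \<odot>\<^bsub>cell\<^esub> x \<oplus>\<^bsub>cell\<^esub> b \<odot>\<^bsub>cell\<^esub> x"
    unfolding c(1) cell_smult[OF a] cell_smult[OF b] cell_smult[OF ab(1)] cell_add frag_extend_plus .
  have "frag_extend (cell_act (a \<otimes>\<^bsub>brauer\<^esub> b)) c = frag_extend (cell_act a) (frag_extend (cell_act b) c)"
    using c(2)
  proof (induction c rule: C.frags_induct)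
    case (of x y)
    then have "x \<in> lin_comb half" by simp
    then show ?case
      unfolding frag_extend_of cell_act_def split
      using half_left_assoc[OF t a[unfolded brauer_carrier] b[unfolded brauer_carrier], of x] by simp
  qed (simp_all only: frag_extend_diff frag_extend_0)
  then show "(a \<otimes>\<^bsub>brauer\<^esub> b) \<odot>\<^bsub>cell\<^esub> x = a \<odot>\<^bsub>cell\<^esub> (b \<odot>\<^bsub>cell\<^esub> x)"
    unfolding c(1) cell_smult[OF a] cell_smult[OF b] cell_smult[OF ab(2)] by simp
next
  fix x assume "x \<in> carrier cell"
  then obtain c where c: "x = C.tclass c" "c \<in> C.frags" by (auto simp: carrier_cell)
  have one: "\<one>\<^bsub>brauer\<^esub> = brauer_scalar r s 1" by (simp add: brauer_scalar_def)
  have "frag_extend (cell_act (brauer_scalar r s 1)) c = c"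
    using c(2)
  proof (induction c rule: C.frags_induct)
    case (of x y)
    then show ?case using half_left_scalar[OF t, of x \<delta> 1] by (simp add: cell_act_def)
  qed (simp_all add: frag_extend_diff)
  then show "\<one>\<^bsub>brauer\<^esub> \<odot>\<^bsub>cell\<^esub> x = x"
    unfolding one c(1) cell_smult[OF scale_one_diagram] by simp
qed

section \<open>The central character of a cell module\<close>

lemma young_scalar_half:
  assumes "x \<in> lin_comb half"
  shows "Poly_Mapping.single (id, id) c \<odot>\<^bsub>half_right_module r s t\<^esub> x = scale c x"
  using assms
proof (induction x rule: lin_comb_induct)
  case (single D d)
  have "south_act (r - t) (id, id) D = D" by (rule south_act_one)
  then show ?case unfolding half_right_module_simps bilinear_extend_single by (simp add: mult.commute)
qed (auto simp: bilinear_extend_add_right scale_add)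

lemma pure_scale:
  assumes "x \<in> lin_comb half" "y \<in> carrier outer_specht"
  shows "C.pure (scale c x) y = C.pure x (Poly_Mapping.single (id, id) c \<odot>\<^bsub>outer_specht\<^esub> y)"
proof -
  have "Poly_Mapping.single (id, id) c \<in> carrier (group_algebra young)"
    unfolding carrier_young_algebra by (rule lin_comb_single[OF identity_young[OF \<alpha> \<beta>]])
  from C.pure_balanced[OF this, of x y] show ?thesis
    using assms young_scalar_half[OF assms(1), of c] by simp
qed

text \<open>The sum of transpositions produced on \<open>I\<^sup>t\<close> crosses the tensor sign
  and becomes a scalar on the two Specht modules; that scalar is then moved back to the half
  diagram.\<close>

lemma casimir_cell:
  assumes x: "x \<in> carrier cell"
  shows "casimir r s \<odot>\<^bsub>cell\<^esub> x = brauer_scalar r s (content_scalar \<alpha> \<beta> - of_nat t * \<delta>) \<odot>\<^bsub>cell\<^esub> x"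
proof -
  obtain c where c: "x = C.tclass c" "c \<in> C.frags" using x by (auto simp: carrier_cell)
  let ?T = "transposition_sum (r - t) (s - t)" and ?\<kappa> = "content_scalar \<alpha> \<beta> :: 'k"
  have cas: "casimir r s \<in> carrier brauer" by (simp add: casimir_closed)
  have "C.tclass (frag_extend (cell_act (casimir r s)) c) =
      C.tclass (frag_extend (cell_act (brauer_scalar r s (?\<kappa> - of_nat t * \<delta>))) c)"
  proof (rule tclass_extend_cong[OF c(2)])
    fix x :: "diagram \<Rightarrow>\<^sub>0 'k" and y assume xy: "x \<in> lin_comb half" "y \<in> carrier outer_specht"
    have T: "?T \<in> carrier (group_algebra young)"
      unfolding carrier_young_algebra by (rule transposition_sum_closed)
    have Tx: "?T \<odot>\<^bsub>half_right_module r s t\<^esub> x \<in> lin_comb half"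
      by (rule half_right_closed[OF t transposition_sum_closed xy(1)])
    have "casimir r s \<odot>\<^bsub>half_left_module \<delta> r s t\<^esub> x =
        ?T \<odot>\<^bsub>half_right_module r s t\<^esub> x + scale (- (of_nat t * \<delta>)) x"
      unfolding casimir_half[OF t xy(1)] scale_minus_left by simp
    then have "C.tclass (cell_act (casimir r s) (x, y)) =
        C.pure (?T \<odot>\<^bsub>half_right_module r s t\<^esub> x + scale (- (of_nat t * \<delta>)) x) y"
      by (simp add: cell_act_def C.pure_def)
    also have "\<dots> = C.tclass (frag_of (?T \<odot>\<^bsub>half_right_module r s t\<^esub> x, y) + frag_of (scale (- (of_nat t * \<delta>)) x, y))"
      using C.pure_left_add[of "?T \<odot>\<^bsub>half_right_module r s t\<^esub> x" "scale (- (of_nat t * \<delta>)) x" y] xy Tx by simp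
    also have "\<dots> = C.tclass (frag_of (scale ?\<kappa> x, y) + frag_of (scale (- (of_nat t * \<delta>)) x, y))"
    proof (rule C.tclass_add_cong[OF _ refl])
      have "C.pure (?T \<odot>\<^bsub>half_right_module r s t\<^esub> x) y = C.pure x (?T \<odot>\<^bsub>outer_specht\<^esub> y)"
        using C.pure_balanced[OF T, of x y] xy by simp
      also have "\<dots> = C.pure (scale ?\<kappa> x) y"
        unfolding outer_transpositions[OF \<alpha> \<beta> xy(2)] pure_scale[OF xy] ..
      finally show "C.tclass (frag_of (?T \<odot>\<^bsub>half_right_module r s t\<^esub> x, y)) = C.tclass (frag_of (scale ?\<kappa> x, y))"
        by (simp add: C.pure_def)
    qed
    also have "\<dots> = C.pure (scale ?\<kappa> x + scale (- (of_nat t * \<delta>)) x) y"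
      using C.pure_left_add[of "scale ?\<kappa> x" "scale (- (of_nat t * \<delta>)) x" y] xy by simp
    also have "scale ?\<kappa> x + scale (- (of_nat t * \<delta>)) x = scale (?\<kappa> - of_nat t * \<delta>) x"
      unfolding scale_add_left[symmetric] by simp
    also have "C.pure (scale (?\<kappa> - of_nat t * \<delta>) x) y = C.tclass (cell_act (brauer_scalar r s (?\<kappa> - of_nat t * \<delta>)) (x, y))"
      using half_left_scalar[OF t xy(1)] by (simp add: cell_act_def C.pure_def)
    finally show "C.tclass (cell_act (casimir r s) (x, y)) = C.tclass (cell_act (brauer_scalar r s (?\<kappa> - of_nat t * \<delta>)) (x, y))" .
  qed
  then show ?thesis unfolding c(1) cell_smult[OF cas] cell_smult[OF scale_one_diagram] .
qed

section \<open>Nonvanishing of the cell module\<close>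

definition base_coordinates :: "(diagram \<Rightarrow>\<^sub>0 'k) \<Rightarrow> ((nat \<Rightarrow> nat) \<times> (nat \<Rightarrow> nat) \<Rightarrow>\<^sub>0 'k)" where
  "base_coordinates x = (\<Sum>g\<in>carrier young.
     Poly_Mapping.single g (Poly_Mapping.lookup x (south_act (r - t) g (base_half r s t))))"

lemma base_coordinates_add: "base_coordinates (x + y) = base_coordinates x + base_coordinates y"
  by (simp add: base_coordinates_def lookup_add single_add sum.distrib)

lemma base_coordinates_0: "base_coordinates 0 = 0"
  by (simp add: base_coordinates_def)

lemma base_coordinates_closed: "base_coordinates x \<in> lin_comb (carrier young)"
  unfolding base_coordinates_def by (intro lin_comb_sum lin_comb_single)

lemma base_coordinates_single:
  "base_coordinates (Poly_Mapping.single D c) =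
    (\<Sum>g\<in>{g \<in> carrier young. south_act (r - t) g (base_half r s t) = D}. Poly_Mapping.single g c)"
  unfolding base_coordinates_def
  by (rule sum.mono_neutral_cong_right)
    (use finite_young_group in \<open>auto simp: lookup_single when_def\<close>)

text \<open>Right multiplication by \<open>h\<close> is a bijection from the group elements that
  carry the base diagram to \<open>D\<close> onto those that carry it to the translate of
  \<open>D\<close> by \<open>h\<close>. So reading coordinates along the orbit is linear over the
  group algebra.\<close>

lemma base_coordinates_smult:
  assumes a: "a \<in> lin_comb (carrier young)" and x: "x \<in> lin_comb half"
  shows "base_coordinates (a \<odot>\<^bsub>half_right_module r s t\<^esub> x) =
    bilinear_extend (\<lambda>g h. Poly_Mapping.single (g \<otimes>\<^bsub>young\<^esub> h) 1) (base_coordinates x) a"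
  using a
proof (induction a rule: lin_comb_induct)
  case zero then show ?case by (simp add: base_coordinates_0)
next
  case (add a b)
  then show ?case
    by (simp only: half_right_module_simps bilinear_extend_add_left bilinear_extend_add_right base_coordinates_add)
next
  case (single h c)
  interpret group young by (rule group_young_group)
  let ?B = "base_half r s t"
  show ?case using x
  proof (induction x rule: lin_comb_induct)
    case zero then show ?case by (simp add: base_coordinates_0)
  next
    case (add x y)
    then show ?case
      by (simp only: half_right_module_simps bilinear_extend_add_left bilinear_extend_add_right base_coordinates_add)
  next
    case (single D d)
    have act: "south_act (r - t) g (south_act (r - t) f E) = south_act (r - t) (f \<otimes>\<^bsub>young\<^esub> g) E"
      if "f \<in> carrier young" "g \<in> carrier young" for f g E
      by (rule south_act_mult[OF that])
    have one: "south_act (r - t) \<one>\<^bsub>young\<^esub> E = E" for E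
      using south_act_one[of "r - t" E] by (simp only: one_DirProd sym_group_simps(3))
    have "(\<Sum>g\<in>{g \<in> carrier young. south_act (r - t) g ?B = south_act (r - t) h D}. Poly_Mapping.single g (d * c)) =
      (\<Sum>g\<in>{g \<in> carrier young. south_act (r - t) g ?B = D}. Poly_Mapping.single (g \<otimes>\<^bsub>young\<^esub> h) (d * c))"
    proof (rule sum.reindex_bij_witness[of _ "\<lambda>g. g \<otimes>\<^bsub>young\<^esub> h" "\<lambda>g. g \<otimes>\<^bsub>young\<^esub> inv\<^bsub>young\<^esub> h"])
      note h = \<open>h \<in> carrier young\<close>
      fix g assume "g \<in> {g \<in> carrier young. south_act (r - t) g ?B = south_act (r - t) h D}"
      then have g: "g \<in> carrier young" "south_act (r - t) g ?B = south_act (r - t) h D" by blast+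
      show "g \<otimes>\<^bsub>young\<^esub> inv\<^bsub>young\<^esub> h \<otimes>\<^bsub>young\<^esub> h = g"
        using g h by (simp only: m_assoc inv_closed l_inv r_one)
      have "south_act (r - t) (g \<otimes>\<^bsub>young\<^esub> inv\<^bsub>young\<^esub> h) ?B = south_act (r - t) (h \<otimes>\<^bsub>young\<^esub> inv\<^bsub>young\<^esub> h) D"
        using act[of g "inv\<^bsub>young\<^esub> h" ?B] act[of h "inv\<^bsub>young\<^esub> h" D] g h inv_closed by metis
      then show "g \<otimes>\<^bsub>young\<^esub> inv\<^bsub>young\<^esub> h \<in> {g \<in> carrier young. south_act (r - t) g ?B = D}"
        using g(1) h by (simp only: r_inv one mem_Collect_eq m_closed inv_closed)
      show "Poly_Mapping.single (g \<otimes>\<^bsub>young\<^esub> inv\<^bsub>young\<^esub> h \<otimes>\<^bsub>young\<^esub> h) (d * c) = Poly_Mapping.single g (d * c)"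
        using g h by (simp only: m_assoc inv_closed l_inv r_one)
    next
      note h = \<open>h \<in> carrier young\<close>
      fix g assume "g \<in> {g \<in> carrier young. south_act (r - t) g ?B = D}"
      then have g: "g \<in> carrier young" "south_act (r - t) g ?B = D" by blast+
      show "g \<otimes>\<^bsub>young\<^esub> h \<otimes>\<^bsub>young\<^esub> inv\<^bsub>young\<^esub> h = g"
        using g h by (simp only: m_assoc inv_closed r_inv r_one)
      show "g \<otimes>\<^bsub>young\<^esub> h \<in> {g \<in> carrier young. south_act (r - t) g ?B = south_act (r - t) h D}"
        using act[OF g(1) h, of ?B] g h m_closed by (simp only: mem_Collect_eq)
    qed
    then show ?case
      unfolding half_right_module_simps bilinear_extend_single scale_single base_coordinates_single bilinear_extend_sum_left
      by (simp add: mult.commute)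
  qed
qed

text \<open>
  Since \<open>I\<^sup>t\<close> is free over the group algebra, reading off the coordinates at one basis element
  gives a balanced map that detects a pure tensor.
\<close>

definition cell_value :: "(diagram \<Rightarrow>\<^sub>0 'k) \<times> 'k specht_pair \<Rightarrow> (tabloid \<times> tabloid \<Rightarrow>\<^sub>0 'k)" where
  "cell_value = (\<lambda>(x, y). pair_act (base_coordinates x) (outer_value y))"

lemma cell_value_kernel:
  assumes "\<rho> \<in> C.tkernel" shows "frag_linear cell_value \<rho> = 0"
  using assms
proof (induction \<rho> rule: C.kernel_induct)
  case (left x x' y)
  then show ?case
    by (simp add: frag_linear_diff cell_value_def base_coordinates_add pair_act_def bilinear_extend_add_left)
next
  case (right x y y')
  then show ?case
    by (simp add: frag_linear_diff cell_value_def outer_value_add[OF \<alpha> \<beta>] pair_act_def bilinear_extend_add_right)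
next
  case (balanced a x y)
  then have a: "a \<in> lin_comb (carrier young)" and x: "x \<in> lin_comb half"
    unfolding carrier_young_algebra half_right_module_simps(1) by simp_all
  have z: "outer_value y \<in> lin_comb (UNIV :: (tabloid \<times> tabloid) set)" by (simp add: lin_comb_def)
  have "pair_act (bilinear_extend (\<lambda>g h. Poly_Mapping.single (g \<otimes>\<^bsub>young\<^esub> h) 1) (base_coordinates x) a) (outer_value y) =
      pair_act (base_coordinates x) (pair_act a (outer_value y))"
    unfolding pair_act_def
    using base_coordinates_closed a z
    by (rule bilinear_extend_assoc) (auto simp: tabloid_act_comp)
  then show ?case
    using outer_value_smult[OF \<alpha> \<beta> a balanced(3)]
    unfolding frag_linear_diff frag_linear_of cell_value_def split base_coordinates_smult[OF a x] by simp
qed (auto simp: frag_linear_add frag_linear_uminus)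

text \<open>The base diagram has trivial stabilizer, so its coordinate is the identity and the value
  of the tensor is the product of two polytabloids. Its coefficient at the two tabloids of
  \<open>T\<close> and \<open>T'\<close> is 1.\<close>

lemma pure_nonzero:
  assumes T: "T \<in> tableaux \<alpha>" "T' \<in> tableaux \<beta>"
  shows "C.pure (Poly_Mapping.single (base_half r s t) 1) (O.pure (polytabloid \<alpha> T) (polytabloid \<beta> T')) \<noteq> C.tclass 0"
proof
  let ?B = "base_half r s t" and ?y = "O.pure (polytabloid \<alpha> T) (polytabloid \<beta> T')"
  let ?t = "tabloid_of \<alpha> T" and ?t' = "tabloid_of \<beta> T'"
  assume "C.pure (Poly_Mapping.single ?B 1) ?y = C.tclass 0"
  then have "frag_of (Poly_Mapping.single ?B 1, ?y) \<in> C.tkernel"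
    by (simp add: C.pure_def C.tclass_eq_iff)
  from cell_value_kernel[OF this]
  have zero: "pair_act (base_coordinates (Poly_Mapping.single ?B 1)) (outer_value ?y) = 0"
    by (simp add: cell_value_def)
  have B: "?B \<in> half" by (rule base_half[OF t])
  have "{g \<in> carrier young. south_act (r - t) g ?B = ?B} = {(id, id)}"
  proof (intro equalityI subsetI)
    fix g assume "g \<in> {g \<in> carrier young. south_act (r - t) g ?B = ?B}"
    then show "g \<in> {(id, id)}"
      using south_act_free[OF half_walled[OF t B] half_no_arcs[OF t B]] by blast
  next
    fix g :: "(nat \<Rightarrow> nat) \<times> (nat \<Rightarrow> nat)" assume "g \<in> {(id, id)}"
    then show "g \<in> {g \<in> carrier young. south_act (r - t) g ?B = ?B}"
      using south_act_one identity_young[OF \<alpha> \<beta>] by blast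
  qed
  then have "base_coordinates (Poly_Mapping.single ?B 1) = Poly_Mapping.single (id, id) 1"
    unfolding base_coordinates_single by (simp only: sum.insert sum.empty finite.emptyI) simp
  moreover have "outer_value ?y = tabloid_tensor (polytabloid \<alpha> T) (polytabloid \<beta> T')"
    by (simp add: O.pure_def outer_value_tclass[OF \<alpha> \<beta>])
  ultimately have "tabloid_tensor (polytabloid \<alpha> T) (polytabloid \<beta> T') = (0 :: tabloid \<times> tabloid \<Rightarrow>\<^sub>0 'k)"
    using zero pair_act_tabloid_tensor[of id id 1 "polytabloid \<alpha> T :: tabloid \<Rightarrow>\<^sub>0 'k" "polytabloid \<beta> T'" \<alpha> \<beta>]
    by (simp only: specht_act_id scale_one)
  then have "Poly_Mapping.lookup (tabloid_tensor (polytabloid \<alpha> T) (polytabloid \<beta> T')) (?t, ?t') = (0 :: 'k)" by simp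
  then show False unfolding lookup_tabloid_tensor lookup_polytabloid[OF T(1)] lookup_polytabloid[OF T(2)] by simp
qed

section \<open>Finite generation of the cell module\<close>

definition cell_generators :: "'k cell_elem set" where
  "cell_generators = (\<lambda>(D, v, w). C.pure (Poly_Mapping.single D 1) (O.pure v w)) `
     (half \<times> polytabloid \<alpha> ` tableaux \<alpha> \<times> polytabloid \<beta> ` tableaux \<beta>)"

lemma finite_cell_generators: "finite cell_generators"
proof -
  have "finite half"
    using finite_subset[OF _ finite_walled_diagrams[of r s "r - t" "s - t"]] by (auto simp: half_diagrams_def)
  then show ?thesis unfolding cell_generators_def by (intro finite_imageI finite_cartesian_product finite_polytabloids)
qed

lemma polytabloid_in_specht: "T \<in> tableaux \<gamma> \<Longrightarrow> polytabloid \<gamma> T \<in> carrier (specht_module \<gamma>)"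
  using specht_polytabloid[of T \<gamma> 1] by simp

lemma outer_pure_closed:
  "v \<in> carrier (specht_module \<alpha>) \<Longrightarrow> w \<in> carrier (specht_module \<beta>) \<Longrightarrow> O.pure v w \<in> carrier outer_specht"
  unfolding carrier_outer[OF \<alpha> \<beta>] O.pure_def by (intro imageI) simp

lemma cell_generators_subset: "cell_generators \<subseteq> carrier cell"
proof -
  have "C.pure (Poly_Mapping.single D 1) (O.pure (polytabloid \<alpha> T) (polytabloid \<beta> T')) \<in> carrier cell"
    if "D \<in> half" "T \<in> tableaux \<alpha>" "T' \<in> tableaux \<beta>" for D T T'
    using that outer_pure_closed[OF polytabloid_in_specht polytabloid_in_specht]
    unfolding carrier_cell C.pure_def by (intro imageI) simp
  then show ?thesis by (auto simp: cell_generators_def)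
qed

text \<open>Biadditivity reduces membership in \<open>N\<close> to tensors of a diagram and two
  polytabloids, each with a scalar. Over the algebra the scalars come for free, since they are
  multiples of its identity.\<close>

lemma cell_generated:
  assumes N: "submodule N brauer cell" and gen: "cell_generators \<subseteq> N"
  shows "N = carrier cell"
proof -
  have sub: "subgroup N (add_monoid cell)" by (rule submodule.axioms(1)[OF N])
  have N0: "C.tclass 0 \<in> N" using subgroup.one_closed[OF sub] by (simp add: cell_zero)
  have Nadd: "C.tclass (c + d) \<in> N" if "C.tclass c \<in> N" "C.tclass d \<in> N" for c d
    using subgroup.m_closed[OF sub that] by (simp add: cell_add)
  interpret cell: left_module brauer cell by (rule left_module_cell)
  have Nneg: "C.tclass (- c) \<in> N" if c: "C.tclass c \<in> N" "c \<in> C.frags" for c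
  proof -
    have "\<ominus>\<^bsub>cell\<^esub> C.tclass c = C.tclass (- c)"
      by (rule cell.M.minus_equality) (use c(2) in \<open>auto simp: carrier_cell cell_add cell_zero\<close>)
    then show ?thesis using subgroup.m_inv_closed[OF sub c(1)] by (simp add: a_inv_def)
  qed
  have Nadd_pure: "C.pure x (y \<oplus>\<^bsub>outer_specht\<^esub> y') \<in> N"
    if "C.pure x y \<in> N" "C.pure x y' \<in> N" "x \<in> lin_comb half" "y \<in> carrier outer_specht" "y' \<in> carrier outer_specht"
    for x y y'
    using that Nadd C.pure_right_add[of x y y'] by (simp add: C.pure_def)
  have Nscale: "C.pure (scale \<mu> x) y \<in> N" if "C.pure x y \<in> N" "x \<in> lin_comb half" for \<mu> x y
  proof -
    have "brauer_scalar r s \<mu> \<odot>\<^bsub>cell\<^esub> C.pure x y = C.pure (scale \<mu> x) y"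
      unfolding C.pure_def cell_smult[OF scale_one_diagram] frag_extend_of cell_act_def split half_left_scalar[OF t that(2)] ..
    then show ?thesis using submodule.smult_closed[OF N scale_one_diagram that(1)] by metis
  qed
  have zero_outer: "C.pure x (O.tclass 0) \<in> N" if "x \<in> lin_comb half" for x
  proof -
    have "O.tclass 0 \<in> carrier outer_specht" unfolding carrier_outer[OF \<alpha> \<beta>] by (rule imageI) simp
    then have "C.pure x (O.tclass 0) = C.tclass 0"
      using that by (intro C.pure_right_zero) (simp_all add: outer_add[OF \<alpha> \<beta>])
    then show ?thesis using N0 by simp
  qed
  \<comment> \<open>The scalars on the polytabloids are moved across both tensor signs to the
    diagram, where they become the action of an element of the algebra.\<close>
  have polys: "C.pure (Poly_Mapping.single D d) (O.pure (scale c (polytabloid \<alpha> T)) (scale c' (polytabloid \<beta> T'))) \<in> N"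
    if D: "D \<in> half" and T: "T \<in> tableaux \<alpha>" "T' \<in> tableaux \<beta>" for D d c c' T T'
  proof -
    let ?e = "polytabloid \<alpha> T :: tabloid \<Rightarrow>\<^sub>0 'k" and ?e' = "polytabloid \<beta> T' :: tabloid \<Rightarrow>\<^sub>0 'k"
    have e: "?e \<in> carrier (specht_module \<alpha>)" "?e' \<in> carrier (specht_module \<beta>)"
      using T by (auto intro: polytabloid_in_specht)
    have "O.pure (scale (c' * c) ?e) ?e' = O.pure (scale c ?e) (scale c' ?e')"
      using kernel_scale[OF \<alpha> \<beta> specht_scale[OF e(1)] e(2), of c' c]
      by (simp add: O.pure_def O.tclass_eq_iff)
    then have "O.pure (scale c ?e) (scale c' ?e') = O.pure (scale (c' * c) ?e) ?e'" ..
    also have "\<dots> = Poly_Mapping.single (id, id) (c' * c) \<odot>\<^bsub>outer_specht\<^esub> O.pure ?e ?e'"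
      by (rule outer_scalar[OF \<alpha> \<beta> e, symmetric])
    finally have "C.pure (Poly_Mapping.single D d) (O.pure (scale c ?e) (scale c' ?e')) =
        C.pure (scale (c' * c) (Poly_Mapping.single D d)) (O.pure ?e ?e')"
      using pure_scale[of "Poly_Mapping.single D d" "O.pure ?e ?e'" "c' * c"] outer_pure_closed[OF e] D by simp
    also have "scale (c' * c) (Poly_Mapping.single D d) = scale (c' * c * d) (Poly_Mapping.single D 1)" by simp
    also have "C.pure \<dots> (O.pure ?e ?e') \<in> N"
    proof (rule Nscale)
      show "C.pure (Poly_Mapping.single D 1) (O.pure ?e ?e') \<in> N"
        by (rule subsetD[OF gen], unfold cell_generators_def, rule image_eqI[of _ _ "(D, ?e, ?e')"])
          (use D T in simp_all)
    qed (use D in simp)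
    finally show ?thesis .
  qed
  have basis: "C.pure (Poly_Mapping.single D d) (O.pure v w) \<in> N"
    if D: "D \<in> half" and v: "v \<in> carrier (specht_module \<alpha>)" and w: "w \<in> carrier (specht_module \<beta>)" for D d v w
  proof -
    have x: "Poly_Mapping.single D d \<in> lin_comb half" using D by simp
    show ?thesis using v
    proof (induction v rule: specht_induct)
      case zero
      have "O.pure 0 w = O.tclass 0" by (rule O.pure_left_zero) (use w in \<open>simp_all add: specht_zero\<close>)
      then show ?case using zero_outer[OF x] by simp
    next
      case (add v v')
      have "O.pure (v + v') w = O.pure v w \<oplus>\<^bsub>outer_specht\<^esub> O.pure v' w"
        using O.pure_left_add[of v v' w] add w by (simp add: O.pure_def outer_add[OF \<alpha> \<beta>])
      then show ?case using add w x by (simp add: Nadd_pure outer_pure_closed)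
    next
      case (polytabloid T c)
      have e: "scale c (polytabloid \<alpha> T) \<in> carrier (specht_module \<alpha>)" by (rule specht_polytabloid[OF polytabloid])
      show ?case using w
      proof (induction w rule: specht_induct)
        case zero
        have "O.pure (scale c (polytabloid \<alpha> T)) 0 = O.tclass 0"
          by (rule O.pure_right_zero) (use e in \<open>simp_all add: specht_zero\<close>)
        then show ?case using zero_outer[OF x] by simp
      next
        case (add w w')
        have "O.pure (scale c (polytabloid \<alpha> T)) (w + w') =
            O.pure (scale c (polytabloid \<alpha> T)) w \<oplus>\<^bsub>outer_specht\<^esub> O.pure (scale c (polytabloid \<alpha> T)) w'"
          using O.pure_right_add[of "scale c (polytabloid \<alpha> T)" w w'] add e
          by (simp add: O.pure_def outer_add[OF \<alpha> \<beta>])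
        then show ?case using add e x by (simp add: Nadd_pure outer_pure_closed)
      next
        case (polytabloid T' c')
        then show ?case by (rule polys[OF D \<open>T \<in> tableaux \<alpha>\<close>])
      qed
    qed
  qed
  have single_pure: "C.pure (Poly_Mapping.single D d) y \<in> N" if D: "D \<in> half" and y: "y \<in> carrier outer_specht" for D d y
  proof -
    have x: "Poly_Mapping.single D d \<in> lin_comb half" using D by simp
    obtain c where c: "c \<in> O.frags" "y = O.tclass c" using y by (auto simp: carrier_outer[OF \<alpha> \<beta>])
    have cl: "O.tclass c \<in> carrier outer_specht" if "c \<in> O.frags" for c
      using that by (auto simp: carrier_outer[OF \<alpha> \<beta>])
    have "C.pure (Poly_Mapping.single D d) (O.tclass c) \<in> N"
      using c(1)
    proof (induction c rule: O.frags_induct_add)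
      case zero show ?case by (rule zero_outer[OF x])
    next
      case (of v w)
      then show ?case using basis[OF D, of v w] by (simp add: O.pure_def)
    next
      case (neg c)
      let ?x = "Poly_Mapping.single D d"
      \<comment> \<open>Additivity in the second factor makes the tensor with \<open>- c\<close>
        inverse to the tensor with \<open>c\<close>, and \<open>N\<close> is closed under
        inverses.\<close>
      have "C.tclass 0 = C.pure ?x (O.tclass c \<oplus>\<^bsub>outer_specht\<^esub> O.tclass (- c))"
        using C.pure_right_zero[of ?x "O.tclass 0"] x cl[of 0] by (simp add: outer_add[OF \<alpha> \<beta>])
      also have "\<dots> = C.tclass (frag_of (?x, O.tclass c) + frag_of (?x, O.tclass (- c)))"
        by (rule C.pure_right_add) (use x cl neg in auto)
      finally have "C.tclass (0 - frag_of (?x, O.tclass c)) =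
          C.tclass (frag_of (?x, O.tclass c) + frag_of (?x, O.tclass (- c)) - frag_of (?x, O.tclass c))"
        by (rule C.tclass_diff_cong) (rule refl)
      then have "C.pure ?x (O.tclass (- c)) = C.tclass (- frag_of (?x, O.tclass c))"
        by (simp add: C.pure_def)
      also have "\<dots> \<in> N" by (rule Nneg) (use neg x cl in \<open>auto simp: C.pure_def\<close>)
      finally show ?case .
    next
      case (add c c')
      then show ?case
        using Nadd_pure[of "Poly_Mapping.single D d" "O.tclass c" "O.tclass c'"] x cl by (simp add: outer_add[OF \<alpha> \<beta>])
    qed
    then show ?thesis by (simp add: c(2))
  qed
  have pure: "C.pure x y \<in> N" if x: "x \<in> lin_comb half" and y: "y \<in> carrier outer_specht" for x y
    using x
  proof (induction x rule: lin_comb_induct)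
    case zero
    have "C.pure 0 y = C.tclass 0" by (rule C.pure_left_zero) (use y in simp_all)
    then show ?case using N0 by simp
  next
    case (single D d) then show ?case by (rule single_pure[OF _ y])
  next
    case (add x x')
    then show ?case using C.pure_left_add[of x x' y] y Nadd by (simp add: C.pure_def)
  qed
  have "C.tclass c \<in> N" if "c \<in> C.frags" for c
    using that
  proof (induction c rule: C.frags_induct_add)
    case (of x y)
    then show ?case using pure[of x y] by (simp add: C.pure_def)
  qed (use N0 Nneg Nadd in auto)
  then show ?thesis using subgroup.subset[OF sub] by (auto simp: carrier_cell)
qed

lemma cell_maximal_submodule: obtains N where "maximal_submodule brauer cell N"
proof -
  interpret cell: left_module brauer cell by (rule left_module_cell)
  obtain T T' where T: "T \<in> tableaux \<alpha>" "T' \<in> tableaux \<beta>" using tableau_exists by metis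
  have "C.pure (Poly_Mapping.single (base_half r s t) 1) (O.pure (polytabloid \<alpha> T) (polytabloid \<beta> T')) \<in> cell_generators"
    using T base_half[OF t] by (force simp: cell_generators_def)
  then have "carrier cell \<noteq> {\<zero>\<^bsub>cell\<^esub>}"
    using cell_generators_subset pure_nonzero[OF T] by (auto simp: cell_zero)
  then show thesis
    using cell.maximal_submodule_exists[OF finite_cell_generators cell_generators_subset cell_generated] that by blast
qed

end

theorem corollary4p3:
  fixes \<delta> :: "'k::alg_closed_field"
    and r s a b t :: nat
    and lamL lamR muL muR :: "nat list"
  assumes "a \<le> min r s" and "b \<le> min r s" and "b = a + t"
    and "(lamL, lamR) \<in> bipartitions (r - a) (s - a)"
    and "(muL, muR) \<in> bipartitions (r - b) (s - b)"
    and "(lamL, lamR) \<in> simple_labels \<delta> r s a"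
    and "(muL, muR) \<in> simple_labels \<delta> r s b"
    and "same_block (walled_brauer \<delta> r s)
           (simple_module \<delta> r s a (lamL, lamR)) (simple_module \<delta> r s b (muL, muR))"
  shows "of_nat t * \<delta>
           + (\<Sum>d\<in>young_diagram lamL. of_int (box_content d))
           + (\<Sum>d\<in>young_diagram lamR. of_int (box_content d))
           - (\<Sum>d\<in>young_diagram muL. of_int (box_content d))
           - (\<Sum>d\<in>young_diagram muR. of_int (box_content d)) = 0"
proof -
  interpret algebra_over_field "walled_brauer \<delta> r s" "brauer_scalar r s" by (rule algebra_walled_brauer)
  have lam: "is_partition lamL (r - a)" "is_partition lamR (s - a)"
    and mu: "is_partition muL (r - b)" "is_partition muR (s - b)"
    using assms by (auto simp: bipartitions_def)
  have cas: "casimir r s \<in> carrier (walled_brauer \<delta> r s)" by (simp add: casimir_closed)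
  obtain P where P: "P \<noteq> 0" "eval_poly (casimir r s) P = 0"
    by (rule annihilating_polynomial[OF cas casimir_central])
  obtain N where N: "maximal_submodule (walled_brauer \<delta> r s) (cell_module \<delta> r s a (lamL, lamR)) N"
    by (rule cell_maximal_submodule[OF assms(1) lam])
  obtain N' where N': "maximal_submodule (walled_brauer \<delta> r s) (cell_module \<delta> r s b (muL, muR)) N'"
    by (rule cell_maximal_submodule[OF assms(2) mu])
  \<comment> \<open>On each cell module the central element acts by the content sum minus the number
    of arcs times \<open>\<delta>\<close>; with \<open>b = a + t\<close> the equality of the two
    scalars is the claim.\<close>
  have "content_scalar lamL lamR - of_nat a * \<delta> = content_scalar muL muR - of_nat b * \<delta>"
    by (rule same_block_imp_eq_char[OF cas casimir_central
        left_module_cell[OF assms(1) lam] left_module_cell[OF assms(2) mu]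
        casimir_cell[OF assms(1) lam] casimir_cell[OF assms(2) mu] N N'
        assms(8)[unfolded simple_module_def] P(1)]) (use P(2) in simp_all)
  then show ?thesis by (simp add: content_scalar_def[OF lam] content_scalar_def[OF mu] assms(3) algebra_simps)
qed

end
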